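(* Let $\rho,\sigma$ be $n$-qubit mixed states with $\rho\ge I/\kappa_\rho$ and $\sigma\ge I/\kappa_\sigma$ for known $\kappa_\rho,\kappa_\sigma\ge1$, and let $\mathcal O_\rho,\mathcal O_\sigma$ be unitaries preparing purifications of $\rho$ and $\sigma$. Then there is a quantum algorithm that, for any $\epsilon\in(0,1)$, outputs an estimate of the fidelity $F(\rho,\sigma)$ within additive error $\epsilon$ with probability at least $2/3$, using $\widetilde O\big(\min\{\kappa_\rho^2,\kappa_\sigma^2\}\cdot\kappa_\rho\kappa_\sigma/\epsilon\big)$ queries to $\mathcal O_\rho$ and $\mathcal O_\sigma$.
   Context: The (Uhlmann) fidelity is $F(\rho,\sigma):=\operatorname{Tr}\big((\sigma^{1/2}\rho\sigma^{1/2})^{1/2}\big)$. A unitary $\mathcal O_\rho$ on $n+a$ qubits prepares a purification of $\rho$ if $\operatorname{Tr}_a(\mathcal O_\rho|0\rangle\langle0|\mathcal O_\rho^\dagger)=\rho$, tracing out the $a$ ancilla qubits. A query means one use of any of $\mathcal O$, $\mathcal O^\dagger$, controlled-$\mathcal O$, controlled-$\mathcal O^\dagger$. $\widetilde O(\cdot)$ hides factors polylogarithmic in $\kappa_\rho,\kappa_\sigma,1/\epsilon$. Inequalities are in the Loewner order. *)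

theory Defs
  imports Complex_Main "Jordan_Normal_Form.Matrix"
begin

definition cadj :: "complex mat \<Rightarrow> complex mat" where
  "cadj A = mat (dim_col A) (dim_row A) (\<lambda>(i,j). cnj (A $$ (j,i)))"

definition mtrace :: "complex mat \<Rightarrow> complex" where
  "mtrace A = (\<Sum>i<dim_row A. A $$ (i,i))"

definition psd :: "nat \<Rightarrow> complex mat \<Rightarrow> bool" where
  "psd d A \<longleftrightarrow> A \<in> carrier_mat d d \<and>
     (\<forall>v \<in> carrier_vec d. let q = (\<Sum>i<d. cnj (v $ i) * (A *\<^sub>v v) $ i)
                             in Im q = 0 \<and> Re q \<ge> 0)"

definition loewner_le :: "nat \<Rightarrow> complex mat \<Rightarrow> complex mat \<Rightarrow> bool" where
  "loewner_le d A B \<longleftrightarrow> A \<in> carrier_mat d d \<and> B \<in> carrier_mat d d \<and> psd d (B - A)"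

definition msqrt :: "nat \<Rightarrow> complex mat \<Rightarrow> complex mat" where
  "msqrt d A = (THE S. psd d S \<and> S * S = A)"

definition fidelity :: "nat \<Rightarrow> complex mat \<Rightarrow> complex mat \<Rightarrow> real" where
  "fidelity d \<rho> \<sigma> = Re (mtrace (msqrt d (msqrt d \<sigma> * \<rho> * msqrt d \<sigma>)))"

definition density :: "nat \<Rightarrow> complex mat \<Rightarrow> bool" where
  "density n \<rho> \<longleftrightarrow> psd (2^n) \<rho> \<and> mtrace \<rho> = 1"

definition unitary_mat :: "nat \<Rightarrow> complex mat \<Rightarrow> bool" where
  "unitary_mat d U \<longleftrightarrow> U \<in> carrier_mat d d \<and> cadj U * U = 1\<^sub>m d"

(* Kronecker product; the first factor corresponds to the leading (most significant) qubits *)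
definition kron :: "complex mat \<Rightarrow> complex mat \<Rightarrow> complex mat" where
  "kron A B = mat (dim_row A * dim_row B) (dim_col A * dim_col B)
     (\<lambda>(i,j). A $$ (i div dim_row B, j div dim_col B) * B $$ (i mod dim_row B, j mod dim_col B))"

definition ptrace2 :: "nat \<Rightarrow> nat \<Rightarrow> complex mat \<Rightarrow> complex mat" where
  "ptrace2 d e M = mat d d (\<lambda>(i,j). \<Sum>l<e. M $$ (i*e + l, j*e + l))"

(* O on n+a qubits (system first, ancilla last) prepares a purification of rho:
   Tr_a(O |0><0| O^dagger) = rho *)
definition purifies :: "nat \<Rightarrow> nat \<Rightarrow> complex mat \<Rightarrow> complex mat \<Rightarrow> bool" where
  "purifies n a W \<rho> \<longleftrightarrow>
     (let P = mat (2^(n+a)) (2^(n+a)) (\<lambda>(i,j). (if i = 0 \<and> j = 0 then 1 else 0))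
      in ptrace2 (2^n) (2^a) (W * P * cadj W) = \<rho>)"

datatype oracle_sel = OrRho | OrSigma
datatype query_kind = QPlain | QAdj | QCtrl | QCtrlAdj

definition proj0 :: "complex mat" where
  "proj0 = mat 2 2 (\<lambda>(i,j). if i = 0 \<and> j = 0 then 1 else 0)"
definition proj1 :: "complex mat" where
  "proj1 = mat 2 2 (\<lambda>(i,j). if i = 1 \<and> j = 1 then 1 else 0)"

definition ctrl :: "complex mat \<Rightarrow> complex mat" where
  "ctrl U = kron proj0 (1\<^sub>m (dim_row U)) + kron proj1 U"

fun query_gate :: "query_kind \<Rightarrow> complex mat \<Rightarrow> complex mat" where
  "query_gate QPlain U = U"
| "query_gate QAdj U = cadj U"
| "query_gate QCtrl U = ctrl U"
| "query_gate QCtrlAdj U = ctrl (cadj U)"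

(* embed a gate acting on the leading qubits into an m-qubit workspace
   (placement is w.l.o.g. since arbitrary unitaries are interleaved) *)
definition embed :: "nat \<Rightarrow> complex mat \<Rightarrow> complex mat" where
  "embed m G = kron G (1\<^sub>m (2^m div dim_row G))"

definition sel_oracle :: "oracle_sel \<Rightarrow> complex mat \<Rightarrow> complex mat \<Rightarrow> complex mat" where
  "sel_oracle s Or Os = (case s of OrRho \<Rightarrow> Or | OrSigma \<Rightarrow> Os)"

fun run_steps :: "complex mat \<Rightarrow> complex mat \<Rightarrow> nat \<Rightarrow>
    (oracle_sel \<times> query_kind \<times> complex mat) list \<Rightarrow> complex vec \<Rightarrow> complex vec" where
  "run_steps Or Os m [] v = v"
| "run_steps Or Os m ((s,k,U) # rest) v =
     run_steps Or Os m rest (U *\<^sub>v (embed m (query_gate k (sel_oracle s Or Os)) *\<^sub>v v))"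

(* A query algorithm on m qubits: initial unitary U0, a list of steps (query, unitary),
   and a classical post-processing map applied to the computational-basis measurement outcome. *)
definition valid_alg :: "nat \<Rightarrow> nat \<Rightarrow> nat \<Rightarrow> nat \<Rightarrow> complex mat \<Rightarrow>
    (oracle_sel \<times> query_kind \<times> complex mat) list \<Rightarrow> bool" where
  "valid_alg n ar as m U0 steps \<longleftrightarrow> n + ar + 1 \<le> m \<and> n + as + 1 \<le> m \<and>
     unitary_mat (2^m) U0 \<and> (\<forall>(s,k,U) \<in> set steps. unitary_mat (2^m) U)"

definition final_state :: "complex mat \<Rightarrow> complex mat \<Rightarrow> nat \<Rightarrow> complex mat \<Rightarrow>
    (oracle_sel \<times> query_kind \<times> complex mat) list \<Rightarrow> complex vec" where
  "final_state Or Os m U0 steps = run_steps Or Os m steps (U0 *\<^sub>v unit_vec (2^m) 0)"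

definition out_prob :: "complex mat \<Rightarrow> complex mat \<Rightarrow> nat \<Rightarrow> complex mat \<Rightarrow>
    (oracle_sel \<times> query_kind \<times> complex mat) list \<Rightarrow> (nat \<Rightarrow> real) \<Rightarrow> real set \<Rightarrow> real" where
  "out_prob Or Os m U0 steps out S =
     (\<Sum>j | j < 2^m \<and> out j \<in> S. (cmod (final_state Or Os m U0 steps $ j))^2)"

end

theory Submission
  imports Defs "Jordan_Normal_Form.Spectral_Radius" "HOL-Analysis.L2_Norm"
begin

text \<open>
  Write \<open>d = 2\<^sup>n\<close>. A state with \<open>\<rho> \<ge> I/\<kappa>\<close> has trace one, so \<open>d \<le> \<kappa>\<close>; the query budget therefore pays for learning
  both density matrices in Frobenius norm, at Heisenberg scaling, and outputting the fidelity of any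
  consistent pair.

  The fidelity is stable: with \<open>R = \<rho>\<^sup>1\<^sup>/\<^sup>2\<close>, \<open>S = \<sigma>\<^sup>1\<^sup>/\<^sup>2\<close> it is the trace norm of \<open>R S\<close>, hence changes by at most
  \<open>\<parallel>R - R'\<parallel> + \<parallel>S - S'\<parallel>\<close>, and the square root is \<open>\<kappa>\<close>-Lipschitz above \<open>I/\<kappa>\<close>.

  Every entry of \<open>\<rho>\<close> follows from overlaps \<open><v|\<rho>|v>\<close> with \<open>v = e\<^sub>i + c e\<^sub>j\<close>, \<open>c = 1\<close> or \<open>c = \<i>\<close>. Conjugating a
  suitable reflection by the oracle gives a reflection \<open>Q\<close> whose vacuum expectation \<open>cos \<phi>\<close> is an affine
  function of the overlap; alternating \<open>Q\<close> with \<open>2|0><0| - I\<close> for \<open>j\<close> rounds turns the vacuum amplitude into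
  the Chebyshev value \<open>cos (j \<phi>)\<close>. Constant-accuracy frequencies of the vacuum outcome for \<open>j = 2\<^sup>k\<close> and
  \<open>j = 2\<^sup>k + 1\<close>, \<open>k \<le> K\<close>, determine the overlap up to \<open>O(2\<^sup>-\<^sup>K)\<close>. All runs sit on separate registers, so
  their outcomes are independent and a Chernoff bound costs only a logarithmic factor.
\<close>

section \<open>Matrix entries and adjoints\<close>

text \<open>With d = 2^n, accuracy h in each of O(d^2) overlaps costs O(d^2/h) queries up to
  logarithms. It gives Frobenius error O(d h) and so fidelity error O((\<kappa>1 + \<kappa>2) d h).
  Taking h of order \<epsilon>/(d (\<kappa>1 + \<kappa>2)) costs d^3 (\<kappa>1 +
  \<kappa>2)/\<epsilon>. This fits the target because d is at most each of \<kappa>1 and \<kappa>2: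
  the factor d^2 is paid by the minimum of the squares, the last d by one of the two bounds. The
  query model has a single final measurement, so the probes are fixed in advance and none adapts to
  an earlier outcome. The post-processing may be any function, so it simply selects some pair of
  states consistent with the outcomes. The circuit must be fixed before the oracles are known; hence
  the states of a circuit are handled as functions of the oracle assignment. The square root in the
  fidelity is a definite description. Its existence and uniqueness are proved by deflation and by
  trace identities, and the same identities give the Lipschitz bound.\<close>

lemma mat_mult_entry:
  "A \<in> carrier_mat a b \<Longrightarrow> B \<in> carrier_mat b c \<Longrightarrow> i < a \<Longrightarrow> j < c \<Longrightarrow>
   (A * B) $$ (i,j) = (\<Sum>k<b. A $$ (i,k) * B $$ (k,j))"
  by (auto simp: scalar_prod_def atLeast0LessThan intro!: sum.cong)

lemma mat_vec_entry:
  "A \<in> carrier_mat a b \<Longrightarrow> v \<in> carrier_vec b \<Longrightarrow> i < a \<Longrightarrow>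
   (A *\<^sub>v v) $ i = (\<Sum>k<b. A $$ (i,k) * v $ k)"
  by (auto simp: scalar_prod_def atLeast0LessThan intro!: sum.cong)

lemma cadj_carrier [simp]: "cadj A \<in> carrier_mat m n \<longleftrightarrow> A \<in> carrier_mat n m"
  unfolding cadj_def by (metis carrier_matD carrier_matI dim_row_mat(1) dim_col_mat(1))

lemma cadj_dim [simp]: "dim_row (cadj A) = dim_col A" "dim_col (cadj A) = dim_row A"
  by (auto simp: cadj_def)

lemma cadj_entry [simp]: "i < dim_col A \<Longrightarrow> j < dim_row A \<Longrightarrow> cadj A $$ (i,j) = cnj (A $$ (j,i))"
  by (simp add: cadj_def)

lemma cadj_cadj [simp]: "cadj (cadj A) = A"
  by (rule eq_matI) (auto simp: cadj_def)

lemma cadj_one [simp]: "cadj (1\<^sub>m n) = 1\<^sub>m n"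
  by (rule eq_matI) (auto simp: cadj_def)

lemma cadj_mult:
  assumes "A \<in> carrier_mat a b" "B \<in> carrier_mat b c"
  shows "cadj (A * B) = cadj B * cadj A"
proof (rule eq_matI)
  fix i j assume "i < dim_row (cadj B * cadj A)" "j < dim_col (cadj B * cadj A)"
  then have ij: "i < c" "j < a" using assms by auto
  have "cadj (A * B) $$ (i,j) = cnj ((A * B) $$ (j,i))" using ij assms by simp
  also have "\<dots> = (\<Sum>k<b. cnj (A $$ (j,k)) * cnj (B $$ (k,i)))"
    using ij by (simp add: mat_mult_entry[OF assms] del: index_mult_mat)
  also have "\<dots> = (\<Sum>k<b. cadj B $$ (i,k) * cadj A $$ (k,j))"
    using ij assms by (intro sum.cong) auto
  also have "\<dots> = (cadj B * cadj A) $$ (i,j)"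
    by (rule mat_mult_entry[symmetric]) (use ij assms in auto)
  finally show "cadj (A * B) $$ (i,j) = (cadj B * cadj A) $$ (i,j)" .
qed (use assms in auto)

lemma cadj_minus:
  "A \<in> carrier_mat a b \<Longrightarrow> B \<in> carrier_mat a b \<Longrightarrow> cadj (A - B) = cadj A - cadj B"
  by (rule eq_matI) auto

lemma cadj_add:
  "A \<in> carrier_mat a b \<Longrightarrow> B \<in> carrier_mat a b \<Longrightarrow> cadj (A + B) = cadj A + cadj B"
  by (rule eq_matI) auto

section \<open>Trace and Frobenius norm\<close>

lemma mtrace_mult:
  assumes "A \<in> carrier_mat a b" "B \<in> carrier_mat b a"
  shows "mtrace (A * B) = (\<Sum>i<a. \<Sum>k<b. A $$ (i,k) * B $$ (k,i))"
proof -
  have "dim_row (A * B) = a" using assms by simp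
  then show ?thesis
    by (simp add: mtrace_def mat_mult_entry[OF assms] del: index_mult_mat)
qed

lemma mtrace_comm:
  assumes "A \<in> carrier_mat a b" "B \<in> carrier_mat b a"
  shows "mtrace (A * B) = mtrace (B * A)"
  unfolding mtrace_mult[OF assms] mtrace_mult[OF assms(2,1)]
  by (subst sum.swap) (simp add: mult.commute)

lemma mtrace_add:
  "A \<in> carrier_mat a a \<Longrightarrow> B \<in> carrier_mat a a \<Longrightarrow> mtrace (A + B) = mtrace A + mtrace B"
  by (simp add: mtrace_def sum.distrib)

lemma mtrace_minus:
  "A \<in> carrier_mat a a \<Longrightarrow> B \<in> carrier_mat a a \<Longrightarrow> mtrace (A - B) = mtrace A - mtrace B"
  by (simp add: mtrace_def sum_subtractf)

text \<open>Expressed through \<open>L2_set\<close> so that Cauchy-Schwarz is inherited from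
  \<open>L2_set_mult_ineq\<close>.\<close>

definition frob :: "complex mat \<Rightarrow> real" where
  "frob A = L2_set (\<lambda>x. cmod (A $$ x)) ({..<dim_row A} \<times> {..<dim_col A})"

lemma frob_nonneg [simp]: "0 \<le> frob A"
  by (simp add: frob_def L2_set_nonneg)

lemma frob_sq: "A \<in> carrier_mat a b \<Longrightarrow> (frob A)\<^sup>2 = (\<Sum>i<a. \<Sum>j<b. (cmod (A $$ (i,j)))\<^sup>2)"
  by (auto simp: frob_def L2_set_def sum_nonneg sum.cartesian_product intro!: sum.cong)

lemma mtrace_cadj_mult:
  assumes "A \<in> carrier_mat a b" "B \<in> carrier_mat a b"
  shows "mtrace (cadj A * B) = (\<Sum>i<a. \<Sum>j<b. cnj (A $$ (i,j)) * B $$ (i,j))"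
proof -
  have "mtrace (cadj A * B) = (\<Sum>i<b. \<Sum>k<a. cadj A $$ (i,k) * B $$ (k,i))"
    by (rule mtrace_mult) (use assms in auto)
  also have "\<dots> = (\<Sum>i<b. \<Sum>k<a. cnj (A $$ (k,i)) * B $$ (k,i))"
    using assms by (intro sum.cong) auto
  finally show ?thesis by (subst (asm) sum.swap)
qed

lemma mtrace_cadj_self:
  assumes "A \<in> carrier_mat a b"
  shows "mtrace (cadj A * A) = complex_of_real ((frob A)\<^sup>2)"
  unfolding mtrace_cadj_mult[OF assms assms] frob_sq[OF assms]
  by (simp add: complex_norm_square mult.commute del: of_real_power)

lemma frob_eq_0:
  assumes "A \<in> carrier_mat a b" "frob A = 0" shows "A = 0\<^sub>m a b"
proof (rule eq_matI)
  fix i j assume "i < dim_row (0\<^sub>m a b :: complex mat)" "j < dim_col (0\<^sub>m a b :: complex mat)"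
  then have "(i,j) \<in> {..<a} \<times> {..<b}" by auto
  with assms show "A $$ (i,j) = 0\<^sub>m a b $$ (i,j)"
    unfolding frob_def by (subst (asm) L2_set_eq_0_iff) auto
qed (use assms in auto)

lemma frob_Cauchy_Schwarz:
  assumes "A \<in> carrier_mat a b" "B \<in> carrier_mat a b"
  shows "cmod (mtrace (cadj A * B)) \<le> frob A * frob B"
proof -
  have "cmod (mtrace (cadj A * B)) = cmod (\<Sum>(i,j)\<in>{..<a}\<times>{..<b}. cnj (A $$ (i,j)) * B $$ (i,j))"
    by (simp add: mtrace_cadj_mult[OF assms] sum.cartesian_product)
  also have "\<dots> \<le> (\<Sum>x\<in>{..<a}\<times>{..<b}. \<bar>cmod (A $$ x)\<bar> * \<bar>cmod (B $$ x)\<bar>)"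
    by (rule order.trans[OF norm_sum]) (auto simp: norm_mult intro!: sum_mono)
  also have "\<dots> \<le> frob A * frob B"
    using L2_set_mult_ineq[of "\<lambda>x. cmod (A $$ x)" "\<lambda>x. cmod (B $$ x)" "{..<a}\<times>{..<b}"] assms
    by (simp add: frob_def)
  finally show ?thesis .
qed

text \<open>Cauchy-Schwarz bounds each squared entry by a row sum times a column sum; summed over
  all entries, this bound factorises.\<close>

lemma frob_mult_le:
  assumes A: "A \<in> carrier_mat a b" and B: "B \<in> carrier_mat b c"
  shows "frob (A * B) \<le> frob A * frob B"
proof (rule power2_le_imp_le)
  have C: "A * B \<in> carrier_mat a c" using A B by auto
  have *: "(cmod ((A * B) $$ (i,j)))\<^sup>2 \<le> (\<Sum>k<b. (cmod (A $$ (i,k)))\<^sup>2) * (\<Sum>k<b. (cmod (B $$ (k,j)))\<^sup>2)"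
    if "i < a" "j < c" for i j
  proof -
    have "cmod ((A * B) $$ (i,j)) \<le> (\<Sum>k<b. \<bar>cmod (A $$ (i,k))\<bar> * \<bar>cmod (B $$ (k,j))\<bar>)"
      unfolding mat_mult_entry[OF A B that]
      by (rule order.trans[OF norm_sum]) (auto simp: norm_mult)
    also have "\<dots> \<le> L2_set (\<lambda>k. cmod (A $$ (i,k))) {..<b} * L2_set (\<lambda>k. cmod (B $$ (k,j))) {..<b}"
      by (rule L2_set_mult_ineq)
    finally have "(cmod ((A * B) $$ (i,j)))\<^sup>2 \<le> (L2_set (\<lambda>k. cmod (A $$ (i,k))) {..<b} * L2_set (\<lambda>k. cmod (B $$ (k,j))) {..<b})\<^sup>2"
      by (intro power_mono) auto
    then show ?thesis by (simp add: power_mult_distrib L2_set_def sum_nonneg)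
  qed
  have "(frob (A * B))\<^sup>2 \<le> (\<Sum>i<a. \<Sum>j<c. (\<Sum>k<b. (cmod (A $$ (i,k)))\<^sup>2) * (\<Sum>k<b. (cmod (B $$ (k,j)))\<^sup>2))"
    unfolding frob_sq[OF C] by (intro sum_mono *) auto
  also have "\<dots> = (frob A)\<^sup>2 * (\<Sum>j<c. \<Sum>k<b. (cmod (B $$ (k,j)))\<^sup>2)"
    unfolding frob_sq[OF A] by (simp only: sum_distrib_left[symmetric] sum_distrib_right[symmetric])
  also have "(\<Sum>j<c. \<Sum>k<b. (cmod (B $$ (k,j)))\<^sup>2) = (frob B)\<^sup>2"
    unfolding frob_sq[OF B] by (rule sum.swap)
  finally show "(frob (A * B))\<^sup>2 \<le> (frob A * frob B)\<^sup>2" by (simp add: power_mult_distrib)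
qed simp

section \<open>Positive semidefinite matrices\<close>

text \<open>Arguments are functions rather than vectors, so indicator functions can be added and
  indices shifted without dimension side conditions.\<close>

definition sesq :: "nat \<Rightarrow> complex mat \<Rightarrow> (nat \<Rightarrow> complex) \<Rightarrow> (nat \<Rightarrow> complex) \<Rightarrow> complex" where
  "sesq d A f g = (\<Sum>i<d. \<Sum>j<d. cnj (f i) * A $$ (i,j) * g j)"

lemma psd_iff:
  "psd d A \<longleftrightarrow> A \<in> carrier_mat d d \<and> (\<forall>f. Im (sesq d A f f) = 0 \<and> 0 \<le> Re (sesq d A f f))"
proof -
  have *: "(\<Sum>i<d. cnj (v $ i) * (A *\<^sub>v v) $ i) = sesq d A (\<lambda>i. v $ i) (\<lambda>i. v $ i)"
    if "A \<in> carrier_mat d d" "v \<in> carrier_vec d" for v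
    using that unfolding sesq_def
    by (intro sum.cong) (auto simp: mat_vec_entry[OF that] sum_distrib_left mult.assoc simp del: index_mult_mat_vec)
  have **: "sesq d A f f = sesq d A (\<lambda>i. vec d f $ i) (\<lambda>i. vec d f $ i)" for f
    unfolding sesq_def by (intro sum.cong) auto
  show ?thesis unfolding psd_def Let_def
  proof (intro conj_cong refl iffI allI ballI)
    fix f assume "A \<in> carrier_mat d d" and h: "\<forall>v\<in>carrier_vec d. Im (\<Sum>i<d. cnj (v $ i) * (A *\<^sub>v v) $ i) = 0 \<and> 0 \<le> Re (\<Sum>i<d. cnj (v $ i) * (A *\<^sub>v v) $ i)"
    then show "Im (sesq d A f f) = 0 \<and> 0 \<le> Re (sesq d A f f)"
      using *[of "vec d f"] **[of f] bspec[OF h, of "vec d f"] by simp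
  next
    fix v :: "complex vec"
    assume "A \<in> carrier_mat d d" "\<forall>f. Im (sesq d A f f) = 0 \<and> 0 \<le> Re (sesq d A f f)" "v \<in> carrier_vec d"
    then show "Im (\<Sum>i<d. cnj (v $ i) * (A *\<^sub>v v) $ i) = 0 \<and> 0 \<le> Re (\<Sum>i<d. cnj (v $ i) * (A *\<^sub>v v) $ i)"
      using * by simp
  qed
qed

lemma sesq_add_left: "sesq d A (\<lambda>k. f k + g k) h = sesq d A f h + sesq d A g h"
  by (simp add: sesq_def sum.distrib distrib_left distrib_right)

lemma sesq_add_right: "sesq d A h (\<lambda>k. f k + g k) = sesq d A h f + sesq d A h g"
  by (simp add: sesq_def sum.distrib distrib_left distrib_right)

lemma sesq_delta:
  assumes "i < d" "j < d"
  shows "sesq d A (\<lambda>k. if k = i then a else 0) (\<lambda>k. if k = j then b else 0) = cnj a * A $$ (i,j) * b"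
proof -
  have "sesq d A (\<lambda>k. if k = i then a else 0) (\<lambda>k. if k = j then b else 0)
      = (\<Sum>x<d. if x = i then (\<Sum>y<d. if y = j then cnj a * A $$ (i,j) * b else 0) else 0)"
    unfolding sesq_def by (rule sum.cong[OF refl]) (simp add: if_distrib cong: if_cong)
  then show ?thesis using assms by (simp add: sum.delta)
qed

text \<open>The two indicators are added instead of nested, so equal indices give (1 + c) e_i and
  the diagonal entries are covered by the same family.\<close>

definition pairfun :: "nat \<Rightarrow> nat \<Rightarrow> complex \<Rightarrow> nat \<Rightarrow> complex" where
  "pairfun i j c k = (if k = i then 1 else 0) + (if k = j then c else 0)"

lemma sesq_pairfun:
  assumes "i < d" "j < d"
  shows "sesq d A (pairfun i j c) (pairfun i j c)
    = A $$ (i,i) + c * A $$ (i,j) + cnj c * A $$ (j,i) + cnj c * c * A $$ (j,j)"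
  unfolding pairfun_def sesq_add_left sesq_add_right
  by (simp only: sesq_delta assms) (simp add: algebra_simps)

lemma psd_carrier: "psd d A \<Longrightarrow> A \<in> carrier_mat d d" by (simp add: psd_def)

text \<open>Polarization: a form that is real at e_i + e_j and at e_i + \<i> e_j has equal real
  parts and opposite imaginary parts in the entries (i,j) and (j,i), once the diagonal is known to
  be real.\<close>

lemma psd_cadj: assumes "psd d A" shows "cadj A = A"
proof -
  have A: "A \<in> carrier_mat d d" using assms by (rule psd_carrier)
  have im: "Im (sesq d A f f) = 0" for f using assms by (simp add: psd_iff)
  have *: "cnj (A $$ (j,i)) = A $$ (i,j)" if ij: "i < d" "j < d" for i j
  proof -
    have d: "Im (A $$ (i,i)) = 0" if "i < d" for i
      using im[of "pairfun i i 1"] sesq_pairfun[of i d i A 1] that by auto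
    show ?thesis
      using im[of "pairfun i j 1"] sesq_pairfun[of i d j A 1] im[of "pairfun i j \<i>"] sesq_pairfun[of i d j A \<i>] ij d[of i] d[of j]
      by (auto simp: complex_eq_iff)
  qed
  show ?thesis by (rule eq_matI) (use A * in auto)
qed

definition cip :: "complex vec \<Rightarrow> complex vec \<Rightarrow> complex" where
  "cip u v = (\<Sum>i<dim_vec v. cnj (u $ i) * v $ i)"

lemma psd_cip: "psd d A \<longleftrightarrow> A \<in> carrier_mat d d \<and>
    (\<forall>v\<in>carrier_vec d. Im (cip v (A *\<^sub>v v)) = 0 \<and> 0 \<le> Re (cip v (A *\<^sub>v v)))"
  by (auto simp: psd_def cip_def Let_def)

lemma cip_adjoint:
  assumes A: "A \<in> carrier_mat a b" and u: "u \<in> carrier_vec a" and v: "v \<in> carrier_vec b"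
  shows "cip u (A *\<^sub>v v) = cip (cadj A *\<^sub>v u) v"
proof -
  have "cip u (A *\<^sub>v v) = (\<Sum>i<a. \<Sum>j<b. cnj (u $ i) * (A $$ (i,j) * v $ j))"
    using A unfolding cip_def
    by (auto simp: mat_vec_entry[OF A v] sum_distrib_left simp del: index_mult_mat_vec)
  also have "\<dots> = (\<Sum>j<b. \<Sum>i<a. cnj (u $ i) * (A $$ (i,j) * v $ j))" by (rule sum.swap)
  also have "\<dots> = cip (cadj A *\<^sub>v u) v"
    unfolding cip_def using v A
    by (auto simp: mat_vec_entry[of "cadj A" b a, OF _ u] sum_distrib_left sum_distrib_right ac_simps
        simp del: index_mult_mat_vec intro!: sum.cong)
  finally show ?thesis .
qed

lemma psd_congruence:
  assumes A: "psd a A" and U: "U \<in> carrier_mat a b"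
  shows "psd b (cadj U * A * U)"
  unfolding psd_cip
proof (intro conjI ballI)
  have Ac: "A \<in> carrier_mat a a" using A by (rule psd_carrier)
  show "cadj U * A * U \<in> carrier_mat b b" using Ac U by auto
  fix v :: "complex vec" assume v: "v \<in> carrier_vec b"
  have Uv: "U *\<^sub>v v \<in> carrier_vec a" using U v by auto
  have "(cadj U * A * U) *\<^sub>v v = cadj U *\<^sub>v (A *\<^sub>v (U *\<^sub>v v))"
    using assoc_mult_mat_vec[of "cadj U * A" b a U b v] assoc_mult_mat_vec[of "cadj U" b a A a "U *\<^sub>v v"] Ac U v Uv
    by simp
  then have "cip v ((cadj U * A * U) *\<^sub>v v) = cip (U *\<^sub>v v) (A *\<^sub>v (U *\<^sub>v v))"
    using cip_adjoint[of "cadj U" b a v "A *\<^sub>v (U *\<^sub>v v)"] U v Ac Uv by simp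
  then show "Im (cip v ((cadj U * A * U) *\<^sub>v v)) = 0" "0 \<le> Re (cip v ((cadj U * A * U) *\<^sub>v v))"
    using A Uv by (auto simp: psd_cip)
qed

section \<open>The positive square root\<close>

lemma unitary_carrier: "unitary_mat d U \<Longrightarrow> U \<in> carrier_mat d d"
  by (simp add: unitary_mat_def)

lemma unitary_left: "unitary_mat d U \<Longrightarrow> cadj U * U = 1\<^sub>m d"
  by (simp add: unitary_mat_def)

lemma unitary_right: "unitary_mat d U \<Longrightarrow> U * cadj U = 1\<^sub>m d"
  using mat_mult_left_right_inverse[of "cadj U" d U] by (simp add: unitary_mat_def)

lemma unitary_mult: "unitary_mat d U \<Longrightarrow> unitary_mat d V \<Longrightarrow> unitary_mat d (U * V)"
proof -
  assume U: "unitary_mat d U" and V: "unitary_mat d V"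
  note c = unitary_carrier[OF U] unitary_carrier[OF V]
  have "cadj (U * V) * (U * V) = cadj V * cadj U * (U * V)" using cadj_mult[OF c] by simp
  also have "\<dots> = cadj V * (cadj U * U * V)"
    using c assoc_mult_mat[of "cadj V" d d "cadj U" d "U * V" d] assoc_mult_mat[of "cadj U" d d U d V d] by simp
  also have "\<dots> = 1\<^sub>m d" using c unitary_left[OF U] unitary_left[OF V] by simp
  finally show ?thesis using c by (simp add: unitary_mat_def)
qed

lemma unitary_cadj: "unitary_mat d U \<Longrightarrow> unitary_mat d (cadj U)"
  using unitary_right[of d U] by (simp add: unitary_mat_def)

lemma unitary_one: "unitary_mat d (1\<^sub>m d)"
  by (simp add: unitary_mat_def)

text \<open>A Householder reflection; taking the leading entry nonpositive keeps the denominator away from zero.\<close>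

lemma householder:
  fixes u :: "nat \<Rightarrow> complex"
  assumes n: "0 < n" and norm: "(\<Sum>i<n. cnj (u i) * u i) = 1" and re: "Im (u 0) = 0" "Re (u 0) \<le> 0"
  shows "\<exists>U. unitary_mat n U \<and> (\<forall>i<n. U $$ (i,0) = u i)"
proof -
  \<comment> \<open>The mirror vector is e_0 - u. As u_0 is real, its squared length is s = 2 - 2
    u_0, which is at least 2, and the reflection I - 2 w w*/s sends e_0 to u.\<close>
  define w where "w i = (if i = 0 then 1 else 0) - u i" for i
  define s where "s = 2 - 2 * u 0"
  have s0: "s \<noteq> 0" using re by (auto simp: s_def complex_eq_iff)
  have u0: "cnj (u 0) = u 0" using re by (auto simp: complex_eq_iff)
  have ww: "(\<Sum>i<n. cnj (w i) * w i) = s"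
  proof -
    have "(\<Sum>i<n. cnj (w i) * w i) = (\<Sum>i<n. (if i = 0 then 1 - u 0 - cnj (u 0) else 0) + cnj (u i) * u i)"
      by (rule sum.cong) (auto simp: w_def algebra_simps)
    also have "\<dots> = s" using n norm u0 by (simp add: sum.distrib s_def)
    finally show ?thesis .
  qed
  define U where "U = mat n n (\<lambda>(i,j). (if i = j then 1 else 0) - 2 * w i * cnj (w j) / s)"
  have s': "cnj s = s" using u0 by (simp add: s_def)
  have "cadj U * U = 1\<^sub>m n"
  proof (rule eq_matI)
    fix i j assume "i < dim_row (1\<^sub>m n :: complex mat)" "j < dim_col (1\<^sub>m n :: complex mat)"
    then have ij: "i < n" "j < n" by auto
    have "(cadj U * U) $$ (i,j) = (\<Sum>k<n. cnj (U $$ (k,i)) * U $$ (k,j))"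
      using ij by (subst mat_mult_entry[of _ n n _ n]) (auto simp: U_def)
    also have "\<dots> = (\<Sum>k<n. (if k = i then (if i = j then 1 else 0) - 2 * w i * cnj (w j) / s else 0)
        - (if k = j then 2 * w i * cnj (w j) / s else 0)
        + (4 * w i * cnj (w j) / s^2) * (cnj (w k) * w k))"
    proof (rule sum.cong[OF refl])
      fix k assume "k \<in> {..<n}"
      then have k: "k < n" by simp
      have "cnj (U $$ (k,i)) * U $$ (k,j) =
        ((if k = i then 1 else 0) - 2 * cnj (w k) * w i / s) * ((if k = j then 1 else 0) - 2 * w k * cnj (w j) / s)"
        using ij k by (simp add: U_def s')
      also have "\<dots> = (if k = i then (if i = j then 1 else 0) - 2 * w i * cnj (w j) / s else 0)
        - (if k = j then 2 * w i * cnj (w j) / s else 0)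
        + (4 * w i * cnj (w j) / s^2) * (cnj (w k) * w k)"
        using s0 by (cases "k = i"; cases "k = j") (auto simp: field_simps power2_eq_square)
      finally show "cnj (U $$ (k,i)) * U $$ (k,j) = \<dots>" .
    qed
    also have "\<dots> = (if i = j then 1 else 0) - 2 * w i * cnj (w j) / s - 2 * w i * cnj (w j) / s
        + (4 * w i * cnj (w j) / s^2) * s"
      unfolding sum.distrib sum_subtractf sum_distrib_left[symmetric] ww using ij by simp
    also have "\<dots> = 1\<^sub>m n $$ (i,j)" using ij s0 by (simp add: power2_eq_square)
    finally show "(cadj U * U) $$ (i,j) = 1\<^sub>m n $$ (i,j)" .
  qed (auto simp: U_def)
  moreover have "U $$ (i,0) = u i" if "i < n" for i
  proof -
    have "U $$ (i,0) = (if i = 0 then 1 else 0) - 2 * w i * cnj (w 0) / s"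
      using that n by (simp add: U_def)
    also have "2 * cnj (w 0) = s" using u0 by (simp add: w_def s_def)
    then have "2 * w i * cnj (w 0) / s = w i" using s0 by (simp add: field_simps)
    finally show ?thesis by (simp add: w_def)
  qed
  ultimately show ?thesis by (intro exI[of _ U]) (auto simp: unitary_mat_def U_def)
qed

text \<open>Splits off row and column 0, which is what the deflation by one dimension below works
  with.\<close>

lemma sesq_Suc:
  "sesq (Suc m) A f g = cnj (f 0) * A $$ (0,0) * g 0 + (\<Sum>j<m. cnj (f 0) * A $$ (0,Suc j) * g (Suc j))
     + (\<Sum>i<m. cnj (f (Suc i)) * A $$ (Suc i,0) * g 0)
     + sesq m (mat m m (\<lambda>(i,j). A $$ (Suc i, Suc j))) (\<lambda>i. f (Suc i)) (\<lambda>i. g (Suc i))"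
  unfolding sesq_def by (simp add: sum.lessThan_Suc_shift sum.distrib del: sum.lessThan_Suc)

text \<open>Deflation: an eigenvector becomes the first column of a unitary \<open>U\<close>.
  Conjugation by \<open>U\<close> clears column 0 below the corner by the eigenvalue equation and
  row 0 by hermiticity. What remains is a smaller positive block whose root exists by induction; the
  corner contributes the root of the eigenvalue.\<close>

lemma psd_sqrt_exists: "psd n A \<Longrightarrow> \<exists>S. psd n S \<and> S * S = A"
proof (induction n arbitrary: A)
  case 0
  then have "A * A = A" by (intro eq_matI) (auto dest: psd_carrier)
  with 0 show ?case by blast
next
  case (Suc m)
  let ?n = "Suc m"
  have A: "A \<in> carrier_mat ?n ?n" using Suc.prems by (rule psd_carrier)
  obtain l v where ev: "v \<in> carrier_vec ?n" "v \<noteq> 0\<^sub>v ?n" "A *\<^sub>v v = l \<cdot>\<^sub>v v"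
    using spectrum_non_empty[OF A] A unfolding spectrum_def eigenvalue_def eigenvector_def by auto
  define N where "N = sqrt (\<Sum>i<?n. (cmod (v $ i))\<^sup>2)"
  have "(\<Sum>i<?n. (cmod (v $ i))\<^sup>2) > 0"
  proof -
    obtain i where i: "i < ?n" "v $ i \<noteq> 0" using ev(1,2) by (metis eq_vecI index_zero_vec carrier_vecD)
    show ?thesis by (rule sum_pos2[of _ i]) (use i in auto)
  qed
  then have N: "N > 0" "N\<^sup>2 = (\<Sum>i<?n. (cmod (v $ i))\<^sup>2)" by (auto simp: N_def)
  \<comment> \<open>This phase makes the leading entry real and nonpositive, as
    \<open>householder\<close> demands; if that entry is zero, any phase of modulus one would
    do.\<close>
  define ph where "ph = (if v $ 0 = 0 then 1 else - (cnj (v $ 0) / cmod (v $ 0)))"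
  have ph: "cnj ph * ph = 1"
    by (auto simp: ph_def complex_norm_square[symmetric] divide_simps power2_eq_square[symmetric])
  have ph0: "ph * v $ 0 = - complex_of_real (cmod (v $ 0))"
    by (auto simp: ph_def divide_simps complex_norm_square[symmetric] power2_eq_square[symmetric] mult.commute)
  define u where "u i = ph * v $ i / complex_of_real N" for i
  have "(\<Sum>i<?n. cnj (u i) * u i) = (\<Sum>i<?n. complex_of_real ((cmod (v $ i))\<^sup>2)) / complex_of_real (N\<^sup>2)"
    unfolding sum_divide_distrib
  proof (rule sum.cong[OF refl])
    fix i
    have "cnj (u i) * u i = (cnj ph * ph) * (cnj (v $ i) * v $ i) / complex_of_real (N\<^sup>2)"
      by (simp add: u_def power2_eq_square)
    then show "cnj (u i) * u i = complex_of_real ((cmod (v $ i))\<^sup>2) / complex_of_real (N\<^sup>2)"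
      unfolding ph by (simp add: complex_norm_square mult.commute del: of_real_power)
  qed
  also have "\<dots> = 1" unfolding of_real_sum[symmetric] N(2)[symmetric] using N(1) by simp
  finally have norm: "(\<Sum>i<?n. cnj (u i) * u i) = 1" .
  have "u 0 = complex_of_real (- cmod (v $ 0) / N)" by (simp add: u_def ph0)
  then have re: "Im (u 0) = 0" "Re (u 0) \<le> 0" using N by (auto simp del: of_real_divide of_real_minus)
  obtain U where U: "unitary_mat ?n U" "\<And>i. i < ?n \<Longrightarrow> U $$ (i,0) = u i"
    using householder[OF _ norm re] by auto
  note Uc = unitary_carrier[OF U(1)]
  define B where "B = cadj U * A * U"
  have B: "psd ?n B" unfolding B_def by (rule psd_congruence[OF Suc.prems Uc])
  note Bc = psd_carrier[OF B]
  have Au: "(A * U) $$ (i,0) = l * U $$ (i,0)" if i: "i < ?n" for i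
  proof -
    have "(A * U) $$ (i,0) = (\<Sum>k<?n. A $$ (i,k) * u k)"
      using mat_mult_entry[OF A Uc i, of 0] U(2) by simp
    also have "\<dots> = ph / N * (\<Sum>k<?n. A $$ (i,k) * v $ k)"
      unfolding sum_distrib_left by (rule sum.cong) (auto simp: u_def)
    also have "(\<Sum>k<?n. A $$ (i,k) * v $ k) = l * v $ i"
      using mat_vec_entry[OF A ev(1) i] ev(1,3) i by simp
    finally show ?thesis using i U(2) by (simp add: u_def)
  qed
  have B0: "B $$ (i,0) = (if i = 0 then l else 0)" if i: "i < ?n" for i
  proof -
    have "B $$ (i,0) = (cadj U * (A * U)) $$ (i,0)"
      unfolding B_def using A Uc by (simp add: assoc_mult_mat[of _ ?n ?n _ ?n _ ?n])
    also have "\<dots> = (\<Sum>k<?n. cadj U $$ (i,k) * (A * U) $$ (k,0))"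
      by (rule mat_mult_entry) (use A Uc i in auto)
    also have "\<dots> = l * (\<Sum>k<?n. cadj U $$ (i,k) * U $$ (k,0))"
      unfolding sum_distrib_left by (rule sum.cong) (simp_all only: Au lessThan_iff mult.left_commute)
    also have "(\<Sum>k<?n. cadj U $$ (i,k) * U $$ (k,0)) = (cadj U * U) $$ (i,0)"
      by (rule mat_mult_entry[symmetric]) (use Uc i in auto)
    finally show ?thesis using i unitary_left[OF U(1)] by simp
  qed
  have B0': "B $$ (0,i) = (if i = 0 then cnj l else 0)" if i: "i < ?n" for i
  proof -
    have "B $$ (0,i) = cadj B $$ (0,i)" using psd_cadj[OF B] by simp
    then show ?thesis using Bc i B0[OF i] by simp
  qed
  have l: "Im l = 0" "0 \<le> Re l"
  proof -
    have "sesq ?n B (\<lambda>k. if k = 0 then 1 else 0) (\<lambda>k. if k = 0 then 1 else 0) = l"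
      by (subst sesq_delta) (auto simp: B0)
    then show "Im l = 0" "0 \<le> Re l" using B unfolding psd_iff by metis+
  qed
  define A' where "A' = mat m m (\<lambda>(i,j). B $$ (Suc i, Suc j))"
  have "psd m A'" unfolding psd_iff
  proof (intro conjI allI)
    fix f
    have "sesq m A' f f = sesq ?n B (\<lambda>k. case k of 0 \<Rightarrow> 0 | Suc k \<Rightarrow> f k) (\<lambda>k. case k of 0 \<Rightarrow> 0 | Suc k \<Rightarrow> f k)"
      unfolding sesq_Suc A'_def by simp
    then show "Im (sesq m A' f f) = 0" "0 \<le> Re (sesq m A' f f)" using B unfolding psd_iff by metis+
  qed (simp add: A'_def)
  then obtain S' where S': "psd m S'" "S' * S' = A'" using Suc.IH by blast
  note S'c = psd_carrier[OF S'(1)]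
  define T where "T = mat ?n ?n (\<lambda>(i,j). if i = 0 \<and> j = 0 then complex_of_real (sqrt (Re l))
      else if i = 0 \<or> j = 0 then 0 else S' $$ (i - 1, j - 1))"
  have Tc: "T \<in> carrier_mat ?n ?n" by (simp add: T_def)
  have T: "psd ?n T" unfolding psd_iff
  proof (intro conjI allI)
    fix f
    have "mat m m (\<lambda>(i,j). T $$ (Suc i, Suc j)) = S'"
      using S'c by (intro eq_matI) (auto simp: T_def)
    then have *: "sesq ?n T f f = complex_of_real (sqrt (Re l)) * (f 0 * cnj (f 0)) + sesq m S' (\<lambda>i. f (Suc i)) (\<lambda>i. f (Suc i))"
      unfolding sesq_Suc by (simp add: T_def)
    have "complex_of_real (sqrt (Re l)) * (f 0 * cnj (f 0)) = complex_of_real (sqrt (Re l) * (cmod (f 0))\<^sup>2)"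
      by (simp add: complex_norm_square[symmetric])
    with * show "Im (sesq ?n T f f) = 0" "0 \<le> Re (sesq ?n T f f)" using S'(1) l unfolding psd_iff by auto
  qed (simp add: T_def)
  have TT: "T * T = B"
  proof (rule eq_matI)
    fix i j assume "i < dim_row B" "j < dim_col B"
    then have ij: "i < ?n" "j < ?n" using Bc by auto
    have e: "(T * T) $$ (i,j) = T $$ (i,0) * T $$ (0,j) + (\<Sum>k<m. T $$ (i,Suc k) * T $$ (Suc k,j))"
      by (simp add: mat_mult_entry[OF Tc Tc ij] sum.lessThan_Suc_shift del: index_mult_mat sum.lessThan_Suc)
    have ll: "complex_of_real (sqrt (Re l)) * complex_of_real (sqrt (Re l)) = l"
      using l by (simp flip: of_real_mult add: complex_eq_iff)
    show "(T * T) $$ (i,j) = B $$ (i,j)"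
    proof (cases "i = 0 \<or> j = 0")
      case True
      then show ?thesis unfolding e using ij B0 B0' ll l by (auto simp: T_def complex_eq_iff)
    next
      case False
      then obtain a b where ab: "i = Suc a" "j = Suc b" by (cases i; cases j) auto
      then have ab': "a < m" "b < m" using ij by auto
      have "(T * T) $$ (i,j) = (\<Sum>k<m. S' $$ (a,k) * S' $$ (k,b))"
        unfolding e using ab ab' by (simp add: T_def)
      also have "\<dots> = A' $$ (a,b)" using mat_mult_entry[OF S'c S'c ab'] S'(2) by simp
      finally show ?thesis using ab ab' by (simp add: A'_def)
    qed
  qed (use Tc Bc in auto)
  define S where "S = U * T * cadj U"
  have "psd ?n S" using psd_congruence[OF T, of "cadj U" ?n] Uc unfolding S_def by simp
  moreover have "S * S = A"
  proof -
    have "S * S = U * T * (cadj U * U) * T * cadj U"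
      unfolding S_def using Uc Tc by (simp add: assoc_mult_mat[of _ ?n ?n _ ?n _ ?n])
    also have "\<dots> = U * (T * T) * cadj U"
      using Uc Tc by (simp add: unitary_left[OF U(1)] assoc_mult_mat[of _ ?n ?n _ ?n _ ?n])
    also have "\<dots> = (U * cadj U) * A * (U * cadj U)"
      unfolding TT B_def using Uc A by (simp add: assoc_mult_mat[of _ ?n ?n _ ?n _ ?n])
    also have "\<dots> = A" using A by (simp add: unitary_right[OF U(1)])
    finally show ?thesis .
  qed
  ultimately show ?case by blast
qed

text \<open>Turns the trace form of a positive matrix into a squared Frobenius norm. Together with
  \<open>psd_sqrt_exists\<close> it replaces every use of eigenvalue decompositions from here
  on.\<close>

lemma sqrt_form:
  assumes Y: "psd d Y" and M: "M \<in> carrier_mat d d"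
  shows "mtrace (cadj M * (Y * Y * M)) = complex_of_real ((frob (Y * M))\<^sup>2)"
proof -
  note c = psd_carrier[OF Y] M
  have "cadj (Y * M) * (Y * M) = cadj M * (Y * Y * M)"
    using c by (simp add: cadj_mult[OF c] psd_cadj[OF Y] assoc_mult_mat[of _ d d _ d _ d])
  then show ?thesis using mtrace_cadj_self[of "Y * M" d d] c by simp
qed

lemma psd_form_nonneg:
  assumes "psd d A" "M \<in> carrier_mat d d"
  shows "0 \<le> Re (mtrace (cadj M * (A * M)))"
proof -
  obtain Y where "psd d Y" "Y * Y = A" using psd_sqrt_exists[OF assms(1)] by blast
  then show ?thesis using sqrt_form[OF _ assms(2), of Y] by simp
qed

text \<open>S^2 - T^2 = S (S - T) + (S - T) T holds without commutativity; cyclicity of the trace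
  then moves the outer factor of the second term.\<close>

lemma trace_diff_squares:
  assumes S: "S \<in> carrier_mat d d" and T: "T \<in> carrier_mat d d"
  shows "mtrace ((S - T) * (S * S - T * T)) = mtrace ((S - T) * (S * (S - T))) + mtrace ((S - T) * (T * (S - T)))"
proof -
  define D where "D = S - T"
  have D: "D \<in> carrier_mat d d" using S T by (simp add: D_def minus_carrier_mat)
  have SD: "S * D = S * S - S * T" unfolding D_def using S T by (intro mult_minus_distrib_mat)
  have DT: "D * T = S * T - T * T" unfolding D_def using S T by (intro minus_mult_distrib_mat)
  have "S * S - T * T = S * D + D * T"
    unfolding SD DT using S T by (intro eq_matI) (simp_all del: index_mult_mat(1))
  then have "mtrace (D * (S * S - T * T)) = mtrace (D * (S * D)) + mtrace (D * (D * T))"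
    using S T D by (simp add: mult_add_distrib_mat[of _ d d _ d] mtrace_add[of _ d])
  also have "mtrace (D * (D * T)) = mtrace (D * T * D)"
    by (rule mtrace_comm) (use D T in auto)
  also have "D * T * D = D * (T * D)" using D T by simp
  finally show ?thesis by (simp add: D_def)
qed

text \<open>With D = S - T, the vanishing trace of D (S^2 - T^2) is a sum of two squared norms, of
  roots of S and T times D. Both vanish, so S D = T D = 0, hence D^2 = 0, and D is
  Hermitian.\<close>

lemma psd_sqrt_unique:
  assumes S: "psd d S" and T: "psd d T" and eq: "S * S = T * T"
  shows "S = T"
proof -
  note c = psd_carrier[OF S] psd_carrier[OF T]
  define D where "D = S - T"
  have D: "D \<in> carrier_mat d d" using c by (simp add: D_def minus_carrier_mat)
  have hD: "cadj D = D" using cadj_minus[OF c] psd_cadj[OF S] psd_cadj[OF T] by (simp add: D_def)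
  obtain Y where Y: "psd d Y" "Y * Y = S" using psd_sqrt_exists[OF S] by blast
  obtain Z where Z: "psd d Z" "Z * Z = T" using psd_sqrt_exists[OF T] by blast
  have "S * S - T * T = 0\<^sub>m d d" using eq c by simp
  then have "mtrace (D * (S * S - T * T)) = 0" using D by (simp add: mtrace_def)
  then have "complex_of_real ((frob (Y * D))\<^sup>2) + complex_of_real ((frob (Z * D))\<^sup>2) = 0"
    using trace_diff_squares[OF c] sqrt_form[OF Y(1) D] sqrt_form[OF Z(1) D] hD Y(2) Z(2)
    by (simp add: D_def[symmetric])
  then have "(frob (Y * D))\<^sup>2 + (frob (Z * D))\<^sup>2 = 0"
    unfolding of_real_add[symmetric] by (simp only: of_real_eq_0_iff)
  then have "frob (Y * D) = 0" "frob (Z * D) = 0"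
    by (simp_all add: sum_power2_eq_zero_iff)
  then have "Y * D = 0\<^sub>m d d" "Z * D = 0\<^sub>m d d"
    using frob_eq_0[of "Y * D" d d] frob_eq_0[of "Z * D" d d] psd_carrier[OF Y(1)] psd_carrier[OF Z(1)] D by auto
  then have "S * D = 0\<^sub>m d d" "T * D = 0\<^sub>m d d"
    unfolding Y(2)[symmetric] Z(2)[symmetric] using psd_carrier[OF Y(1)] psd_carrier[OF Z(1)] D
    by (simp_all add: assoc_mult_mat[of _ d d _ d _ d])
  moreover have "D * D = S * D - T * D" using c D unfolding D_def by (intro minus_mult_distrib_mat)
  ultimately have "cadj D * D = 0\<^sub>m d d" using hD by simp
  then have "complex_of_real ((frob D)\<^sup>2) = 0"
    using mtrace_cadj_self[OF D] by (simp add: mtrace_def)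
  then have "frob D = 0" by simp
  then have "D = 0\<^sub>m d d" using frob_eq_0[OF D] by simp
  then have e: "D $$ (i,j) = 0" if "i < d" "j < d" for i j using that by simp
  show ?thesis
  proof (rule eq_matI)
    fix i j assume "i < dim_row T" "j < dim_col T"
    then show "S $$ (i,j) = T $$ (i,j)" using e[of i j] c by (simp add: D_def)
  qed (use c in auto)
qed

lemma msqrt:
  assumes "psd d A"
  shows "psd d (msqrt d A)" "msqrt d A * msqrt d A = A"
proof -
  obtain S where S: "psd d S" "S * S = A" using psd_sqrt_exists[OF assms] by blast
  have "psd d (msqrt d A) \<and> msqrt d A * msqrt d A = A"
    unfolding msqrt_def
  proof (rule theI)
    show "psd d S \<and> S * S = A" using S by blast
    fix T assume "psd d T \<and> T * T = A"
    then show "T = S" using psd_sqrt_unique[of d T S] S by simp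
  qed
  then show "psd d (msqrt d A)" "msqrt d A * msqrt d A = A" by auto
qed

lemma frob_psd_sq:
  assumes "psd d R" shows "mtrace (R * R) = complex_of_real ((frob R)\<^sup>2)"
  using mtrace_cadj_self[OF psd_carrier[OF assms]] psd_cadj[OF assms] by simp

text \<open>The normalisation used for roots of density matrices, where R^2 has trace one.\<close>

lemma frob_psd_eq_1:
  assumes "psd d R" "mtrace (R * R) = 1" shows "frob R = 1"
proof -
  have "complex_of_real ((frob R)\<^sup>2) = complex_of_real 1"
    using frob_psd_sq[OF assms(1)] assms(2) by simp
  then have "(frob R)\<^sup>2 = 1" by (simp only: of_real_eq_iff)
  then show ?thesis using frob_nonneg[of R] by (auto simp: power2_eq_1_iff)
qed

text \<open>The operator inequality R^2 \<le> R in trace form: writing R = Y^2 and N = Y M,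
  Cauchy-Schwarz gives |R M|^2 = tr(N* R N) \<le> |R| |N|^2. Comparing with R^2 gives a Lipschitz
  constant \<kappa> in place of its square root, which the query budget affords, and no operator
  monotonicity of the root is invoked.\<close>

lemma frob_le_form:
  assumes R: "psd d R" and M: "M \<in> carrier_mat d d" and R1: "frob R \<le> 1"
  shows "(frob (R * M))\<^sup>2 \<le> Re (mtrace (cadj M * (R * M)))"
proof -
  obtain Y where Y: "psd d Y" "Y * Y = R" using psd_sqrt_exists[OF R] by blast
  note c = psd_carrier[OF Y(1)] psd_carrier[OF R]
  define N where "N = Y * M"
  have N: "N \<in> carrier_mat d d" using c M by (simp add: N_def)
  have "(frob (Y * N))\<^sup>2 = Re (mtrace (cadj N * (R * N)))"
    using sqrt_form[OF Y(1) N] Y(2) by simp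
  also have "\<dots> \<le> cmod (mtrace (cadj N * (R * N)))" by (rule complex_Re_le_cmod)
  also have "\<dots> \<le> frob N * frob (R * N)" by (rule frob_Cauchy_Schwarz) (use N c in auto)
  also have "\<dots> \<le> frob N * (frob R * frob N)"
    by (intro mult_left_mono frob_mult_le) (use N c in auto)
  also have "\<dots> \<le> frob N * (1 * frob N)" by (intro mult_left_mono mult_right_mono R1) auto
  finally have "(frob (Y * N))\<^sup>2 \<le> (frob N)\<^sup>2" by (simp add: power2_eq_square)
  moreover have "Y * N = R * M" unfolding N_def Y(2)[symmetric] using c M by simp
  ultimately show ?thesis using sqrt_form[OF Y(1) M] Y(2) by (simp add: N_def)
qed

text \<open>The Loewner bound tested on a matrix, that is on all of its columns at once.\<close>

lemma loewner_form:
  assumes L: "loewner_le d ((1 / complex_of_real \<kappa>) \<cdot>\<^sub>m 1\<^sub>m d) A" and M: "M \<in> carrier_mat d d"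
  shows "(frob M)\<^sup>2 / \<kappa> \<le> Re (mtrace (cadj M * (A * M)))"
proof -
  let ?B = "(1 / complex_of_real \<kappa>) \<cdot>\<^sub>m 1\<^sub>m d :: complex mat"
  have A: "A \<in> carrier_mat d d" and p: "psd d (A - ?B)" using L by (auto simp: loewner_le_def)
  have "(A - ?B) * M = A * M - (1 / complex_of_real \<kappa>) \<cdot>\<^sub>m M"
    using A M by (subst minus_mult_distrib_mat[of _ d d _ _ d]) (auto simp: mult_smult_assoc_mat[of _ d d _ d])
  then have "cadj M * ((A - ?B) * M) = cadj M * (A * M) - (1 / complex_of_real \<kappa>) \<cdot>\<^sub>m (cadj M * M)"
    using A M by (simp add: mult_minus_distrib_mat[of _ d d _ d] mult_smult_distrib[of _ d d _ d])
  then have "mtrace (cadj M * ((A - ?B) * M)) = mtrace (cadj M * (A * M)) - (1 / complex_of_real \<kappa>) * mtrace (cadj M * M)"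
    using A M by (simp add: mtrace_minus[of _ d] mtrace_def sum_distrib_left sum_subtractf del: index_mult_mat(1))
  also have "\<dots> = mtrace (cadj M * (A * M)) - complex_of_real ((frob M)\<^sup>2 / \<kappa>)"
    unfolding mtrace_cadj_self[OF M] by simp
  finally have "Re (mtrace (cadj M * ((A - ?B) * M))) = Re (mtrace (cadj M * (A * M))) - (frob M)\<^sup>2 / \<kappa>"
    by (simp only: minus_complex.sel Re_complex_of_real)
  then show ?thesis using psd_form_nonneg[OF p M] by linarith
qed

text \<open>With \<open>D = R - R'\<close>, the trace of \<open>D (R\<^sup>2 - R'\<^sup>2)\<close> equals that of \<open>D (R + R') D\<close>, and \<open>R \<ge> R\<^sup>2\<close>.\<close>

lemma sqrt_Lipschitz:
  assumes R: "psd d R" and R': "psd d R'" and R1: "frob R \<le> 1" and k: "\<kappa> > 0"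
    and L: "loewner_le d ((1 / complex_of_real \<kappa>) \<cdot>\<^sub>m 1\<^sub>m d) (R * R)"
  shows "frob (R - R') \<le> \<kappa> * frob (R * R - R' * R')"
proof -
  note c = psd_carrier[OF R] psd_carrier[OF R']
  define D where "D = R - R'"
  have D: "D \<in> carrier_mat d d" using c by (simp add: D_def minus_carrier_mat)
  have hD: "cadj D = D" using cadj_minus[OF c] psd_cadj[OF R] psd_cadj[OF R'] by (simp add: D_def)
  have "(frob D)\<^sup>2 / \<kappa> \<le> Re (mtrace (cadj D * (R * R * D)))" by (rule loewner_form[OF L D])
  also have "\<dots> = (frob (R * D))\<^sup>2" by (simp add: sqrt_form[OF R D])
  also have "\<dots> \<le> Re (mtrace (cadj D * (R * D)))" by (rule frob_le_form[OF R D R1])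
  also have "\<dots> \<le> Re (mtrace (cadj D * (R * D))) + Re (mtrace (cadj D * (R' * D)))"
    using psd_form_nonneg[OF R' D] by simp
  also have "\<dots> = Re (mtrace (cadj D * (R * R - R' * R')))"
    unfolding hD using trace_diff_squares[OF c] by (simp add: D_def)
  also have "\<dots> \<le> cmod (mtrace (cadj D * (R * R - R' * R')))" by (rule complex_Re_le_cmod)
  also have "\<dots> \<le> frob D * frob (R * R - R' * R')"
    by (rule frob_Cauchy_Schwarz) (use D c in \<open>auto intro!: minus_carrier_mat\<close>)
  finally have "frob D * frob D \<le> frob D * (\<kappa> * frob (R * R - R' * R'))"
    using k by (simp add: field_simps power2_eq_square)
  then show ?thesis
    unfolding D_def[symmetric] using frob_nonneg[of D] k
    by (cases "frob D = 0") (auto simp: mult_le_cancel_left)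
qed

section \<open>Continuity of the fidelity\<close>

lemma frob_unitary_left:
  assumes U: "unitary_mat d U" and A: "A \<in> carrier_mat d d"
  shows "frob (U * A) = frob A"
proof -
  note c = unitary_carrier[OF U] A
  have "cadj (U * A) * (U * A) = cadj A * (cadj U * U * A)"
    using c by (simp add: cadj_mult[OF c] assoc_mult_mat[of _ d d _ d _ d])
  also have "\<dots> = cadj A * A" using A by (simp add: unitary_left[OF U])
  finally have "complex_of_real ((frob (U * A))\<^sup>2) = complex_of_real ((frob A)\<^sup>2)"
    using mtrace_cadj_self[of "U * A" d d] mtrace_cadj_self[OF A] c by simp
  then have "(frob (U * A))\<^sup>2 = (frob A)\<^sup>2" by (simp only: of_real_eq_iff)
  then show ?thesis by simp
qed

lemma frob_unitary_right:
  assumes U: "unitary_mat d U" and A: "A \<in> carrier_mat d d"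
  shows "frob (A * U) = frob A"
proof -
  note c = unitary_carrier[OF U] A
  have "mtrace (cadj (A * U) * (A * U)) = mtrace ((A * U) * cadj (A * U))"
    by (rule mtrace_comm[of _ d d]) (use c in auto)
  also have "(A * U) * cadj (A * U) = A * (U * cadj U * cadj A)"
    using c by (simp add: cadj_mult[OF c(2,1)] assoc_mult_mat[of _ d d _ d _ d])
  also have "\<dots> = A * cadj A" using A by (simp add: unitary_right[OF U])
  also have "mtrace \<dots> = mtrace (cadj A * A)"
    by (rule mtrace_comm[of _ d d]) (use c in auto)
  finally have "complex_of_real ((frob (A * U))\<^sup>2) = complex_of_real ((frob A)\<^sup>2)"
    using mtrace_cadj_self[of "A * U" d d] mtrace_cadj_self[OF A] c by simp
  then have "(frob (A * U))\<^sup>2 = (frob A)\<^sup>2" by (simp only: of_real_eq_iff)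
  then show ?thesis by simp
qed

text \<open>With X = Y^2, cyclicity gives tr(W X) = tr(Y W Y), which is at most |Y| |W Y| = |Y|^2.
  This is the variational property of the trace norm: the polar unitary is the best one.\<close>

lemma trace_unitary_psd_le:
  assumes W: "unitary_mat d W" and X: "psd d X"
  shows "Re (mtrace (W * X)) \<le> Re (mtrace X)"
proof -
  obtain Y where Y: "psd d Y" "Y * Y = X" using psd_sqrt_exists[OF X] by blast
  note c = psd_carrier[OF Y(1)] unitary_carrier[OF W]
  have "mtrace (W * X) = mtrace ((W * Y) * Y)"
    unfolding Y(2)[symmetric] using c by simp
  also have "\<dots> = mtrace (Y * (W * Y))" by (rule mtrace_comm) (use c in auto)
  also have "\<dots> = mtrace (cadj Y * (W * Y))" by (simp add: psd_cadj[OF Y(1)])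
  finally have "Re (mtrace (W * X)) \<le> cmod (mtrace (cadj Y * (W * Y)))"
    by (simp add: complex_Re_le_cmod)
  also have "\<dots> \<le> frob Y * frob (W * Y)" by (rule frob_Cauchy_Schwarz) (use c in auto)
  also have "\<dots> = (frob Y)\<^sup>2" by (simp add: frob_unitary_left[OF W c(1)] power2_eq_square)
  also have "\<dots> = Re (mtrace X)" using frob_psd_sq[OF Y(1)] Y(2) by simp
  finally show ?thesis .
qed

text \<open>A kernel vector v would make the form of A - I/\<kappa> equal to -|v|^2/\<kappa>.
  Invertibility lets the polar factor below be written down with an inverse.\<close>

lemma loewner_det_nonzero:
  assumes L: "loewner_le d ((1 / complex_of_real \<kappa>) \<cdot>\<^sub>m 1\<^sub>m d) A" and k: "\<kappa> > 0"
  shows "det A \<noteq> 0"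
proof
  let ?B = "(1 / complex_of_real \<kappa>) \<cdot>\<^sub>m 1\<^sub>m d :: complex mat"
  have A: "A \<in> carrier_mat d d" and p: "psd d (A - ?B)" using L by (auto simp: loewner_le_def)
  assume "det A = 0"
  then obtain v where v: "v \<in> carrier_vec d" "v \<noteq> 0\<^sub>v d" "A *\<^sub>v v = 0\<^sub>v d"
    using det_0_iff_vec_prod_zero[OF A] by auto
  have Bv: "((A - ?B) *\<^sub>v v) $ i = - (v $ i / \<kappa>)" if i: "i < d" for i
  proof -
    have "((A - ?B) *\<^sub>v v) $ i = (\<Sum>k<d. (A - ?B) $$ (i,k) * v $ k)"
      by (rule mat_vec_entry[of _ d d]) (use A v i in \<open>auto intro!: minus_carrier_mat\<close>)
    also have "\<dots> = (\<Sum>k<d. A $$ (i,k) * v $ k - (if k = i then v $ i / \<kappa> else 0))"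
      using A i by (intro sum.cong) (auto simp: left_diff_distrib)
    also have "\<dots> = (A *\<^sub>v v) $ i - v $ i / \<kappa>"
      using i by (simp add: sum_subtractf mat_vec_entry[OF A v(1) i] del: index_mult_mat_vec)
    finally show ?thesis using v i by simp
  qed
  have "cip v ((A - ?B) *\<^sub>v v) = (\<Sum>i<d. - complex_of_real ((cmod (v $ i))\<^sup>2 / \<kappa>))"
    unfolding cip_def using A
    by (auto simp: Bv complex_norm_square mult.commute simp del: index_mult_mat_vec of_real_power intro!: sum.cong)
  then have "Re (cip v ((A - ?B) *\<^sub>v v)) = - (\<Sum>i<d. (cmod (v $ i))\<^sup>2 / \<kappa>)"
    by (simp add: sum_negf)
  moreover obtain i where "i < d" "v $ i \<noteq> 0" using v(1,2) by (metis eq_vecI index_zero_vec carrier_vecD)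
  then have "(\<Sum>i<d. (cmod (v $ i))\<^sup>2 / \<kappa>) > 0"
    by (intro sum_pos2[of _ i]) (use k in auto)
  ultimately show False using p v(1) by (auto simp: psd_cip)
qed

lemma det_nonzero_inverse:
  fixes X :: "complex mat"
  assumes "X \<in> carrier_mat d d" "det X \<noteq> 0"
  shows "\<exists>Y \<in> carrier_mat d d. X * Y = 1\<^sub>m d"
  using det_non_zero_imp_unit[OF assms, of "()"] by (auto simp: Units_def ring_mat_simps)

text \<open>Since S \<rho> S = (R S)*(R S), its root X is the absolute value of R S, and V = R S
  X^-1 satisfies V* V = X^-1 X^2 X^-1 = I. The fidelity is thereby a trace norm.\<close>

lemma fidelity_polar:
  assumes r: "psd d \<rho>" and s: "psd d \<sigma>" and dr: "det \<rho> \<noteq> 0" and ds: "det \<sigma> \<noteq> 0"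
  shows "\<exists>V X. unitary_mat d V \<and> psd d X \<and> V * X = msqrt d \<rho> * msqrt d \<sigma> \<and> fidelity d \<rho> \<sigma> = Re (mtrace X)"
proof -
  define R where "R = msqrt d \<rho>"
  define S where "S = msqrt d \<sigma>"
  note R = msqrt[OF r, folded R_def] and S = msqrt[OF s, folded S_def]
  define P where "P = S * \<rho> * S"
  have P: "psd d P" using psd_congruence[OF r psd_carrier[OF S(1)]] by (simp add: P_def psd_cadj[OF S(1)])
  define X where "X = msqrt d P"
  note X = msqrt[OF P, folded X_def]
  note c = psd_carrier[OF R(1)] psd_carrier[OF S(1)] psd_carrier[OF X(1)] psd_carrier[OF r]
  have dS: "det S \<noteq> 0" using ds det_mult[OF c(2) c(2)] S(2) by auto
  have "det P = det S * det \<rho> * det S"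
    unfolding P_def using c by (simp add: det_mult[of _ d])
  then have "det P \<noteq> 0" using dS dr by simp
  then have "det X \<noteq> 0" using det_mult[OF c(3) c(3)] X(2) by auto
  then obtain Y where Y: "Y \<in> carrier_mat d d" "X * Y = 1\<^sub>m d" using det_nonzero_inverse[OF c(3)] by blast
  have YX: "Y * X = 1\<^sub>m d" using mat_mult_left_right_inverse[OF c(3) Y] .
  define V where "V = R * S * Y"
  have V: "V \<in> carrier_mat d d" using c Y by (simp add: V_def)
  have "cadj V = cadj Y * (S * R)"
    unfolding V_def using c Y by (simp add: cadj_mult[of _ d d _ d] psd_cadj[OF R(1)] psd_cadj[OF S(1)])
  then have "cadj V * V = cadj Y * (S * (R * R) * S) * Y"
    unfolding V_def using c Y by (simp add: assoc_mult_mat[of _ d d _ d _ d])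
  also have "S * (R * R) * S = X * X" by (simp add: R(2) X(2) P_def)
  also have "cadj Y * (X * X) * Y = (cadj Y * X) * (X * Y)"
    using c Y by (simp add: assoc_mult_mat[of _ d d _ d _ d])
  also have "\<dots> = cadj (X * Y)"
    unfolding cadj_mult[OF c(3) Y(1)] psd_cadj[OF X(1)] using c Y by simp
  finally have "unitary_mat d V" using V Y by (simp add: unitary_mat_def)
  moreover have "V * X = R * S"
    unfolding V_def using c Y YX by (simp add: assoc_mult_mat[of _ d d _ d _ d])
  moreover have "fidelity d \<rho> \<sigma> = Re (mtrace X)" by (simp add: fidelity_def X_def P_def S_def)
  ultimately show ?thesis using X(1) R_def S_def by blast
qed

text \<open>The unitary V that is optimal for R S is also used for R' S', where it can only
  underestimate. The difference telescopes as (R - R') S + R' (S - S'), and Cauchy-Schwarz with |S|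
  = |R'| = 1 finishes.\<close>

lemma fidelity_diff_le:
  assumes r: "psd d \<rho>" "mtrace \<rho> = 1" "det \<rho> \<noteq> 0" and s: "psd d \<sigma>" "mtrace \<sigma> = 1" "det \<sigma> \<noteq> 0"
    and r': "psd d \<rho>'" "mtrace \<rho>' = 1" "det \<rho>' \<noteq> 0" and s': "psd d \<sigma>'" "mtrace \<sigma>' = 1" "det \<sigma>' \<noteq> 0"
  shows "fidelity d \<rho> \<sigma> - fidelity d \<rho>' \<sigma>' \<le> frob (msqrt d \<rho> - msqrt d \<rho>') + frob (msqrt d \<sigma> - msqrt d \<sigma>')"
proof -
  define R where "R = msqrt d \<rho>"
  define S where "S = msqrt d \<sigma>"
  define R' where "R' = msqrt d \<rho>'"
  define S' where "S' = msqrt d \<sigma>'"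
  note R = msqrt[OF r(1), folded R_def] and S = msqrt[OF s(1), folded S_def]
  note R' = msqrt[OF r'(1), folded R'_def] and S' = msqrt[OF s'(1), folded S'_def]
  have fS: "frob S = 1" using frob_psd_eq_1[OF S(1)] S(2) s(2) by simp
  have fR': "frob R' = 1" using frob_psd_eq_1[OF R'(1)] R'(2) r'(2) by simp
  obtain V X where V: "unitary_mat d V" "psd d X" "V * X = R * S" "fidelity d \<rho> \<sigma> = Re (mtrace X)"
    using fidelity_polar[OF r(1) s(1) r(3) s(3)] R_def S_def by blast
  obtain V' X' where V': "unitary_mat d V'" "psd d X'" "V' * X' = R' * S'" "fidelity d \<rho>' \<sigma>' = Re (mtrace X')"
    using fidelity_polar[OF r'(1) s'(1) r'(3) s'(3)] R'_def S'_def by blast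
  note c = psd_carrier[OF R(1)] psd_carrier[OF S(1)] psd_carrier[OF R'(1)] psd_carrier[OF S'(1)]
    unitary_carrier[OF V(1)] unitary_carrier[OF V'(1)] psd_carrier[OF V(2)] psd_carrier[OF V'(2)]
  have c2: "R - R' \<in> carrier_mat d d" "S - S' \<in> carrier_mat d d" using c by (auto intro!: minus_carrier_mat)
  have "X = cadj V * (R * S)"
  proof -
    have "cadj V * (V * X) = cadj V * V * X" using c by simp
    then show ?thesis using c V by (simp add: unitary_left[OF V(1)])
  qed
  moreover have "Re (mtrace (cadj V * (R' * S'))) \<le> Re (mtrace X')"
  proof -
    have "cadj V * (R' * S') = cadj V * V' * X'" using c by (simp flip: V'(3))
    then show ?thesis
      using trace_unitary_psd_le[OF unitary_mult[OF unitary_cadj[OF V(1)] V'(1)] V'(2)] by simp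
  qed
  ultimately have "fidelity d \<rho> \<sigma> - fidelity d \<rho>' \<sigma>' \<le> Re (mtrace (cadj V * (R * S)) - mtrace (cadj V * (R' * S')))"
    using V(4) V'(4) by simp
  also have "mtrace (cadj V * (R * S)) - mtrace (cadj V * (R' * S'))
      = mtrace (cadj V * ((R - R') * S)) + mtrace (cadj V * (R' * (S - S')))"
    using c c2
    by (simp add: minus_mult_distrib_mat[of _ d d _ _ d] mult_minus_distrib_mat[of _ d d _ d] mtrace_minus[of _ d])
  also have "mtrace (cadj V * ((R - R') * S)) = mtrace (cadj (V * S) * (R - R'))"
  proof -
    have "cadj V * ((R - R') * S) = cadj V * (R - R') * S" using c c2 by simp
    also have "mtrace \<dots> = mtrace (S * (cadj V * (R - R')))" by (rule mtrace_comm) (use c c2 in auto)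
    also have "S * (cadj V * (R - R')) = cadj (V * S) * (R - R')"
      using c c2 by (simp add: cadj_mult[of _ d d _ d] psd_cadj[OF S(1)] assoc_mult_mat[of _ d d _ d _ d])
    finally show ?thesis .
  qed
  also have "cadj V * (R' * (S - S')) = cadj (R' * V) * (S - S')"
    using c c2 by (simp add: cadj_mult[of _ d d _ d] psd_cadj[OF R'(1)] assoc_mult_mat[of _ d d _ d _ d])
  finally have "fidelity d \<rho> \<sigma> - fidelity d \<rho>' \<sigma>'
      \<le> cmod (mtrace (cadj (V * S) * (R - R'))) + cmod (mtrace (cadj (R' * V) * (S - S')))"
    using complex_Re_le_cmod[of "mtrace (cadj (V * S) * (R - R'))"] complex_Re_le_cmod[of "mtrace (cadj (R' * V) * (S - S'))"]
    by simp
  also have "\<dots> \<le> frob (V * S) * frob (R - R') + frob (R' * V) * frob (S - S')"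
    by (intro add_mono frob_Cauchy_Schwarz) (use c c2 in auto)
  finally have "fidelity d \<rho> \<sigma> - fidelity d \<rho>' \<sigma>' \<le> frob (R - R') + frob (S - S')"
    using c by (simp add: frob_unitary_left[OF V(1)] frob_unitary_right[OF V(1)] fS fR')
  then show ?thesis unfolding R_def R'_def S_def S'_def .
qed

lemma fidelity_Lipschitz:
  assumes r: "psd d \<rho>" "mtrace \<rho> = 1" and s: "psd d \<sigma>" "mtrace \<sigma> = 1"
    and r': "psd d \<rho>'" "mtrace \<rho>' = 1" and s': "psd d \<sigma>'" "mtrace \<sigma>' = 1"
    and k: "a > 0" "b > 0"
    and l: "loewner_le d ((1 / complex_of_real a) \<cdot>\<^sub>m 1\<^sub>m d) \<rho>" "loewner_le d ((1 / complex_of_real b) \<cdot>\<^sub>m 1\<^sub>m d) \<sigma>"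
      "loewner_le d ((1 / complex_of_real a) \<cdot>\<^sub>m 1\<^sub>m d) \<rho>'" "loewner_le d ((1 / complex_of_real b) \<cdot>\<^sub>m 1\<^sub>m d) \<sigma>'"
  shows "fidelity d \<rho> \<sigma> - fidelity d \<rho>' \<sigma>' \<le> a * frob (\<rho> - \<rho>') + b * frob (\<sigma> - \<sigma>')"
proof -
  have f: "frob (msqrt d A) \<le> 1" if "psd d A" "mtrace A = 1" for A
    using frob_psd_eq_1[OF msqrt(1)[OF that(1)]] msqrt(2)[OF that(1)] that(2) by simp
  have "fidelity d \<rho> \<sigma> - fidelity d \<rho>' \<sigma>' \<le> frob (msqrt d \<rho> - msqrt d \<rho>') + frob (msqrt d \<sigma> - msqrt d \<sigma>')"
    by (rule fidelity_diff_le) (use assms loewner_det_nonzero in auto)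
  also have "frob (msqrt d \<rho> - msqrt d \<rho>') \<le> a * frob (\<rho> - \<rho>')"
    using sqrt_Lipschitz[OF msqrt(1)[OF r(1)] msqrt(1)[OF r'(1)] f[OF r] k(1)] l
    by (simp add: msqrt(2)[OF r(1)] msqrt(2)[OF r'(1)])
  also have "frob (msqrt d \<sigma> - msqrt d \<sigma>') \<le> b * frob (\<sigma> - \<sigma>')"
    using sqrt_Lipschitz[OF msqrt(1)[OF s(1)] msqrt(1)[OF s'(1)] f[OF s] k(2)] l
    by (simp add: msqrt(2)[OF s(1)] msqrt(2)[OF s'(1)])
  finally show ?thesis by simp
qed

section \<open>Kronecker products\<close>

lemma sum_lessThan_mult:
  fixes F :: "nat \<Rightarrow> 'a::comm_monoid_add"
  shows "(\<Sum>k<a*b. F k) = (\<Sum>i<a. \<Sum>j<b. F (i * b + j))"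
proof -
  have "(\<Sum>k<a*b. F k) = (\<Sum>i<a. sum F {i*b..<i*b+b})" by (rule sum.nat_group[symmetric])
  also have "\<dots> = (\<Sum>i<a. \<Sum>j<b. F (i * b + j))"
  proof (rule sum.cong[OF refl])
    fix i show "sum F {i*b..<i*b+b} = (\<Sum>j<b. F (i * b + j))"
      using sum.shift_bounds_nat_ivl[of F 0 "i*b" b] by (simp add: atLeast0LessThan add.commute)
  qed
  finally show ?thesis .
qed

lemma mult_add_less: "i < a \<Longrightarrow> j < b \<Longrightarrow> i * b + j < a * (b::nat)"
proof -
  assume "i < a" "j < b"
  then have "i * b + j < (i + 1) * b" by simp
  also have "\<dots> \<le> a * b" using \<open>i < a\<close> by (intro mult_le_mono1) simp
  finally show ?thesis .
qed

lemma less_mult_div_mod: "i < a * (b::nat) \<Longrightarrow> i div b < a \<and> i mod b < b"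
proof
  assume i: "i < a * b"
  then have "b \<noteq> 0" by (rule contrapos_pn) simp
  then show "i mod b < b" by simp
  show "i div b < a" using i by (rule less_mult_imp_div_less)
qed

lemma kron_carrier [simp]:
  "A \<in> carrier_mat a b \<Longrightarrow> B \<in> carrier_mat c d \<Longrightarrow> kron A B \<in> carrier_mat (a*c) (b*d)"
  by (intro carrier_matI) (simp_all add: kron_def)

lemma kron_entry:
  "A \<in> carrier_mat a b \<Longrightarrow> B \<in> carrier_mat c d \<Longrightarrow> i < a * c \<Longrightarrow> j < b * d \<Longrightarrow>
   kron A B $$ (i,j) = A $$ (i div c, j div d) * B $$ (i mod c, j mod d)"
  by (simp add: kron_def)

lemma kron_mult:
  assumes A: "A \<in> carrier_mat a b" and B: "B \<in> carrier_mat c d"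
    and A': "A' \<in> carrier_mat b e" and B': "B' \<in> carrier_mat d f"
  shows "kron A B * kron A' B' = kron (A * A') (B * B')"
proof (rule eq_matI)
  fix i j assume "i < dim_row (kron (A * A') (B * B'))" "j < dim_col (kron (A * A') (B * B'))"
  then have ij: "i < a * c" "j < e * f" using A B A' B' by (auto simp: kron_def)
  note dm = less_mult_div_mod[OF ij(1)] less_mult_div_mod[OF ij(2)]
  have "(kron A B * kron A' B') $$ (i,j) = (\<Sum>k<b*d. kron A B $$ (i,k) * kron A' B' $$ (k,j))"
    by (rule mat_mult_entry[OF kron_carrier[OF A B] kron_carrier[OF A' B'] ij])
  also have "\<dots> = (\<Sum>x<b. \<Sum>y<d. (A $$ (i div c, x) * A' $$ (x, j div f)) * (B $$ (i mod c, y) * B' $$ (y, j mod f)))"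
    unfolding sum_lessThan_mult
  proof (intro sum.cong refl)
    fix x y assume "x \<in> {..<b}" "y \<in> {..<d}"
    then have xy: "x < b" "y < d" by auto
    then have "(x * d + y) div d = x" "(x * d + y) mod d = y" by auto
    then show "kron A B $$ (i, x * d + y) * kron A' B' $$ (x * d + y, j) =
      (A $$ (i div c, x) * A' $$ (x, j div f)) * (B $$ (i mod c, y) * B' $$ (y, j mod f))"
      using kron_entry[OF A B ij(1) mult_add_less[OF xy]] kron_entry[OF A' B' mult_add_less[OF xy] ij(2)] by simp
  qed
  also have "\<dots> = (A * A') $$ (i div c, j div f) * (B * B') $$ (i mod c, j mod f)"
    unfolding mat_mult_entry[OF A A' dm(1)[THEN conjunct1] dm(2)[THEN conjunct1]]
      mat_mult_entry[OF B B' dm(1)[THEN conjunct2] dm(2)[THEN conjunct2]]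
    by (simp only: sum_product)
  also have "\<dots> = kron (A * A') (B * B') $$ (i,j)"
    by (rule kron_entry[symmetric, OF _ _ ij]) (use A B A' B' in auto)
  finally show "(kron A B * kron A' B') $$ (i,j) = kron (A * A') (B * B') $$ (i,j)" .
qed (use A B A' B' in \<open>auto simp: kron_def\<close>)

lemma cadj_kron:
  assumes A: "A \<in> carrier_mat a b" and B: "B \<in> carrier_mat c d"
  shows "cadj (kron A B) = kron (cadj A) (cadj B)"
proof (rule eq_matI)
  fix i j assume "i < dim_row (kron (cadj A) (cadj B))" "j < dim_col (kron (cadj A) (cadj B))"
  then have ij: "i < b * d" "j < a * c" using A B by (auto simp: kron_def)
  have "cadj (kron A B) $$ (i,j) = cnj (kron A B $$ (j,i))"
    using kron_carrier[OF A B] ij by (intro cadj_entry) auto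
  also have "\<dots> = kron (cadj A) (cadj B) $$ (i,j)"
    using A B ij less_mult_div_mod[OF ij(1)] less_mult_div_mod[OF ij(2)]
      kron_entry[OF A B ij(2,1)] kron_entry[of "cadj A" b a "cadj B" d c i j] by simp
  finally show "cadj (kron A B) $$ (i,j) = kron (cadj A) (cadj B) $$ (i,j)" .
qed (use A B in \<open>auto simp: kron_def\<close>)

lemma kron_one: "kron (1\<^sub>m a) (1\<^sub>m b) = 1\<^sub>m (a * b)"
proof (rule eq_matI)
  fix i j assume "i < dim_row (1\<^sub>m (a*b) :: complex mat)" "j < dim_col (1\<^sub>m (a*b) :: complex mat)"
  then have ij: "i < a * b" "j < a * b" by auto
  have "i = j \<longleftrightarrow> i div b = j div b \<and> i mod b = j mod b" by (metis div_mult_mod_eq)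
  then show "kron (1\<^sub>m a) (1\<^sub>m b) $$ (i,j) = 1\<^sub>m (a * b) $$ (i,j)"
    using less_mult_div_mod[OF ij(1)] less_mult_div_mod[OF ij(2)] ij
      kron_entry[OF one_carrier_mat one_carrier_mat ij] by simp
qed (auto simp: kron_def)

lemma kron_assoc:
  assumes A: "A \<in> carrier_mat a a" and B: "B \<in> carrier_mat b b" and C: "C \<in> carrier_mat c c"
  shows "kron (kron A B) C = kron A (kron B C)"
proof (rule eq_matI)
  fix i j assume "i < dim_row (kron A (kron B C))" "j < dim_col (kron A (kron B C))"
  then have ij: "i < a * (b * c)" "j < a * (b * c)" using A B C by (auto simp: kron_def)
  then have ij': "i < (a * b) * c" "j < (a * b) * c" by (simp_all add: mult.assoc)
  have i1: "x div (b * c) = x div c div b" "(x mod (b * c)) div c = (x div c) mod b"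
    "(x mod (b * c)) mod c = x mod c" for x
  proof -
    show "x div (b * c) = x div c div b" using div_mult2_eq[of x c b] by (simp only: mult.commute)
    show "(x mod (b * c)) div c = (x div c) mod b"
      using mod_mult2_eq[of x c b] by (cases "c = 0") (auto simp: mult.commute)
    show "(x mod (b * c)) mod c = x mod c" by (simp add: mod_mod_cancel)
  qed
  show "kron (kron A B) C $$ (i,j) = kron A (kron B C) $$ (i,j)"
    using kron_entry[OF kron_carrier[OF A B] C ij'] kron_entry[OF A kron_carrier[OF B C] ij]
      kron_entry[OF A B, of "i div c" "j div c"] kron_entry[OF B C, of "i mod (b*c)" "j mod (b*c)"]
      less_mult_div_mod[OF ij(1)] less_mult_div_mod[OF ij(2)] less_mult_div_mod[OF ij'(1)] less_mult_div_mod[OF ij'(2)]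
    by (simp add: i1 mult.assoc)
qed (use A B C in \<open>auto simp: kron_def\<close>)

lemma unitary_kron:
  assumes "unitary_mat a A" "unitary_mat b B"
  shows "unitary_mat (a * b) (kron A B)"
proof -
  note c = unitary_carrier[OF assms(1)] unitary_carrier[OF assms(2)]
  have "cadj (kron A B) * kron A B = kron (cadj A * A) (cadj B * B)"
    unfolding cadj_kron[OF c] by (rule kron_mult) (use c in auto)
  then show ?thesis using c kron_carrier[OF c] by (simp add: unitary_mat_def unitary_left[OF assms(1)] unitary_left[OF assms(2)] kron_one)
qed

section \<open>Product vectors and the exchange of registers\<close>

definition kvec :: "complex vec \<Rightarrow> complex vec \<Rightarrow> complex vec" where
  "kvec x y = vec (dim_vec x * dim_vec y) (\<lambda>i. x $ (i div dim_vec y) * y $ (i mod dim_vec y))"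

lemma kvec_carrier [simp]: "x \<in> carrier_vec a \<Longrightarrow> y \<in> carrier_vec b \<Longrightarrow> kvec x y \<in> carrier_vec (a * b)"
  unfolding kvec_def by (metis carrier_vecD vec_carrier)

lemma kvec_entry: "x \<in> carrier_vec a \<Longrightarrow> y \<in> carrier_vec b \<Longrightarrow> i < a * b \<Longrightarrow>
  kvec x y $ i = x $ (i div b) * y $ (i mod b)"
  by (simp add: kvec_def)

lemma kron_mult_kvec:
  assumes A: "A \<in> carrier_mat a b" and B: "B \<in> carrier_mat c d" and x: "x \<in> carrier_vec b" and y: "y \<in> carrier_vec d"
  shows "kron A B *\<^sub>v kvec x y = kvec (A *\<^sub>v x) (B *\<^sub>v y)"
proof (rule eq_vecI)
  have Ax: "A *\<^sub>v x \<in> carrier_vec a" "B *\<^sub>v y \<in> carrier_vec c" using A B x y by auto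
  fix i assume "i < dim_vec (kvec (A *\<^sub>v x) (B *\<^sub>v y))"
  then have i: "i < a * c" unfolding carrier_vecD[OF kvec_carrier[OF Ax]] .
  note dm = less_mult_div_mod[OF i]
  have "(kron A B *\<^sub>v kvec x y) $ i = (\<Sum>k<b*d. kron A B $$ (i,k) * kvec x y $ k)"
    by (rule mat_vec_entry[OF kron_carrier[OF A B] kvec_carrier[OF x y] i])
  also have "\<dots> = (\<Sum>p<b. \<Sum>q<d. (A $$ (i div c, p) * x $ p) * (B $$ (i mod c, q) * y $ q))"
    unfolding sum_lessThan_mult
  proof (intro sum.cong refl)
    fix p q assume "p \<in> {..<b}" "q \<in> {..<d}"
    then have pq: "p < b" "q < d" by auto
    then have "(p * d + q) div d = p" "(p * d + q) mod d = q" by auto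
    then show "kron A B $$ (i, p * d + q) * kvec x y $ (p * d + q) = (A $$ (i div c, p) * x $ p) * (B $$ (i mod c, q) * y $ q)"
      using kron_entry[OF A B i mult_add_less[OF pq]] kvec_entry[OF x y mult_add_less[OF pq]] by simp
  qed
  also have "\<dots> = (A *\<^sub>v x) $ (i div c) * (B *\<^sub>v y) $ (i mod c)"
    unfolding mat_vec_entry[OF A x dm[THEN conjunct1]] mat_vec_entry[OF B y dm[THEN conjunct2]]
    by (simp only: sum_product)
  also have "\<dots> = kvec (A *\<^sub>v x) (B *\<^sub>v y) $ i" by (rule kvec_entry[symmetric, OF Ax i])
  finally show "(kron A B *\<^sub>v kvec x y) $ i = kvec (A *\<^sub>v x) (B *\<^sub>v y) $ i" .
qed (use A B x y in \<open>auto simp: kvec_def kron_def\<close>)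

lemma kvec_unit_vec:
  assumes "0 < a" "0 < b"
  shows "kvec (unit_vec a 0) (unit_vec b 0) = unit_vec (a * b) 0"
proof (rule eq_vecI)
  fix i assume "i < dim_vec (unit_vec (a * b) 0 :: complex vec)"
  then have i: "i < a * b" by simp
  have "i = 0 \<longleftrightarrow> i div b = 0 \<and> i mod b = 0" using div_mult_mod_eq[of i b] by (auto simp: assms)
  then show "kvec (unit_vec a 0) (unit_vec b 0) $ i = unit_vec (a * b) 0 $ i"
    using less_mult_div_mod[OF i] i by (auto simp: kvec_def unit_vec_def)
qed (simp add: kvec_def)

definition swap_mat :: "nat \<Rightarrow> nat \<Rightarrow> complex mat" where
  "swap_mat a b = mat (b * a) (a * b) (\<lambda>(i,j). if j = (i mod a) * b + i div a then 1 else 0)"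

lemma swap_mat_carrier [simp]: "swap_mat a b \<in> carrier_mat (a * b) (a * b)"
  unfolding swap_mat_def by (subst mult.commute[of b a]) (rule mat_carrier)

lemma swap_mat_kvec:
  assumes x: "x \<in> carrier_vec a" and y: "y \<in> carrier_vec b"
  shows "swap_mat a b *\<^sub>v kvec x y = kvec y x"
proof (rule eq_vecI)
  fix i assume "i < dim_vec (kvec y x)"
  then have i: "i < b * a" using x y by (auto simp: kvec_def)
  note dm = less_mult_div_mod[OF i]
  define k where "k = (i mod a) * b + i div a"
  have k: "k < a * b" unfolding k_def by (rule mult_add_less) (use dm in auto)
  have "(swap_mat a b *\<^sub>v kvec x y) $ i = (\<Sum>j<a*b. swap_mat a b $$ (i,j) * kvec x y $ j)"
    by (rule mat_vec_entry[OF swap_mat_carrier kvec_carrier[OF x y]]) (use i in \<open>simp add: mult.commute\<close>)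
  also have "\<dots> = (\<Sum>j<a*b. if j = k then kvec x y $ k else 0)"
    by (rule sum.cong) (use i in \<open>auto simp: swap_mat_def k_def\<close>)
  also have "\<dots> = kvec x y $ k" using k by simp
  also have "\<dots> = kvec y x $ i"
    using kvec_entry[OF x y k] kvec_entry[OF y x i] dm by (simp add: k_def)
  finally show "(swap_mat a b *\<^sub>v kvec x y) $ i = kvec y x $ i" .
qed (use x y in \<open>auto simp: kvec_def swap_mat_def\<close>)

lemma unitary_swap_mat: "unitary_mat (a * b) (swap_mat a b)"
proof -
  have "cadj (swap_mat a b) * swap_mat a b = 1\<^sub>m (a * b)"
  proof (rule eq_matI)
    fix i j assume "i < dim_row (1\<^sub>m (a*b) :: complex mat)" "j < dim_col (1\<^sub>m (a*b) :: complex mat)"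
    then have ij: "i < a * b" "j < a * b" by auto
    note dm = less_mult_div_mod[OF ij(1)]
    \<comment> \<open>The only row in which column i has its entry 1.\<close>
    define k where "k = (i mod b) * a + i div b"
    have k: "k < b * a" unfolding k_def by (rule mult_add_less) (use dm in auto)
    have kk: "l = k \<longleftrightarrow> i = (l mod a) * b + l div a" if "l < b * a" for l
    proof
      assume "l = k"
      then show "i = (l mod a) * b + l div a" using dm by (simp add: k_def)
    next
      assume i: "i = (l mod a) * b + l div a"
      have "l div a < b" using less_mult_div_mod[OF that] by simp
      then have "i mod b = l div a" "i div b = l mod a" by (auto simp: i)
      then show "l = k" by (simp add: k_def)
    qed
    have ik: "i = (k mod a) * b + k div a" using kk[OF k] by simp
    have "(cadj (swap_mat a b) * swap_mat a b) $$ (i,j) = (\<Sum>l<a*b. cadj (swap_mat a b) $$ (i,l) * swap_mat a b $$ (l,j))"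
      by (rule mat_mult_entry) (use ij in auto)
    also have "\<dots> = (\<Sum>l<a*b. if l = k then (if i = j then 1 else 0) else 0)"
    proof (rule sum.cong[OF refl])
      fix l assume "l \<in> {..<a*b}"
      then have l: "l < b * a" by (simp add: mult.commute)
      then have "cadj (swap_mat a b) $$ (i,l) = (if l = k then 1 else 0)"
        using ij kk[OF l] by (simp add: swap_mat_def)
      moreover have "swap_mat a b $$ (l,j) = (if j = (l mod a) * b + l div a then 1 else 0)"
        using l ij by (simp add: swap_mat_def)
      ultimately show "cadj (swap_mat a b) $$ (i,l) * swap_mat a b $$ (l,j) = (if l = k then (if i = j then 1 else 0) else 0)"
        using ik by auto
    qed
    also have "\<dots> = 1\<^sub>m (a*b) $$ (i,j)" using k ij by (simp add: mult.commute)
    finally show "(cadj (swap_mat a b) * swap_mat a b) $$ (i,j) = 1\<^sub>m (a*b) $$ (i,j)" .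
  qed (auto simp: swap_mat_def)
  then show ?thesis by (simp add: unitary_mat_def)
qed

lemma cip_self: "cip v v = complex_of_real (\<Sum>i<dim_vec v. (cmod (v $ i))\<^sup>2)"
  unfolding cip_def of_real_sum by (rule sum.cong) (auto simp: complex_norm_square mult.commute simp del: of_real_power)

lemma unitary_norm:
  assumes U: "unitary_mat d U" and v: "v \<in> carrier_vec d"
  shows "(\<Sum>i<d. (cmod ((U *\<^sub>v v) $ i))\<^sup>2) = (\<Sum>i<d. (cmod (v $ i))\<^sup>2)"
proof -
  note c = unitary_carrier[OF U]
  have Uv: "U *\<^sub>v v \<in> carrier_vec d" using c v by simp
  have "cip (U *\<^sub>v v) (U *\<^sub>v v) = cip (cadj U *\<^sub>v (U *\<^sub>v v)) v"
    by (rule cip_adjoint[OF c Uv v])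
  also have "cadj U *\<^sub>v (U *\<^sub>v v) = (cadj U * U) *\<^sub>v v"
    by (rule assoc_mult_mat_vec[symmetric, of _ d d _ d]) (use c v in auto)
  also have "\<dots> = v" using v by (simp add: unitary_left[OF U])
  finally show ?thesis unfolding cip_self using Uv v by (simp only: of_real_eq_iff carrier_vecD)
qed

section \<open>States reachable by a query circuit\<close>

definition gates_ok :: "nat \<Rightarrow> (oracle_sel \<Rightarrow> nat) \<Rightarrow> (oracle_sel \<Rightarrow> complex mat) \<Rightarrow> bool" where
  "gates_ok n anc W \<longleftrightarrow> (\<forall>s. unitary_mat (2 ^ (n + anc s)) (W s))"

text \<open>The state is a function of the oracle assignment, so one derivation describes one
  circuit for all oracles, with \<open>N\<close> queries on \<open>m\<close> qubits. The kinds
  \<open>QPlain\<close> and \<open>QAdj\<close> keep the gate on exactly n + anc s qubits. Rule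
  \<open>cong\<close> compares states for unitary oracles alone, since dimensions and norms are
  controlled only there.\<close>

inductive reach :: "nat \<Rightarrow> (oracle_sel \<Rightarrow> nat) \<Rightarrow> nat \<Rightarrow> nat \<Rightarrow> ((oracle_sel \<Rightarrow> complex mat) \<Rightarrow> complex vec) \<Rightarrow> bool"
  for n anc m where
  init: "reach n anc m 0 (\<lambda>W. unit_vec (2^m) 0)"
| unit: "reach n anc m N f \<Longrightarrow> unitary_mat (2^m) V \<Longrightarrow> reach n anc m N (\<lambda>W. V *\<^sub>v f W)"
| query: "reach n anc m N f \<Longrightarrow> n + anc s \<le> m \<Longrightarrow> k \<in> {QPlain, QAdj} \<Longrightarrow>
    reach n anc m (Suc N) (\<lambda>W. embed m (query_gate k (W s)) *\<^sub>v f W)"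
| cong: "reach n anc m N f \<Longrightarrow> (\<And>W. gates_ok n anc W \<Longrightarrow> g W = f W) \<Longrightarrow> reach n anc m N g"

lemma unitary_query_gate:
  "gates_ok n anc W \<Longrightarrow> k \<in> {QPlain, QAdj} \<Longrightarrow> unitary_mat (2 ^ (n + anc s)) (query_gate k (W s))"
  by (auto simp: gates_ok_def unitary_cadj)

lemma embed_eq:
  assumes "unitary_mat (2^g) G" "g \<le> m"
  shows "embed m G = kron G (1\<^sub>m (2 ^ (m - g)))"
  using unitary_carrier[OF assms(1)] assms(2) by (simp add: embed_def power_diff)

lemma unitary_embed:
  assumes "unitary_mat (2^g) G" "g \<le> m"
  shows "unitary_mat (2^m) (embed m G)"
proof -
  have "(2::nat)^g * 2^(m-g) = 2^m" using assms(2) by (simp flip: power_add)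
  then show ?thesis using unitary_kron[OF assms(1) unitary_one[of "2^(m-g)"]] embed_eq[OF assms] by simp
qed

text \<open>Qubits appended at the end are not touched by a gate on the leading ones; associativity
  of \<open>kron\<close> regroups the padding.\<close>

lemma embed_mult_kvec:
  assumes G: "unitary_mat (2^g) G" and "g \<le> m1" and x: "x \<in> carrier_vec (2^m1)" and y: "y \<in> carrier_vec (2^m2)"
  shows "embed (m1 + m2) G *\<^sub>v kvec x y = kvec (embed m1 G *\<^sub>v x) y"
proof -
  note c = unitary_carrier[OF G]
  have "embed (m1 + m2) G = kron G (1\<^sub>m (2^(m1 + m2 - g)))" using embed_eq[OF G] assms(2) by simp
  also have "(1\<^sub>m (2^(m1 + m2 - g)) :: complex mat) = kron (1\<^sub>m (2^(m1-g))) (1\<^sub>m (2^m2))"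
    unfolding kron_one using assms(2) by (simp flip: power_add)
  also have "kron G \<dots> = kron (kron G (1\<^sub>m (2^(m1-g)))) (1\<^sub>m (2^m2))"
    by (rule kron_assoc[symmetric, OF c one_carrier_mat one_carrier_mat])
  also have "kron G (1\<^sub>m (2^(m1-g))) = embed m1 G" using embed_eq[OF G assms(2)] by simp
  finally have "embed (m1 + m2) G = kron (embed m1 G) (1\<^sub>m (2^m2))" .
  then show ?thesis
    using kron_mult_kvec[OF unitary_carrier[OF unitary_embed[OF G assms(2)]] one_carrier_mat x y] y by simp
qed

lemma reach_norm:
  assumes "reach n anc m N f" "gates_ok n anc W"
  shows "f W \<in> carrier_vec (2^m) \<and> (\<Sum>i<2^m. (cmod (f W $ i))\<^sup>2) = 1"
  using assms
proof (induction rule: reach.induct)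
  case init
  have "(\<Sum>i<2^m. (cmod (unit_vec (2^m) 0 $ i :: complex))\<^sup>2) = (\<Sum>i<(2::nat)^m. if i = 0 then 1 else 0)"
    by (rule sum.cong) (auto simp: unit_vec_def)
  then show ?case by simp
next
  case (unit N f V)
  then show ?case using unitary_norm[OF unit.hyps(2), of "f W"] unitary_carrier[OF unit.hyps(2)] by auto
next
  case (query N f s k)
  note u = unitary_embed[OF unitary_query_gate[OF query.prems query.hyps(3)] query.hyps(2)]
  show ?case using unitary_norm[OF u, of "f W"] unitary_carrier[OF u] query by auto
next
  case (cong N f g)
  then show ?case by simp
qed

text \<open>Runs a circuit on the trailing register. Interleaved unitaries are padded on the left; a
  query acts on the leading qubits, so the registers are swapped before it and swapped back after
  it.\<close>

lemma reach_tensor_init: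
  assumes "reach n anc m2 N g"
  shows "reach n anc (m1 + m2) N (\<lambda>W. kvec (unit_vec (2^m1) 0) (g W))"
  using assms
proof (induction rule: reach.induct)
  case init
  show ?case using reach.init[of n anc "m1 + m2"] by (simp add: kvec_unit_vec power_add)
next
  case (unit N f V)
  have "unitary_mat (2^(m1+m2)) (kron (1\<^sub>m (2^m1)) V)"
    using unitary_kron[OF unitary_one unit.hyps(2)] by (simp add: power_add)
  from reach.unit[OF unit.IH this] show ?case
    by (rule reach.cong)
      (use reach_norm[OF unit.hyps(1)] unitary_carrier[OF unit.hyps(2)] in
        \<open>simp add: kron_mult_kvec[of _ "2^m1" "2^m1" _ "2^m2" "2^m2"]\<close>)
next
  case (query N f s k)
  have sw: "unitary_mat (2^(m1+m2)) (swap_mat (2^m1) (2^m2))" "unitary_mat (2^(m1+m2)) (swap_mat (2^m2) (2^m1))"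
    using unitary_swap_mat[of "2^m1" "2^m2"] unitary_swap_mat[of "2^m2" "2^m1"] by (simp_all add: power_add mult.commute)
  have m: "n + anc s \<le> m1 + m2" using query.hyps(2) by simp
  from reach.unit[OF reach.query[OF reach.unit[OF query.IH sw(1)] m query.hyps(3)] sw(2)]
  show ?case
  proof (rule reach.cong)
    fix W assume W: "gates_ok n anc W"
    note u = unitary_query_gate[OF W query.hyps(3), of s]
    have fW: "f W \<in> carrier_vec (2^m2)" using reach_norm[OF query.hyps(1) W] by simp
    have EW: "embed m2 (query_gate k (W s)) *\<^sub>v f W \<in> carrier_vec (2^m2)"
      using unitary_carrier[OF unitary_embed[OF u query.hyps(2)]] fW by simp
    have e: "embed (m1 + m2) (query_gate k (W s)) *\<^sub>v kvec (f W) (unit_vec (2^m1) 0)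
        = kvec (embed m2 (query_gate k (W s)) *\<^sub>v f W) (unit_vec (2^m1) 0)"
      using embed_mult_kvec[OF u query.hyps(2) fW, of "unit_vec (2^m1) 0" m1] by (simp add: add.commute)
    show "kvec (unit_vec (2^m1) 0) (embed m2 (query_gate k (W s)) *\<^sub>v f W) =
      swap_mat (2^m2) (2^m1) *\<^sub>v (embed (m1 + m2) (query_gate k (W s)) *\<^sub>v
        (swap_mat (2^m1) (2^m2) *\<^sub>v kvec (unit_vec (2^m1) 0) (f W)))"
      unfolding swap_mat_kvec[OF unit_vec_carrier fW] e swap_mat_kvec[OF EW unit_vec_carrier] ..
  qed
next
  case (cong N f g)
  from cong.IH show ?case by (rule reach.cong) (simp add: cong.hyps)
qed

text \<open>The second circuit runs while the leading register is still in the vacuum, which is the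
  base case; the first circuit then runs on the leading register and needs no swaps.\<close>

lemma reach_tensor:
  assumes "reach n anc m1 N1 f" and g: "reach n anc m2 N2 g"
  shows "reach n anc (m1 + m2) (N1 + N2) (\<lambda>W. kvec (f W) (g W))"
  using assms(1)
proof (induction rule: reach.induct)
  case init
  show ?case using reach_tensor_init[OF g] by simp
next
  case (unit N f V)
  have "unitary_mat (2^(m1+m2)) (kron V (1\<^sub>m (2^m2)))"
    using unitary_kron[OF unit.hyps(2) unitary_one] by (simp add: power_add)
  from reach.unit[OF unit.IH this] show ?case
    by (rule reach.cong)
      (use reach_norm[OF unit.hyps(1)] reach_norm[OF g] unitary_carrier[OF unit.hyps(2)] in
        \<open>simp add: kron_mult_kvec[of _ "2^m1" "2^m1" _ "2^m2" "2^m2"]\<close>)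
next
  case (query N f s k)
  have m: "n + anc s \<le> m1 + m2" using query.hyps(2) by simp
  from reach.query[OF query.IH m query.hyps(3)]
  have "reach n anc (m1 + m2) (Suc N + N2) (\<lambda>W. embed (m1 + m2) (query_gate k (W s)) *\<^sub>v kvec (f W) (g W))" by simp
  then show ?case
  proof (rule reach.cong)
    fix W assume W: "gates_ok n anc W"
    have "f W \<in> carrier_vec (2^m1)" "g W \<in> carrier_vec (2^m2)"
      using reach_norm[OF query.hyps(1) W] reach_norm[OF g W] by auto
    from embed_mult_kvec[OF unitary_query_gate[OF W query.hyps(3)] query.hyps(2) this]
    show "kvec (embed m1 (query_gate k (W s)) *\<^sub>v f W) (g W) = embed (m1 + m2) (query_gate k (W s)) *\<^sub>v kvec (f W) (g W)"
      by simp
  qed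
next
  case (cong N f g')
  from cong.IH show ?case by (rule reach.cong) (simp add: cong.hyps)
qed

lemma run_steps_append:
  "run_steps P Q m (xs @ ys) v = run_steps P Q m ys (run_steps P Q m xs v)"
  by (induction P Q m xs v rule: run_steps.induct) auto

lemma run_steps_carrier:
  assumes "gates_ok n anc W" "v \<in> carrier_vec (2^m)"
    and "\<forall>(s,k,U)\<in>set xs. n + anc s \<le> m \<and> k \<in> {QPlain, QAdj} \<and> unitary_mat (2^m) U"
  shows "run_steps (W OrRho) (W OrSigma) m xs v \<in> carrier_vec (2^m)"
  using assms(2,3)
proof (induction xs arbitrary: v)
  case (Cons a xs)
  obtain s k U where a: "a = (s,k,U)" by (cases a)
  have W: "sel_oracle s (W OrRho) (W OrSigma) = W s" by (cases s) (auto simp: sel_oracle_def)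
  have "unitary_mat (2^m) U" "unitary_mat (2^m) (embed m (query_gate k (W s)))"
    using Cons.prems(2) unitary_embed[OF unitary_query_gate[OF assms(1)]] by (auto simp: a)
  then show ?case using Cons.prems by (auto simp: a W dest!: unitary_carrier intro!: Cons.IH)
qed simp

text \<open>The concrete format has exactly one unitary after each query. A further unitary is
  therefore multiplied into the last step, or into \<open>U0\<close> if there is no step yet, and a
  new query is followed by the identity.\<close>

lemma reach_run:
  assumes "reach n anc m N f"
  shows "\<exists>U0 steps. unitary_mat (2^m) U0 \<and> length steps = N \<and>
     (\<forall>(s,k,U)\<in>set steps. n + anc s \<le> m \<and> k \<in> {QPlain, QAdj} \<and> unitary_mat (2^m) U) \<and>
     (\<forall>W. gates_ok n anc W \<longrightarrow> final_state (W OrRho) (W OrSigma) m U0 steps = f W)"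
  using assms
proof (induction rule: reach.induct)
  case init
  show ?case by (intro exI[of _ "1\<^sub>m (2^m)"] exI[of _ "[]"]) (simp add: unitary_one final_state_def)
next
  case (unit N f V)
  then obtain U0 steps where h: "unitary_mat (2^m) U0" "length steps = N"
    "\<forall>(s,k,U)\<in>set steps. n + anc s \<le> m \<and> k \<in> {QPlain, QAdj} \<and> unitary_mat (2^m) U"
    "\<And>W. gates_ok n anc W \<Longrightarrow> final_state (W OrRho) (W OrSigma) m U0 steps = f W" by blast
  note Vc = unitary_carrier[OF unit.hyps(2)] and Uc = unitary_carrier[OF h(1)]
  show ?case
  proof (cases steps rule: rev_cases)
    case Nil
    have "final_state (W OrRho) (W OrSigma) m (V * U0) [] = V *\<^sub>v f W" if "gates_ok n anc W" for W
      using h(4)[OF that] Nil Vc Uc by (simp add: final_state_def assoc_mult_mat_vec[of _ "2^m" "2^m" _ "2^m"])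
    then show ?thesis using h Nil unitary_mult[OF unit.hyps(2) h(1)] by (intro exI[of _ "V * U0"] exI[of _ "[]"]) auto
  next
    case (snoc ys y)
    obtain s k U where y: "y = (s,k,U)" by (cases y)
    have hy: "n + anc s \<le> m" "k \<in> {QPlain, QAdj}" "unitary_mat (2^m) U" using h(3) by (auto simp: snoc y)
    have "final_state (W OrRho) (W OrSigma) m U0 (ys @ [(s,k,V*U)]) = V *\<^sub>v f W" if W: "gates_ok n anc W" for W
    proof -
      have Ws: "sel_oracle s (W OrRho) (W OrSigma) = W s" by (cases s) (auto simp: sel_oracle_def)
      define z where "z = run_steps (W OrRho) (W OrSigma) m ys (U0 *\<^sub>v unit_vec (2^m) 0)"
      have z: "z \<in> carrier_vec (2^m)" unfolding z_def
        by (rule run_steps_carrier[OF W]) (use h(3) Uc in \<open>auto simp: snoc\<close>)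
      have "embed m (query_gate k (W s)) *\<^sub>v z \<in> carrier_vec (2^m)"
        using unitary_carrier[OF unitary_embed[OF unitary_query_gate[OF W hy(2)] hy(1)]] z by simp
      then show ?thesis
        using h(4)[OF W] Vc unitary_carrier[OF hy(3)]
        by (simp add: final_state_def snoc y run_steps_append Ws z_def[symmetric] flip: assoc_mult_mat_vec[of _ "2^m" "2^m" _ "2^m"])
    qed
    then show ?thesis using h hy snoc y unitary_mult[OF unit.hyps(2) hy(3)]
      by (intro exI[of _ U0] exI[of _ "ys @ [(s,k,V*U)]"]) auto
  qed
next
  case (query N f s k)
  then obtain U0 steps where h: "unitary_mat (2^m) U0" "length steps = N"
    "\<forall>(s,k,U)\<in>set steps. n + anc s \<le> m \<and> k \<in> {QPlain, QAdj} \<and> unitary_mat (2^m) U"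
    "\<And>W. gates_ok n anc W \<Longrightarrow> final_state (W OrRho) (W OrSigma) m U0 steps = f W" by blast
  have "final_state (W OrRho) (W OrSigma) m U0 (steps @ [(s,k,1\<^sub>m (2^m))]) = embed m (query_gate k (W s)) *\<^sub>v f W"
    if W: "gates_ok n anc W" for W
  proof -
    have Ws: "sel_oracle s (W OrRho) (W OrSigma) = W s" by (cases s) (auto simp: sel_oracle_def)
    have "embed m (query_gate k (W s)) *\<^sub>v f W \<in> carrier_vec (2^m)"
      using unitary_carrier[OF unitary_embed[OF unitary_query_gate[OF W query.hyps(3)] query.hyps(2)]]
        reach_norm[OF query.hyps(1) W] by simp
    then show ?thesis using h(4)[OF W] by (simp add: final_state_def run_steps_append Ws)
  qed
  then show ?case using h query.hyps(2,3) unitary_one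
    by (intro exI[of _ U0] exI[of _ "steps @ [(s,k,1\<^sub>m (2^m))]"]) auto
next
  case (cong N f g)
  then show ?case by (metis (no_types, lifting))
qed

section \<open>Repeated measurements\<close>

lemma exp_le_quadratic: "exp y \<le> 1 + y + y\<^sup>2" if "\<bar>y\<bar> \<le> 1" for y :: real
proof (cases "0 \<le> y")
  case True
  then show ?thesis using exp_bound[of y] that by simp
next
  case False
  define t where "t = - y"
  have t: "0 < t" "t \<le> 1" using False that by (auto simp: t_def)
  have "exp y * (1 + t) \<le> exp y * exp t" by (intro mult_left_mono) (auto simp: exp_ge_add_one_self)
  also have "\<dots> = 1" by (simp add: t_def flip: exp_add)
  \<comment> \<open>The factorisation of 1 + t^3 by 1 + t has the wanted quadratic as
    cofactor.\<close>
  also have "1 \<le> 1 + t ^ 3" using t by simp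
  also have "1 + t ^ 3 = (1 - t + t\<^sup>2) * (1 + t)" by (simp add: power2_eq_square power3_eq_cube algebra_simps)
  finally have "exp y \<le> 1 - t + t\<^sup>2" using t by (simp add: mult_le_cancel_right)
  then show ?thesis by (simp add: t_def)
qed

text \<open>For a centred Bernoulli variable the linear terms cancel, and the quadratic ones add up
  to the variance p (1 - p), here bounded by 1.\<close>

lemma bernoulli_mgf:
  fixes p l :: real
  assumes p: "0 \<le> p" "p \<le> 1" and l: "\<bar>l\<bar> \<le> 1"
  shows "p * exp (l * (1 - p)) + (1 - p) * exp (- (l * p)) \<le> exp (l\<^sup>2)"
proof -
  have "\<bar>l * (1 - p)\<bar> \<le> 1 * 1" "\<bar>- (l * p)\<bar> \<le> 1 * 1"
    unfolding abs_mult abs_minus_cancel by (intro mult_mono; use p l in auto)+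
  then have "p * exp (l * (1 - p)) + (1 - p) * exp (- (l * p))
      \<le> p * (1 + l * (1 - p) + (l * (1 - p))\<^sup>2) + (1 - p) * (1 + (- (l * p)) + (- (l * p))\<^sup>2)"
    by (intro add_mono mult_left_mono exp_le_quadratic) (use p in auto)
  also have "\<dots> = 1 + l\<^sup>2 * (p * (1 - p))" by (simp add: power2_eq_square algebra_simps)
  also have "p * (1 - p) \<le> 1 * 1" by (intro mult_mono) (use p in auto)
  then have "1 + l\<^sup>2 * (p * (1 - p)) \<le> 1 + l\<^sup>2 * 1" by (intro add_left_mono mult_left_mono) auto
  also have "\<dots> \<le> exp (l\<^sup>2)" using exp_ge_add_one_self[of "l\<^sup>2"] by simp
  finally show ?thesis .
qed

text \<open>Reads z as r digits in base D, leading digit first. A digit 0 is a register found in the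
  vacuum, so the value is the number of successes among r repetitions.\<close>

fun count_zero :: "nat \<Rightarrow> nat \<Rightarrow> nat \<Rightarrow> nat" where
  "count_zero D 0 z = 0"
| "count_zero D (Suc r) z = (if z div D ^ r = 0 then 1 else 0) + count_zero D r (z mod D ^ r)"

fun kvec_power :: "complex vec \<Rightarrow> nat \<Rightarrow> complex vec" where
  "kvec_power v 0 = unit_vec 1 0"
| "kvec_power v (Suc r) = kvec v (kvec_power v r)"

lemma reach_kvec_power:
  assumes "reach n anc m N f"
  shows "reach n anc (r * m) (r * N) (\<lambda>W. kvec_power (f W) r)"
proof (induction r)
  case 0
  show ?case using reach.init[of n anc 0] by simp
next
  case (Suc r)
  show ?case using reach_tensor[OF assms Suc] by simp
qed

lemma kvec_power_carrier: "v \<in> carrier_vec D \<Longrightarrow> kvec_power v r \<in> carrier_vec (D ^ r)"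
  by (induction r) auto

lemma sum_kvec:
  fixes F :: "nat \<Rightarrow> nat \<Rightarrow> real"
  assumes x: "x \<in> carrier_vec a" and y: "y \<in> carrier_vec b"
  shows "(\<Sum>z<a*b. (cmod (kvec x y $ z))\<^sup>2 * F (z div b) (z mod b))
     = (\<Sum>i<a. \<Sum>j<b. (cmod (x $ i))\<^sup>2 * (cmod (y $ j))\<^sup>2 * F i j)"
  unfolding sum_lessThan_mult
proof (intro sum.cong refl)
  fix i j assume "i \<in> {..<a}" "j \<in> {..<b}"
  then have ij: "i < a" "j < b" by auto
  then have dm: "(i * b + j) div b = i" "(i * b + j) mod b = j" by auto
  then show "(cmod (kvec x y $ (i * b + j)))\<^sup>2 * F ((i * b + j) div b) ((i * b + j) mod b)
    = (cmod (x $ i))\<^sup>2 * (cmod (y $ j))\<^sup>2 * F i j"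
    using kvec_entry[OF x y mult_add_less[OF ij]] by (simp add: norm_mult power_mult_distrib)
qed

text \<open>Outcome probabilities of a product state are products, so the moment generating function
  is a product of r Bernoulli factors.\<close>

lemma count_zero_mgf:
  fixes l p :: real
  assumes v: "v \<in> carrier_vec D" and n: "(\<Sum>i<D. (cmod (v $ i))\<^sup>2) = 1" and D: "0 < D" and l: "\<bar>l\<bar> \<le> 1"
  defines "p \<equiv> (cmod (v $ 0))\<^sup>2"
  shows "(\<Sum>z<D^r. (cmod (kvec_power v r $ z))\<^sup>2 * exp (l * (count_zero D r z - r * p))) \<le> exp (r * l\<^sup>2)"
proof (induction r)
  case 0
  show ?case by simp
next
  case (Suc r)
  have p1: "0 \<le> p" "p \<le> 1"
    using member_le_sum[of 0 "{..<D}" "\<lambda>i. (cmod (v $ i))\<^sup>2"] D by (auto simp: p_def n)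
  define g where "g i = exp (l * ((if i = 0 then 1 else 0) - p))" for i :: nat
  define G where "G j = exp (l * (count_zero D r j - r * p))" for j
  have "(\<Sum>z<D^Suc r. (cmod (kvec_power v (Suc r) $ z))\<^sup>2 * exp (l * (count_zero D (Suc r) z - Suc r * p)))
      = (\<Sum>z<D*D^r. (cmod (kvec v (kvec_power v r) $ z))\<^sup>2 * (g (z div D^r) * G (z mod D^r)))"
    by (intro sum.cong) (auto simp: g_def G_def algebra_simps simp flip: exp_add)
  also have "\<dots> = (\<Sum>i<D. \<Sum>j<D^r. (cmod (v $ i))\<^sup>2 * (cmod (kvec_power v r $ j))\<^sup>2 * (g i * G j))"
    by (rule sum_kvec[OF v kvec_power_carrier[OF v]])
  also have "\<dots> = (\<Sum>i<D. (cmod (v $ i))\<^sup>2 * g i) * (\<Sum>j<D^r. (cmod (kvec_power v r $ j))\<^sup>2 * G j)"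
    unfolding sum_product by (intro sum.cong refl) (simp add: mult_ac)
  also have "(\<Sum>i<D. (cmod (v $ i))\<^sup>2 * g i)
      = (\<Sum>i<D. (cmod (v $ i))\<^sup>2 * exp (- (l * p)) + (if i = 0 then p * exp (l * (1 - p)) - p * exp (- (l * p)) else 0))"
    by (intro sum.cong) (auto simp: g_def p_def)
  also have "\<dots> = exp (- (l * p)) + (p * exp (l * (1 - p)) - p * exp (- (l * p)))"
    using D unfolding sum.distrib sum_distrib_right[symmetric] n by simp
  also have "\<dots> = p * exp (l * (1 - p)) + (1 - p) * exp (- (l * p))" by (simp add: algebra_simps)
  also have "\<dots> * (\<Sum>j<D^r. (cmod (kvec_power v r $ j))\<^sup>2 * G j) \<le> exp (l\<^sup>2) * exp (r * l\<^sup>2)"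
    by (intro mult_mono bernoulli_mgf p1 l Suc.IH[folded G_def] sum_nonneg) (auto simp: G_def)
  also have "\<dots> = exp (Suc r * l\<^sup>2)" by (simp add: algebra_simps flip: exp_add)
  finally show ?case .
qed

text \<open>Chernoff bound with parameters c/2 and -c/2: the exponent is -c^2 r/2 from the threshold
  plus c^2 r/4 from the generating function. The indicator weight 0 or 1 lets failure probabilities
  be added and compared termwise.\<close>

lemma count_zero_tail:
  fixes c p :: real
  assumes v: "v \<in> carrier_vec D" and n: "(\<Sum>i<D. (cmod (v $ i))\<^sup>2) = 1" and D: "0 < D"
    and c: "0 < c" "c \<le> 1" and r: "0 < r"
  defines "p \<equiv> (cmod (v $ 0))\<^sup>2"
  shows "(\<Sum>z<D^r. (cmod (kvec_power v r $ z))\<^sup>2 * (if \<bar>count_zero D r z / r - p\<bar> \<le> c then 0 else 1)) \<le> 2 * exp (- (c\<^sup>2 * r / 4))"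
proof -
  define w where "w z = (cmod (kvec_power v r $ z))\<^sup>2" for z
  define Z where "Z z = count_zero D r z - r * p" for z
  have *: "(if \<bar>count_zero D r z / r - p\<bar> \<le> c then 0 else 1)
      \<le> exp (- (c\<^sup>2 * r / 2)) * (exp (c / 2 * Z z) + exp (- (c / 2) * Z z))" for z
  proof (cases "\<bar>count_zero D r z / r - p\<bar> \<le> c")
    case False
    have "Z z = r * (count_zero D r z / r - p)" using r by (simp add: Z_def algebra_simps)
    then have "\<bar>Z z\<bar> = r * \<bar>count_zero D r z / r - p\<bar>" by (simp add: abs_mult)
    also have "\<dots> \<ge> r * c" using False by (intro mult_left_mono) auto
    finally have Z: "r * c \<le> \<bar>Z z\<bar>" .
    then have "c / 2 * (r * c) \<le> c / 2 * \<bar>Z z\<bar>" using c by (intro mult_left_mono) auto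
    then have "0 \<le> - (c\<^sup>2 * r / 2) + c / 2 * \<bar>Z z\<bar>" by (simp add: power2_eq_square algebra_simps)
    then have "1 \<le> exp (- (c\<^sup>2 * r / 2) + c / 2 * \<bar>Z z\<bar>)" by simp
    also have "\<dots> \<le> exp (- (c\<^sup>2 * r / 2)) * (exp (c / 2 * Z z) + exp (- (c / 2) * Z z))"
      unfolding exp_add by (intro mult_left_mono) (auto simp: abs_if)
    finally show ?thesis using False by simp
  qed auto
  have "(\<Sum>z<D^r. w z * (if \<bar>count_zero D r z / r - p\<bar> \<le> c then 0 else 1))
     \<le> (\<Sum>z<D^r. w z * (exp (- (c\<^sup>2 * r / 2)) * (exp (c / 2 * Z z) + exp (- (c / 2) * Z z))))"
    by (intro sum_mono mult_left_mono *) (auto simp: w_def)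
  also have "\<dots> = exp (- (c\<^sup>2 * r / 2)) * ((\<Sum>z<D^r. w z * exp (c / 2 * Z z)) + (\<Sum>z<D^r. w z * exp (- (c / 2) * Z z)))"
    unfolding sum.distrib[symmetric] sum_distrib_left by (intro sum.cong) (auto simp: algebra_simps)
  also have "\<dots> \<le> exp (- (c\<^sup>2 * r / 2)) * (exp (r * (c / 2)\<^sup>2) + exp (r * (- (c / 2))\<^sup>2))"
    unfolding w_def Z_def p_def
    by (intro mult_left_mono add_mono count_zero_mgf[OF v n D]) (use c in auto)
  also have "\<dots> = 2 * exp (- (c\<^sup>2 * r / 2) + r * (c / 2)\<^sup>2)" by (simp add: mult_exp_exp)
  also have "- (c\<^sup>2 * r / 2) + r * (c / 2)\<^sup>2 = - (c\<^sup>2 * r / 4)" by (simp add: power2_eq_square algebra_simps)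
  finally show ?thesis unfolding w_def .
qed

text \<open>One circuit whose outcome approximates all values \<open>q i W\<close>, i in I, within c
  simultaneously, except with probability \<delta>. \<open>M\<close> is a lower bound on the width,
  carried along to meet the size condition on valid algorithms.\<close>

definition estimates :: "nat \<Rightarrow> (oracle_sel \<Rightarrow> nat) \<Rightarrow> real \<Rightarrow> nat \<Rightarrow> nat \<Rightarrow> real \<Rightarrow>
    'i set \<Rightarrow> ('i \<Rightarrow> (oracle_sel \<Rightarrow> complex mat) \<Rightarrow> real) \<Rightarrow> bool" where
  "estimates n anc c M N \<delta> I q \<longleftrightarrow> (\<exists>m f out. M \<le> m \<and> reach n anc m N f \<and>
     (\<forall>W. gates_ok n anc W \<longrightarrow>
       (\<Sum>z<2^m. (cmod (f W $ z))\<^sup>2 * (if \<forall>i\<in>I. \<bar>out z i - q i W\<bar> \<le> c then 0 else 1)) \<le> \<delta>))"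

text \<open>An idle register of M qubits; it is what provides the minimal width in later
  unions.\<close>

lemma estimates_empty: "estimates n anc c M 0 0 {} q"
  unfolding estimates_def
  by (intro exI[of _ M] exI[of _ "\<lambda>W. unit_vec (2^M) 0"] exI[of _ undefined]) (auto intro: reach.init)

lemma estimates_repeat:
  assumes f: "reach n anc m N f" and c: "0 < c" "c \<le> 1" and r: "0 < r"
    and q: "\<And>W. gates_ok n anc W \<Longrightarrow> q i W = (cmod (f W $ 0))\<^sup>2"
  shows "estimates n anc c 0 (r * N) (2 * exp (- (c\<^sup>2 * r / 4))) {i} q"
  unfolding estimates_def
proof (intro exI conjI allI impI)
  show "reach n anc (r * m) (r * N) (\<lambda>W. kvec_power (f W) r)" by (rule reach_kvec_power[OF f])
  fix W assume W: "gates_ok n anc W"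
  have e: "(2::nat) ^ (r * m) = (2 ^ m) ^ r" by (simp add: power_mult mult.commute)
  show "(\<Sum>z<2^(r*m). (cmod (kvec_power (f W) r $ z))\<^sup>2 *
     (if \<forall>i\<in>{i}. \<bar>(\<lambda>z i. count_zero (2^m) r z / r) z i - q i W\<bar> \<le> c then 0 else 1)) \<le> 2 * exp (- (c\<^sup>2 * r / 4))"
    unfolding e using count_zero_tail[OF _ _ _ c r, of "f W" "2^m"] reach_norm[OF f W] q[OF W] by simp
qed simp

text \<open>The circuits sit side by side and the outcome splits by division with remainder; the
  failure probabilities obey the union bound.\<close>

lemma estimates_union:
  assumes "estimates n anc c M N1 \<delta>1 I q" "estimates n anc c 0 N2 \<delta>2 J q"
  shows "estimates n anc c M (N1 + N2) (\<delta>1 + \<delta>2) (I \<union> J) q"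
proof -
  obtain m1 f1 out1 where 1: "M \<le> m1" "reach n anc m1 N1 f1"
    "\<And>W. gates_ok n anc W \<Longrightarrow> (\<Sum>z<2^m1. (cmod (f1 W $ z))\<^sup>2 * (if \<forall>i\<in>I. \<bar>out1 z i - q i W\<bar> \<le> c then 0 else 1)) \<le> \<delta>1"
    using assms(1) unfolding estimates_def by blast
  obtain m2 f2 out2 where 2: "reach n anc m2 N2 f2"
    "\<And>W. gates_ok n anc W \<Longrightarrow> (\<Sum>z<2^m2. (cmod (f2 W $ z))\<^sup>2 * (if \<forall>i\<in>J. \<bar>out2 z i - q i W\<bar> \<le> c then 0 else 1)) \<le> \<delta>2"
    using assms(2) unfolding estimates_def by blast
  \<comment> \<open>An index lying in both sets is answered by the first circuit.\<close>
  define out where "out z i = (if i \<in> I then out1 (z div 2^m2) i else out2 (z mod 2^m2) i)" for z i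
  show ?thesis unfolding estimates_def
  proof (intro exI conjI allI impI)
    show "M \<le> m1 + m2" using 1(1) by simp
    show "reach n anc (m1 + m2) (N1 + N2) (\<lambda>W. kvec (f1 W) (f2 W))" by (rule reach_tensor[OF 1(2) 2(1)])
    fix W assume W: "gates_ok n anc W"
    note n1 = reach_norm[OF 1(2) W] and n2 = reach_norm[OF 2(1) W]
    define b1 :: "nat \<Rightarrow> real" where "b1 x = (if \<forall>i\<in>I. \<bar>out1 x i - q i W\<bar> \<le> c then 0 else 1)" for x
    define b2 :: "nat \<Rightarrow> real" where "b2 x = (if \<forall>i\<in>J. \<bar>out2 x i - q i W\<bar> \<le> c then 0 else 1)" for x
    have b: "(if \<forall>i\<in>I \<union> J. \<bar>out z i - q i W\<bar> \<le> c then 0 else 1) \<le> b1 (z div 2^m2) + b2 (z mod 2^m2)" for z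
      by (auto simp: b1_def b2_def out_def)
    have "(\<Sum>z<2^(m1+m2). (cmod (kvec (f1 W) (f2 W) $ z))\<^sup>2 * (if \<forall>i\<in>I \<union> J. \<bar>out z i - q i W\<bar> \<le> c then 0 else 1))
       \<le> (\<Sum>z<2^m1*2^m2. (cmod (kvec (f1 W) (f2 W) $ z))\<^sup>2 * (b1 (z div 2^m2) + b2 (z mod 2^m2)))"
      unfolding power_add by (intro sum_mono mult_left_mono b) auto
    also have "\<dots> = (\<Sum>i<2^m1. \<Sum>j<2^m2. (cmod (f1 W $ i))\<^sup>2 * (cmod (f2 W $ j))\<^sup>2 * (b1 i + b2 j))"
      by (rule sum_kvec) (use n1 n2 in auto)
    also have "\<dots> = (\<Sum>i<2^m1. \<Sum>j<2^m2. ((cmod (f1 W $ i))\<^sup>2 * b1 i) * (cmod (f2 W $ j))\<^sup>2)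
       + (\<Sum>i<2^m1. \<Sum>j<2^m2. (cmod (f1 W $ i))\<^sup>2 * ((cmod (f2 W $ j))\<^sup>2 * b2 j))"
      unfolding sum.distrib[symmetric] by (intro sum.cong refl) (simp add: algebra_simps)
    also have "\<dots> = (\<Sum>i<2^m1. (cmod (f1 W $ i))\<^sup>2 * b1 i) + (\<Sum>j<2^m2. (cmod (f2 W $ j))\<^sup>2 * b2 j)"
      unfolding sum_product[symmetric] using n1 n2 by simp
    also have "\<dots> \<le> \<delta>1 + \<delta>2" using 1(3)[OF W] 2(2)[OF W] unfolding b1_def b2_def by (rule add_mono)
    finally show "(\<Sum>z<2^(m1+m2). (cmod (kvec (f1 W) (f2 W) $ z))\<^sup>2 * (if \<forall>i\<in>I \<union> J. \<bar>out z i - q i W\<bar> \<le> c then 0 else 1)) \<le> \<delta>1 + \<delta>2" .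
  qed
qed

lemma estimates_finite:
  fixes \<delta> :: real
  assumes "finite I" "\<And>i. i \<in> I \<Longrightarrow> estimates n anc c 0 (N i) \<delta> {i} q"
  shows "estimates n anc c M (\<Sum>i\<in>I. N i) (card I * \<delta>) I q"
  using assms
proof (induction I)
  case empty
  show ?case using estimates_empty by simp
next
  case (insert i I)
  have "estimates n anc c M (sum N I + N i) (card I * \<delta> + \<delta>) (I \<union> {i}) q"
    by (rule estimates_union) (use insert in auto)
  then show ?case using insert.hyps by (simp add: algebra_simps)
qed

section \<open>Recovering an angle from squared cosines of its dyadic multiples\<close>

lemma sin_ge_cubic: "\<bar>x\<bar> * (1 - x\<^sup>2 / 6) \<le> \<bar>sin x\<bar>" for x :: real
proof -
  have f: "(fact 3 :: real) = 6" by (simp add: fact_numeral)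
  have "\<bar>sin x - (\<Sum>m<3. sin_coeff m * x ^ m)\<bar> \<le> inverse (fact 3) * \<bar>x\<bar> ^ 3"
    by (rule Maclaurin_sin_bound)
  moreover have "(\<Sum>m<3. sin_coeff m * x ^ m) = x"
    by (simp add: sin_coeff_def numeral_3_eq_3)
  ultimately have "\<bar>sin x - x\<bar> \<le> \<bar>x\<bar> ^ 3 / 6" by (simp add: f field_simps)
  moreover have "\<bar>x\<bar> ^ 3 = \<bar>x\<bar> * x\<^sup>2" by (simp add: power3_eq_cube power2_eq_square)
  ultimately have "\<bar>x\<bar> \<le> \<bar>sin x\<bar> + \<bar>x\<bar> * x\<^sup>2 / 6" by linarith
  then show ?thesis by (simp add: right_diff_distrib)
qed

lemma abs_le_two_sin: "\<bar>x\<bar> \<le> 2 * \<bar>sin x\<bar>" if "\<bar>x\<bar> \<le> 3 / 2" for x :: real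
proof -
  have "x\<^sup>2 \<le> (3/2)\<^sup>2" using power_mono[OF that, of 2] by simp
  then have "1 / 2 \<le> 1 - x\<^sup>2 / 6" by (simp add: power2_eq_square)
  then have "\<bar>x\<bar> * (1 / 2) \<le> \<bar>x\<bar> * (1 - x\<^sup>2 / 6)" by (intro mult_left_mono) auto
  then show ?thesis using sin_ge_cubic[of x] by simp
qed

text \<open>The range reaches 2, hence covers any difference of two angles in [0, pi/2], since pi/2
  < 2. At the end point 1 - 4/6 is exactly 1/3.\<close>

lemma abs_le_three_sin: "\<bar>x\<bar> \<le> 3 * \<bar>sin x\<bar>" if "\<bar>x\<bar> \<le> 2" for x :: real
proof -
  have "x\<^sup>2 \<le> 2\<^sup>2" using power_mono[OF that, of 2] by simp
  then have "1 / 3 \<le> 1 - x\<^sup>2 / 6" by (simp add: power2_eq_square)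
  then have "\<bar>x\<bar> * (1 / 3) \<le> \<bar>x\<bar> * (1 - x\<^sup>2 / 6)" by (intro mult_left_mono) auto
  then show ?thesis using sin_ge_cubic[of x] by simp
qed

lemma cos_sq_diff: "(cos x)\<^sup>2 - (cos y)\<^sup>2 = - (sin (x + y) * sin (x - y))" for x y :: real
proof -
  have "sin (x + y) * sin (x - y) = (sin x)\<^sup>2 * (cos y)\<^sup>2 - (cos x)\<^sup>2 * (sin y)\<^sup>2"
    by (simp add: sin_add sin_diff power2_eq_square algebra_simps)
  also have "\<dots> = (1 - (cos x)\<^sup>2) * (cos y)\<^sup>2 - (cos x)\<^sup>2 * (1 - (cos y)\<^sup>2)"
    by (simp add: sin_squared_eq)
  finally show ?thesis by (simp add: algebra_simps)
qed

text \<open>Consecutive multiples \<open>j\<close> and \<open>j + 1\<close> are probed because \<open>sin (j s)\<close> may vanish,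
  but then \<open>sin ((j + 1) s)\<close> does not.\<close>

lemma angle_recovery:
  fixes a a' :: real
  assumes a: "3/5 \<le> a" "a \<le> 4/5" and a': "3/5 \<le> a'" "a' \<le> 4/5"
    and h: "\<And>k b. k \<le> K \<Longrightarrow> b \<le> 1 \<Longrightarrow>
      \<bar>(cos (real (2^k + b) * arccos a))\<^sup>2 - (cos (real (2^k + b) * arccos a'))\<^sup>2\<bar> \<le> 2/25"
  shows "\<bar>a - a'\<bar> \<le> (2/5) / 2^K"
proof -
  define p where "p = arccos a"
  define p' where "p' = arccos a'"
  define s where "s = p + p'"
  define t where "t = p - p'"
  have cp: "cos p = a" "cos p' = a'" unfolding p_def p'_def using a a' by (auto intro!: cos_arccos)
  \<comment> \<open>By the 3-4-5 triangle the interval [3/5, 4/5] is mapped to itself by x \<mapsto>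
    sqrt(1 - x^2), so sines obey the same bounds as cosines.\<close>
  have sp: "3/5 \<le> sin p" "sin p \<le> 4/5" "3/5 \<le> sin p'" "sin p' \<le> 4/5"
  proof -
    have *: "3/5 \<le> sin (arccos x) \<and> sin (arccos x) \<le> 4/5" if "3/5 \<le> x" "x \<le> 4/5" for x :: real
    proof -
      have "(3/5)\<^sup>2 \<le> x\<^sup>2" "x\<^sup>2 \<le> (4/5)\<^sup>2" using that by (auto intro!: power_mono)
      then have "(3/5)\<^sup>2 \<le> 1 - x\<^sup>2" "1 - x\<^sup>2 \<le> (4/5)\<^sup>2" by (simp_all add: power2_eq_square)
      then have "sqrt ((3/5)\<^sup>2) \<le> sqrt (1 - x\<^sup>2)" "sqrt (1 - x\<^sup>2) \<le> sqrt ((4/5)\<^sup>2)"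
        by (simp_all only: real_sqrt_le_iff)
      then have "3/5 \<le> sqrt (1 - x\<^sup>2)" "sqrt (1 - x\<^sup>2) \<le> 4/5"
        unfolding real_sqrt_abs by auto
      then show ?thesis using that by (simp add: sin_arccos)
    qed
    show "3/5 \<le> sin p" "sin p \<le> 4/5" "3/5 \<le> sin p'" "sin p' \<le> 4/5"
      using *[OF a] *[OF a'] by (auto simp: p_def p'_def)
  qed
  have prod: "9/25 \<le> x * y \<and> x * y \<le> 16/25" if "3/5 \<le> x" "x \<le> 4/5" "3/5 \<le> y" "y \<le> 4/5" for x y :: real
    using mult_mono[of "3/5" x "3/5" y] mult_mono[of x "4/5" y "4/5"] that by auto
  \<comment> \<open>sin s is the sum, and sin t the difference, of two products lying in
    [9/25, 16/25].\<close>
  have sin_s: "18/25 \<le> \<bar>sin s\<bar>"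
    using prod[OF sp(1,2) a'] prod[OF a sp(3,4)] by (simp add: s_def sin_add cp)
  have sin_t: "\<bar>sin t\<bar> \<le> 7/25"
    using prod[OF sp(1,2) a'] prod[OF a sp(3,4)] unfolding t_def sin_diff cp by (intro abs_leI) auto
  have "0 \<le> p" "p \<le> pi/2" "0 \<le> p'" "p' \<le> pi/2"
    unfolding p_def p'_def using a a' arccos_le_pi2[of a] arccos_le_pi2[of a'] arccos_lbound[of a] arccos_lbound[of a'] by auto
  \<comment> \<open>Bootstrap: from 2 to 3 * 7/25, which is inside the range of the sharper sine
    bound, and then to 2 * 7/25. So the level k = 0 starts with 2 * 14/25 < 3/2.\<close>
  then have "\<bar>t\<bar> \<le> 2" using pi_half_less_two by (simp add: t_def)
  then have "\<bar>t\<bar> \<le> 3/2" using abs_le_three_sin[of t] sin_t by simp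
  then have t1: "\<bar>t\<bar> \<le> 14/25" using abs_le_two_sin[of t] sin_t by simp
  \<comment> \<open>One of the two multiples of s has sine at least 9/25, half of 18/25. The
    tolerance 2/25 then leaves at most 2/9 for the sine of the same multiple of t, and the sine
    bound doubles this to 4/9.\<close>
  have step: "2^k * \<bar>t\<bar> \<le> 4/9" if k: "k \<le> K" "(2^k + 1) * \<bar>t\<bar> \<le> 3/2" for k
  proof -
    define j where "j = (2::real)^k"
    have "sin s = sin ((j + 1) * s - j * s)" by (simp add: algebra_simps)
    then have "sin s = sin ((j + 1) * s) * cos (j * s) - cos ((j + 1) * s) * sin (j * s)"
      by (simp only: sin_diff)
    moreover have "\<bar>sin ((j + 1) * s) * cos (j * s)\<bar> \<le> \<bar>sin ((j + 1) * s)\<bar>"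
      using mult_left_mono[OF abs_cos_le_one[of "j * s"], of "\<bar>sin ((j + 1) * s)\<bar>"] by (simp add: abs_mult)
    moreover have "\<bar>cos ((j + 1) * s) * sin (j * s)\<bar> \<le> \<bar>sin (j * s)\<bar>"
      using mult_right_mono[OF abs_cos_le_one[of "(j + 1) * s"], of "\<bar>sin (j * s)\<bar>"] by (simp add: abs_mult)
    ultimately have "18/25 \<le> \<bar>sin ((j + 1) * s)\<bar> + \<bar>sin (j * s)\<bar>" using sin_s by linarith
    then have "9/25 \<le> \<bar>sin ((j + 1) * s)\<bar> \<or> 9/25 \<le> \<bar>sin (j * s)\<bar>" by linarith
    then obtain b :: nat where b: "b \<le> 1" "9/25 \<le> \<bar>sin ((j + b) * s)\<bar>"
      by (metis add.right_neutral le_refl of_nat_0 of_nat_1 zero_le)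
    have jb: "real (2^k + b) = j + b" by (simp add: j_def)
    have "\<bar>sin ((j + b) * s) * sin ((j + b) * t)\<bar> \<le> 2/25"
      using h[OF k(1) b(1)] unfolding cos_sq_diff jb p_def[symmetric] p'_def[symmetric]
      by (simp add: s_def t_def distrib_left right_diff_distrib)
    moreover have "9/25 * \<bar>sin ((j + b) * t)\<bar> \<le> \<bar>sin ((j + b) * s) * sin ((j + b) * t)\<bar>"
      unfolding abs_mult by (rule mult_right_mono[OF b(2)]) simp
    ultimately have st: "\<bar>sin ((j + b) * t)\<bar> \<le> 2/9" by simp
    have j0: "0 \<le> j" by (simp add: j_def)
    have "\<bar>(j + b) * t\<bar> = (j + b) * \<bar>t\<bar>" using j0 by (simp add: abs_mult)
    also have "\<dots> \<le> (j + 1) * \<bar>t\<bar>" using b(1) by (intro mult_right_mono) auto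
    finally have "\<bar>(j + b) * t\<bar> \<le> 3/2" using k(2) by (simp add: j_def)
    from abs_le_two_sin[OF this] st have "\<bar>(j + b) * t\<bar> \<le> 4/9" by simp
    moreover have "j * \<bar>t\<bar> \<le> (j + b) * \<bar>t\<bar>" by (intro mult_right_mono) auto
    ultimately show ?thesis using j0 by (simp add: abs_mult j_def)
  qed
  \<comment> \<open>Level k yields 2 * 4/9 + 4/9 = 4/3 at level k + 1, still below 3/2; the branch
    of the sine is never lost.\<close>
  have inv: "(2^k + 1) * \<bar>t\<bar> \<le> 3/2" if "k \<le> K" for k
    using that
  proof (induction k)
    case 0
    then show ?case using t1 by simp
  next
    case (Suc k)
    then have "2^k * \<bar>t\<bar> \<le> 4/9" using step[of k] by simp
    moreover have "1 * \<bar>t\<bar> \<le> 2^k * \<bar>t\<bar>" by (intro mult_right_mono) auto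
    moreover have "(2^(Suc k) + 1) * \<bar>t\<bar> = 2 * (2^k * \<bar>t\<bar>) + \<bar>t\<bar>" by (simp add: algebra_simps)
    ultimately show ?case by linarith
  qed
  have tK: "2^K * \<bar>t\<bar> \<le> 4/9" using step inv by simp
  \<comment> \<open>Back from angles to cosines: a + a' is at least 6/5, so |a - a'| is at most 5/6
    of |t|, and 5/6 * 4/9 = 10/27 is below 2/5.\<close>
  have "a\<^sup>2 - a'\<^sup>2 = - (sin s * sin t)" using cos_sq_diff[of p p'] by (simp add: cp s_def t_def)
  then have "(a - a') * (a + a') = - (sin s * sin t)" by (simp add: power2_eq_square algebra_simps)
  from arg_cong[OF this, of abs] have "\<bar>a - a'\<bar> * (a + a') = \<bar>sin s\<bar> * \<bar>sin t\<bar>"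
    using a a' by (simp add: abs_mult)
  also have "\<dots> \<le> 1 * \<bar>t\<bar>" by (intro mult_mono abs_sin_le_one abs_sin_x_le_abs_x) auto
  finally have "\<bar>a - a'\<bar> * (a + a') \<le> \<bar>t\<bar>" by simp
  moreover have "\<bar>a - a'\<bar> * (6/5) \<le> \<bar>a - a'\<bar> * (a + a')" using a a' by (intro mult_left_mono) auto
  ultimately have "\<bar>a - a'\<bar> * (6/5) \<le> \<bar>t\<bar>" by linarith
  then have "2^K * (\<bar>a - a'\<bar> * (6/5)) \<le> 2^K * \<bar>t\<bar>" by (intro mult_left_mono) auto
  with tK have "2^K * (\<bar>a - a'\<bar> * (6/5)) \<le> 4/9" by (rule order_trans[rotated])
  then have "2^K * \<bar>a - a'\<bar> * (6/5) \<le> 4/9" by (simp only: mult.assoc)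
  then have "2^K * \<bar>a - a'\<bar> \<le> 2/5" by linarith
  then show ?thesis by (simp add: field_simps)
qed

section \<open>Chebyshev iteration with a reflection\<close>

definition refl0 :: "nat \<Rightarrow> complex mat" where
  "refl0 D = mat D D (\<lambda>(i,j). if i = j then (if i = 0 then 1 else - 1) else 0)"

lemma refl0_carrier [simp]: "refl0 D \<in> carrier_mat D D"
  by (simp add: refl0_def)

lemma refl0_mult_vec:
  assumes "v \<in> carrier_vec D" "i < D"
  shows "(refl0 D *\<^sub>v v) $ i = (if i = 0 then v $ 0 else - (v $ i))"
proof -
  have "(refl0 D *\<^sub>v v) $ i = (\<Sum>k<D. refl0 D $$ (i,k) * v $ k)"
    by (rule mat_vec_entry[OF refl0_carrier assms])
  also have "\<dots> = (\<Sum>k<D. if k = i then (if i = 0 then v $ 0 else - (v $ i)) else 0)"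
    using assms by (intro sum.cong) (auto simp: refl0_def)
  finally show ?thesis using assms by simp
qed

lemma refl0_involution:
  assumes "v \<in> carrier_vec D"
  shows "refl0 D *\<^sub>v (refl0 D *\<^sub>v v) = v"
proof (rule eq_vecI)
  have c: "refl0 D *\<^sub>v v \<in> carrier_vec D" using mult_mat_vec_carrier[OF refl0_carrier assms] .
  fix i assume "i < dim_vec v"
  then have i: "i < D" using assms by simp
  then have D: "0 < D" by simp
  show "(refl0 D *\<^sub>v (refl0 D *\<^sub>v v)) $ i = v $ i"
    using refl0_mult_vec[OF c i] refl0_mult_vec[OF assms i] refl0_mult_vec[OF assms D] by auto
qed (use assms in \<open>simp add: refl0_def\<close>)

lemma unitary_refl0: "unitary_mat D (refl0 D)"
proof -
  have "cadj (refl0 D) = refl0 D" by (rule eq_matI) (auto simp: refl0_def)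
  moreover have "refl0 D * refl0 D = 1\<^sub>m D"
  proof (rule eq_matI)
    fix i j assume "i < dim_row (1\<^sub>m D :: complex mat)" "j < dim_col (1\<^sub>m D :: complex mat)"
    then have ij: "i < D" "j < D" by auto
    have "(refl0 D * refl0 D) $$ (i,j) = (\<Sum>k<D. refl0 D $$ (i,k) * refl0 D $$ (k,j))"
      by (rule mat_mult_entry[OF refl0_carrier refl0_carrier ij])
    also have "\<dots> = (\<Sum>k<D. if k = i then (if i = j then 1 else 0) else 0)"
      using ij by (intro sum.cong) (auto simp: refl0_def)
    finally show "(refl0 D * refl0 D) $$ (i,j) = 1\<^sub>m D $$ (i,j)" using ij by simp
  qed (auto simp: refl0_def)
  ultimately show ?thesis by (simp add: unitary_mat_def)
qed

definition cheb_step :: "nat \<Rightarrow> complex mat \<Rightarrow> complex vec \<Rightarrow> complex vec" where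
  "cheb_step D R v = refl0 D *\<^sub>v (R *\<^sub>v v)"

lemma cheb_step_carrier:
  "R \<in> carrier_mat D D \<Longrightarrow> v \<in> carrier_vec D \<Longrightarrow> cheb_step D R v \<in> carrier_vec D"
  unfolding cheb_step_def by (intro mult_mat_vec_carrier[OF refl0_carrier] mult_mat_vec_carrier)

text \<open>Since \<open>Z = refl0 D\<close> equals \<open>2 |0><0| - 1\<close> and \<open>R\<close>, \<open>Z\<close> are involutions,
  \<open><0|(Z R + R Z)|u> = 2 <0|R|0> <0|u>\<close>, which is the Chebyshev recurrence.\<close>

lemma cheb_iterate:
  assumes R: "R \<in> carrier_mat D D" and RR: "R * R = 1\<^sub>m D" and D: "0 < D"
    and R0: "R $$ (0,0) = complex_of_real (cos \<phi>)"
  shows "(cheb_step D R ^^ j) (unit_vec D 0) \<in> carrier_vec D \<and>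
    (cheb_step D R ^^ j) (unit_vec D 0) $ 0 = complex_of_real (cos (j * \<phi>))"
proof (induction j rule: induct_nat_012)
  case 0
  show ?case using D by simp
next
  case 1
  have "(R *\<^sub>v unit_vec D 0) $ 0 = (\<Sum>k<D. R $$ (0,k) * unit_vec D 0 $ k)"
    by (rule mat_vec_entry[OF R unit_vec_carrier D])
  also have "\<dots> = (\<Sum>k<D. if k = 0 then R $$ (0,0) else 0)"
    by (intro sum.cong) (auto simp: unit_vec_def)
  finally have "(R *\<^sub>v unit_vec D 0) $ 0 = R $$ (0,0)" using D by simp
  then show ?case using R0 D cheb_step_carrier[OF R unit_vec_carrier]
      refl0_mult_vec[OF mult_mat_vec_carrier[OF R unit_vec_carrier] D] by (simp add: cheb_step_def)
next
  case (ge2 j)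
  define x where "x = (cheb_step D R ^^ j) (unit_vec D 0)"
  define y where "y = cheb_step D R x"
  have x: "x \<in> carrier_vec D" "x $ 0 = complex_of_real (cos (j * \<phi>))" using ge2 by (auto simp: x_def)
  have y: "y \<in> carrier_vec D" "y $ 0 = complex_of_real (cos (Suc j * \<phi>))" using ge2(2) by (auto simp: x_def y_def)
  have Rx: "R *\<^sub>v x \<in> carrier_vec D" "R *\<^sub>v y \<in> carrier_vec D" using R x y by auto
  \<comment> \<open>Undoing the last step gives x = R Z y. Its vacuum entry is x_0 = 2 R_00 y_0 - (R
    y)_0, and Z fixes entry 0, so this determines the vacuum entry of the next iterate.\<close>
  have Zy: "refl0 D *\<^sub>v y = R *\<^sub>v x" unfolding y_def cheb_step_def by (rule refl0_involution[OF Rx(1)])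
  have "R *\<^sub>v (R *\<^sub>v x) = (R * R) *\<^sub>v x" by (rule assoc_mult_mat_vec[symmetric, OF R R x(1)])
  then have "x = R *\<^sub>v (refl0 D *\<^sub>v y)" using x(1) by (simp add: RR Zy)
  then have "x $ 0 = (\<Sum>k<D. R $$ (0,k) * (refl0 D *\<^sub>v y) $ k)"
    using mat_vec_entry[OF R _ D, of "refl0 D *\<^sub>v y"] Zy Rx by simp
  also have "\<dots> = (\<Sum>k<D. (if k = 0 then 2 * R $$ (0,0) * y $ 0 else 0) - R $$ (0,k) * y $ k)"
    by (intro sum.cong) (auto simp: refl0_mult_vec[OF y(1)])
  also have "\<dots> = 2 * R $$ (0,0) * y $ 0 - (R *\<^sub>v y) $ 0"
    using D by (simp add: sum_subtractf mat_vec_entry[OF R y(1) D] del: index_mult_mat_vec)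
  finally have "(R *\<^sub>v y) $ 0 = complex_of_real (2 * cos \<phi> * cos (Suc j * \<phi>) - cos (j * \<phi>))"
    using x(2) y(2) R0 by (simp add: algebra_simps)
  also have "2 * cos \<phi> * cos (Suc j * \<phi>) - cos (j * \<phi>) = cos (Suc (Suc j) * \<phi>)"
  proof -
    have "cos (Suc (Suc j) * \<phi>) = cos (Suc j * \<phi> + \<phi>)" "cos (j * \<phi>) = cos (Suc j * \<phi> - \<phi>)"
      by (simp_all add: algebra_simps)
    then show ?thesis unfolding cos_add cos_diff by simp
  qed
  finally have "(R *\<^sub>v y) $ 0 = complex_of_real (cos (Suc (Suc j) * \<phi>))" .
  then have "cheb_step D R y $ 0 = complex_of_real (cos (Suc (Suc j) * \<phi>))"
    unfolding cheb_step_def using refl0_mult_vec[OF Rx(2) D] by simp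
  moreover have "(cheb_step D R ^^ Suc (Suc j)) (unit_vec D 0) = cheb_step D R y"
    by (simp add: x_def y_def)
  ultimately show ?case using cheb_step_carrier[OF R y(1)] by simp
qed

section \<open>The probing circuit\<close>

definition sqnorm :: "nat \<Rightarrow> (nat \<Rightarrow> complex) \<Rightarrow> real" where
  "sqnorm d v = (\<Sum>i<d. (cmod (v i))\<^sup>2)"

definition overlap :: "nat \<Rightarrow> complex mat \<Rightarrow> (nat \<Rightarrow> complex) \<Rightarrow> real" where
  "overlap d \<rho> v = Re (sesq d \<rho> v v) / sqnorm d v"

definition proj :: "nat \<Rightarrow> (nat \<Rightarrow> complex) \<Rightarrow> complex mat" where
  "proj d v = mat d d (\<lambda>(i,j). v i * cnj (v j) / complex_of_real (sqnorm d v))"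

definition tiltA :: "complex mat" where
  "tiltA = mat 2 2 (\<lambda>(i,j). if i = 0 \<and> j = 0 then 3/5 else if i = 1 \<and> j = 1 then - 3/5 else 4/5)"

text \<open>The difference between the reflection with rows (4/5, 3/5), (3/5, -4/5) and
  \<open>tiltA\<close>; the 3-4-5 triangle keeps all entries rational.\<close>

definition tiltC :: "complex mat" where
  "tiltC = mat 2 2 (\<lambda>(i,j). if i = 0 \<and> j = 0 then 1/5 else - 1/5)"

text \<open>On the range of the projection the last qubit sees the reflection \<open>tiltA + tiltC\<close>, off it \<open>tiltA\<close>.
  This keeps the expectation in \<open>[3/5, 4/5]\<close>, where arccos is well conditioned.\<close>

definition probe :: "nat \<Rightarrow> nat \<Rightarrow> (nat \<Rightarrow> complex) \<Rightarrow> complex mat" where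
  "probe d e v = kron (kron (proj d v) (1\<^sub>m e)) tiltC + kron (1\<^sub>m (d * e)) tiltA"

lemma proj_carrier [simp]: "proj d v \<in> carrier_mat d d" by (simp add: proj_def)
lemma tilt_carrier [simp]: "tiltA \<in> carrier_mat 2 2" "tiltC \<in> carrier_mat 2 2"
  by (simp_all add: tiltA_def tiltC_def)

lemma proj_idem:
  assumes "sqnorm d v \<noteq> 0" shows "proj d v * proj d v = proj d v"
proof (rule eq_matI)
  let ?s = "complex_of_real (sqnorm d v)"
  have s: "(\<Sum>k<d. cnj (v k) * v k) = ?s"
    unfolding sqnorm_def of_real_sum by (rule sum.cong) (auto simp: complex_norm_square mult.commute simp del: of_real_power)
  fix i j assume "i < dim_row (proj d v)" "j < dim_col (proj d v)"
  then have ij: "i < d" "j < d" by (auto simp: proj_def)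
  have "(proj d v * proj d v) $$ (i,j) = (\<Sum>k<d. proj d v $$ (i,k) * proj d v $$ (k,j))"
    by (rule mat_mult_entry[OF proj_carrier proj_carrier ij])
  also have "\<dots> = (\<Sum>k<d. (v i * cnj (v j) / (?s * ?s)) * (cnj (v k) * v k))"
    using ij by (intro sum.cong) (auto simp: proj_def)
  also have "\<dots> = (v i * cnj (v j) / (?s * ?s)) * ?s" unfolding sum_distrib_left[symmetric] s ..
  also have "\<dots> = proj d v $$ (i,j)" using ij assms by (simp add: proj_def)
  finally show "(proj d v * proj d v) $$ (i,j) = proj d v $$ (i,j)" .
qed (auto simp: proj_def)

lemma cadj_proj: "cadj (proj d v) = proj d v"
  by (rule eq_matI) (auto simp: proj_def)

lemma mat2_mult_entry:
  "A \<in> carrier_mat 2 2 \<Longrightarrow> B \<in> carrier_mat 2 2 \<Longrightarrow> i < 2 \<Longrightarrow> j < 2 \<Longrightarrow>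
   (A * B) $$ (i,j) = A $$ (i,0) * B $$ (0,j) + A $$ (i,1) * B $$ (1,j)"
  by (subst mat_mult_entry[of _ 2 2 _ 2]) (auto simp: numeral_2_eq_2)

text \<open>The second identity says that \<open>tiltA + tiltC\<close> squares to the same matrix as
  \<open>tiltA\<close>, in expanded form.\<close>

lemma tilt_squares:
  "tiltA * tiltA = 1\<^sub>m 2" "tiltC * tiltC + (tiltC * tiltA + tiltA * tiltC) = 0\<^sub>m 2 2"
proof -
  show "tiltA * tiltA = 1\<^sub>m 2"
  proof (rule eq_matI)
    fix i j assume "i < dim_row (1\<^sub>m 2 :: complex mat)" "j < dim_col (1\<^sub>m 2 :: complex mat)"
    then have ij: "i < 2" "j < 2" by auto
    show "(tiltA * tiltA) $$ (i,j) = 1\<^sub>m 2 $$ (i,j)"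
      unfolding mat2_mult_entry[OF tilt_carrier(1,1) ij]
      using less_2_cases[OF ij(1)] less_2_cases[OF ij(2)] by (auto simp: tiltA_def)
  qed (auto simp: tiltA_def)
  show "tiltC * tiltC + (tiltC * tiltA + tiltA * tiltC) = 0\<^sub>m 2 2"
  proof (rule eq_matI)
    fix i j assume "i < dim_row (0\<^sub>m 2 2 :: complex mat)" "j < dim_col (0\<^sub>m 2 2 :: complex mat)"
    then have ij: "i < 2" "j < 2" by auto
    have "(tiltC * tiltC + (tiltC * tiltA + tiltA * tiltC)) $$ (i,j) =
      (tiltC * tiltC) $$ (i,j) + ((tiltC * tiltA) $$ (i,j) + (tiltA * tiltC) $$ (i,j))"
      using ij carrier_matD[OF tilt_carrier(1)] carrier_matD[OF tilt_carrier(2)] by (simp del: index_mult_mat(1))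
    also have "\<dots> = 0" using less_2_cases[OF ij(1)] less_2_cases[OF ij(2)]
      unfolding mat2_mult_entry[OF tilt_carrier(2,2) ij] mat2_mult_entry[OF tilt_carrier(2,1) ij] mat2_mult_entry[OF tilt_carrier(1,2) ij]
      by (auto simp: tiltA_def tiltC_def)
    finally show "(tiltC * tiltC + (tiltC * tiltA + tiltA * tiltC)) $$ (i,j) = 0\<^sub>m 2 2 $$ (i,j)" using ij by simp
  qed (auto simp: tiltA_def tiltC_def)
qed

lemma kron_add_right:
  assumes "A \<in> carrier_mat a b" "B \<in> carrier_mat c d" "B' \<in> carrier_mat c d"
  shows "kron A (B + B') = kron A B + kron A B'"
proof (rule eq_matI)
  fix i j assume "i < dim_row (kron A B + kron A B')" "j < dim_col (kron A B + kron A B')"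
  then have ij: "i < a * c" "j < b * d" using assms by (auto simp: kron_def)
  have s: "B + B' \<in> carrier_mat c d" using assms by simp
  have "(kron A B + kron A B') $$ (i,j) = kron A B $$ (i,j) + kron A B' $$ (i,j)"
    using ij carrier_matD[OF kron_carrier[OF assms(1,3)]] by (intro index_add_mat(1)) auto
  then show "kron A (B + B') $$ (i,j) = (kron A B + kron A B') $$ (i,j)"
    using ij assms
      kron_entry[OF assms(1,2) ij] kron_entry[OF assms(1,3) ij] kron_entry[OF assms(1) s ij]
      less_mult_div_mod[OF ij(1)] less_mult_div_mod[OF ij(2)] by (simp add: distrib_left)
qed (use assms in \<open>auto simp: kron_def\<close>)

lemma probe_carrier: "probe d e v \<in> carrier_mat (d * e * 2) (d * e * 2)"
  unfolding probe_def by simp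

text \<open>The projection Q is idempotent, so every term containing \<open>tiltC\<close> carries
  the same factor Q, and their sum is Q tensored with the vanishing combination in
  \<open>tilt_squares\<close>.\<close>

lemma probe_involution:
  assumes "sqnorm d v \<noteq> 0" shows "probe d e v * probe d e v = 1\<^sub>m (d * e * 2)"
proof -
  define Q where "Q = kron (proj d v) (1\<^sub>m e)"
  have Q: "Q \<in> carrier_mat (d * e) (d * e)" by (simp add: Q_def)
  have QQ: "Q * Q = Q"
    unfolding Q_def by (subst kron_mult[of _ d d _ e e _ d _ e]) (simp_all add: proj_idem[OF assms])
  let ?K = "kron Q tiltC" and ?L = "kron (1\<^sub>m (d * e)) tiltA" and ?D = "d * e * 2"
  have c: "?K \<in> carrier_mat ?D ?D" "?L \<in> carrier_mat ?D ?D" using Q by auto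
  have KK: "?K * ?K = kron Q (tiltC * tiltC)"
    by (subst kron_mult[OF Q tilt_carrier(2) Q tilt_carrier(2)]) (simp add: QQ)
  have KL: "?K * ?L = kron Q (tiltC * tiltA)"
    by (subst kron_mult[OF Q tilt_carrier(2) one_carrier_mat tilt_carrier(1)]) (use Q in simp)
  have LK: "?L * ?K = kron Q (tiltA * tiltC)"
    by (subst kron_mult[OF one_carrier_mat tilt_carrier(1) Q tilt_carrier(2)]) (use Q in simp)
  have LL: "?L * ?L = 1\<^sub>m ?D"
    by (subst kron_mult[OF one_carrier_mat tilt_carrier(1) one_carrier_mat tilt_carrier(1)]) (simp add: tilt_squares kron_one)
  have t: "tiltC * tiltC \<in> carrier_mat 2 2" "tiltC * tiltA \<in> carrier_mat 2 2" "tiltA * tiltC \<in> carrier_mat 2 2"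
    by (rule mult_carrier_mat; rule tilt_carrier)+
  have "kron Q (tiltC * tiltC) + (kron Q (tiltC * tiltA) + kron Q (tiltA * tiltC)) = kron Q (0\<^sub>m 2 2)"
    unfolding kron_add_right[OF Q t(2,3), symmetric] tilt_squares(2)[symmetric]
    by (rule kron_add_right[OF Q t(1), symmetric]) (use t in simp)
  also have "\<dots> = 0\<^sub>m ?D ?D"
  proof (rule eq_matI)
    fix i j assume "i < dim_row (0\<^sub>m ?D ?D :: complex mat)" "j < dim_col (0\<^sub>m ?D ?D :: complex mat)"
    then have ij: "i < d * e * 2" "j < d * e * 2" by auto
    show "kron Q (0\<^sub>m 2 2) $$ (i,j) = 0\<^sub>m ?D ?D $$ (i,j)"
      using kron_entry[OF Q zero_carrier_mat ij] ij less_mult_div_mod[OF ij(1)] less_mult_div_mod[OF ij(2)] by simp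
  qed (use Q in \<open>auto simp: kron_def\<close>)
  finally have z: "?K * ?K + (?K * ?L + ?L * ?K) = 0\<^sub>m ?D ?D" unfolding KK KL LK .
  have cc: "?K * ?K \<in> carrier_mat ?D ?D" "?K * ?L \<in> carrier_mat ?D ?D" "?L * ?K \<in> carrier_mat ?D ?D" "?L * ?L \<in> carrier_mat ?D ?D"
    by (rule mult_carrier_mat; rule c)+
  have "(?K + ?L) * (?K + ?L) = (?K + ?L) * ?K + (?K + ?L) * ?L"
    by (rule mult_add_distrib_mat[of _ ?D ?D _ ?D]) (use c in auto)
  also have "\<dots> = (?K * ?K + ?L * ?K) + (?K * ?L + ?L * ?L)"
    unfolding add_mult_distrib_mat[OF c c(1)] add_mult_distrib_mat[OF c c(2)] ..
  also have "\<dots> = (?K * ?K + (?K * ?L + ?L * ?K)) + ?L * ?L"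
    using cc by (intro eq_matI) (auto simp: add_ac simp del: index_mult_mat(1))
  also have "\<dots> = 1\<^sub>m ?D" unfolding z LL by simp
  finally show ?thesis by (simp add: probe_def Q_def)
qed

lemma cadj_probe: "cadj (probe d e v) = probe d e v"
proof -
  have A: "cadj tiltA = tiltA" by (rule eq_matI) (auto simp: tiltA_def)
  have C: "cadj tiltC = tiltC" by (rule eq_matI) (auto simp: tiltC_def)
  have k: "kron (proj d v) (1\<^sub>m e) \<in> carrier_mat (d * e) (d * e)" by simp
  show ?thesis unfolding probe_def
    by (subst cadj_add[of _ "d * e * 2" "d * e * 2"])
      (auto simp: cadj_kron[OF k tilt_carrier(2)] cadj_kron[OF one_carrier_mat tilt_carrier(1)]
        cadj_kron[OF proj_carrier one_carrier_mat] A C cadj_proj)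
qed

lemma unitary_probe: "sqnorm d v \<noteq> 0 \<Longrightarrow> unitary_mat (d * e * 2) (probe d e v)"
  using probe_involution[of d v e] probe_carrier[of d e v] by (simp add: unitary_mat_def cadj_probe)

text \<open>The vector w is the purification with the last qubit in state 0, so the tilts enter only
  through their corner entries 3/5 and 1/5. The expectation of the projection on a purification is
  its expectation in the reduced state.\<close>

lemma probe_expectation:
  assumes G: "unitary_mat (d * e) G" and de: "0 < d * e"
    and \<rho>: "\<And>i j. i < d \<Longrightarrow> j < d \<Longrightarrow> \<rho> $$ (i,j) = (\<Sum>l<e. G $$ (i*e+l, 0) * cnj (G $$ (j*e+l, 0)))"
  defines "w \<equiv> \<lambda>k. kron G (1\<^sub>m 2) $$ (k,0)"
  shows "sesq (d * e * 2) (probe d e v) w w = 3/5 + 1/5 * (sesq d \<rho> v v / complex_of_real (sqnorm d v))"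
proof -
  note Gc = unitary_carrier[OF G]
  define g where "g i = G $$ (i,0)" for i
  let ?D = "d * e" and ?s = "complex_of_real (sqnorm d v)"
  define Q where "Q = kron (proj d v) (1\<^sub>m e)"
  have Q: "Q \<in> carrier_mat ?D ?D" by (simp add: Q_def)
  \<comment> \<open>Even positions carry column 0 of G, odd ones vanish.\<close>
  have w0: "w (i * 2 + 0) = g i" "w (i * 2 + 1) = 0" if "i < ?D" for i
    using kron_entry[OF Gc one_carrier_mat, of "i*2+0" 2 0] kron_entry[OF Gc one_carrier_mat, of "i*2+1" 2 0] that de
    by (auto simp: w_def g_def)
  have X: "probe d e v $$ (i * 2 + 0, j * 2 + 0) = 1/5 * Q $$ (i,j) + (if i = j then 3/5 else 0)" if ij: "i < ?D" "j < ?D" for i j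
  proof -
    have b: "i * 2 < ?D * 2" "j * 2 < ?D * 2" using ij by auto
    have c: "kron Q tiltC \<in> carrier_mat (?D * 2) (?D * 2)" "kron (1\<^sub>m ?D) tiltA \<in> carrier_mat (?D * 2) (?D * 2)"
      using Q by auto
    have "probe d e v $$ (i * 2, j * 2) = kron Q tiltC $$ (i * 2, j * 2) + kron (1\<^sub>m ?D) tiltA $$ (i * 2, j * 2)"
      unfolding probe_def Q_def[symmetric] using b carrier_matD[OF c(2)] by (intro index_add_mat(1)) auto
    also have "\<dots> = 1/5 * Q $$ (i,j) + (if i = j then 3/5 else 0)"
      unfolding kron_entry[OF Q tilt_carrier(2) b] kron_entry[OF one_carrier_mat tilt_carrier(1) b]
      using ij by (simp add: tiltA_def tiltC_def)
    finally show ?thesis by simp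
  qed
  have "sesq (?D * 2) (probe d e v) w w
      = (\<Sum>i<?D. \<Sum>j<?D. cnj (g i) * (1/5 * Q $$ (i,j) + (if i = j then 3/5 else 0)) * g j)"
    unfolding sesq_def sum_lessThan_mult[where b = 2]
  proof (rule sum.cong[OF refl])
    fix i assume "i \<in> {..<?D}"
    then have i: "i < ?D" by simp
    have s2: "(\<Sum>a<2. F a) = F 0 + F 1" for F :: "nat \<Rightarrow> complex" by (simp add: numeral_2_eq_2)
    have 1: "(\<Sum>j<?D. \<Sum>b<2. cnj (w (i*2+1)) * probe d e v $$ (i*2+1, j*2+b) * w (j*2+b)) = 0"
      using w0(2)[OF i] by simp
    have 0: "(\<Sum>j<?D. \<Sum>b<2. cnj (w (i*2+0)) * probe d e v $$ (i*2+0, j*2+b) * w (j*2+b))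
       = (\<Sum>j<?D. cnj (g i) * (1/5 * Q $$ (i,j) + (if i = j then 3/5 else 0)) * g j)"
    proof (rule sum.cong[OF refl])
      fix j assume "j \<in> {..<?D}"
      then have j: "j < ?D" by simp
      show "(\<Sum>b<2. cnj (w (i*2+0)) * probe d e v $$ (i*2+0, j*2+b) * w (j*2+b))
        = cnj (g i) * (1/5 * Q $$ (i,j) + (if i = j then 3/5 else 0)) * g j"
        unfolding s2 w0[OF i] w0[OF j] X[OF i j] by simp
    qed
    show "(\<Sum>a<2. \<Sum>j<?D. \<Sum>b<2. cnj (w (i*2+a)) * probe d e v $$ (i*2+a, j*2+b) * w (j*2+b))
       = (\<Sum>j<?D. cnj (g i) * (1/5 * Q $$ (i,j) + (if i = j then 3/5 else 0)) * g j)"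
      unfolding s2[of "\<lambda>a. \<Sum>j<?D. \<Sum>b<2. cnj (w (i*2+a)) * probe d e v $$ (i*2+a, j*2+b) * w (j*2+b)"] 0 1 by simp
  qed
  also have "\<dots> = (\<Sum>i<?D. \<Sum>j<?D. 1/5 * (cnj (g i) * Q $$ (i,j) * g j)) + (\<Sum>i<?D. \<Sum>j<?D. if j = i then 3/5 * (cnj (g i) * g i) else 0)"
    unfolding sum.distrib[symmetric] by (intro sum.cong refl) (auto simp: algebra_simps)
  also have "(\<Sum>i<?D. \<Sum>j<?D. if j = i then 3/5 * (cnj (g i) * g i) else 0) = 3/5 * (\<Sum>i<?D. cnj (g i) * g i)"
    by (simp add: sum_distrib_left)
  also have "(\<Sum>i<?D. cnj (g i) * g i) = (\<Sum>i<?D. cadj G $$ (0,i) * G $$ (i,0))"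
    by (rule sum.cong) (use Gc de in \<open>auto simp: g_def\<close>)
  also have "\<dots> = (cadj G * G) $$ (0,0)" by (rule mat_mult_entry[symmetric]) (use Gc de in auto)
  also have "\<dots> = 1" using de by (simp add: unitary_left[OF G])
  also have "(\<Sum>i<?D. \<Sum>j<?D. 1/5 * (cnj (g i) * Q $$ (i,j) * g j)) = 1/5 * (\<Sum>i<?D. \<Sum>j<?D. cnj (g i) * Q $$ (i,j) * g j)"
    by (simp add: sum_distrib_left)
  also have "(\<Sum>i<?D. \<Sum>j<?D. cnj (g i) * Q $$ (i,j) * g j)
      = (\<Sum>i<d. \<Sum>l<e. \<Sum>j<d. \<Sum>l'<e. if l' = l then cnj (g (i*e+l)) * proj d v $$ (i,j) * g (j*e+l) else 0)"
    unfolding sum_lessThan_mult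
  proof (intro sum.cong refl)
    fix i l j l' assume "i \<in> {..<d}" "l \<in> {..<e}" "j \<in> {..<d}" "l' \<in> {..<e}"
    then have h: "i < d" "l < e" "j < d" "l' < e" by auto
    have dm: "(i*e+l) div e = i" "(i*e+l) mod e = l" "(j*e+l') div e = j" "(j*e+l') mod e = l'" using h by auto
    show "cnj (g (i*e+l)) * Q $$ (i*e+l, j*e+l') * g (j*e+l') =
      (if l' = l then cnj (g (i*e+l)) * proj d v $$ (i,j) * g (j*e+l) else 0)"
      unfolding Q_def kron_entry[OF proj_carrier one_carrier_mat mult_add_less[OF h(1,2)] mult_add_less[OF h(3,4)]] dm
      using h by auto
  qed
  also have "\<dots> = (\<Sum>i<d. \<Sum>l<e. \<Sum>j<d. cnj (g (i*e+l)) * proj d v $$ (i,j) * g (j*e+l))" by simp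
  also have "\<dots> = (\<Sum>i<d. \<Sum>j<d. \<Sum>l<e. cnj (g (i*e+l)) * proj d v $$ (i,j) * g (j*e+l))"
    by (intro sum.cong refl sum.swap)
  also have "\<dots> = (\<Sum>i<d. \<Sum>j<d. cnj (v j) * \<rho> $$ (j,i) * v i / ?s)"
  proof (intro sum.cong refl)
    fix i j assume "i \<in> {..<d}" "j \<in> {..<d}"
    then have ij: "i < d" "j < d" by auto
    have "(\<Sum>l<e. cnj (g (i*e+l)) * proj d v $$ (i,j) * g (j*e+l)) = proj d v $$ (i,j) * \<rho> $$ (j,i)"
      unfolding \<rho>[OF ij(2,1)] sum_distrib_left by (intro sum.cong) (auto simp: g_def)
    then show "(\<Sum>l<e. cnj (g (i*e+l)) * proj d v $$ (i,j) * g (j*e+l)) = cnj (v j) * \<rho> $$ (j,i) * v i / ?s"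
      using ij by (simp add: proj_def)
  qed
  also have "\<dots> = sesq d \<rho> v v / ?s"
    unfolding sesq_def sum_divide_distrib by (rule sum.swap)
  finally show ?thesis by (simp add: add.commute)
qed

lemma purifies_entry:
  assumes G: "unitary_mat (2^(n+a)) G" and p: "purifies n a G \<rho>" and ij: "i < 2^n" "j < 2^n"
  shows "\<rho> $$ (i,j) = (\<Sum>l<2^a. G $$ (i * 2^a + l, 0) * cnj (G $$ (j * 2^a + l, 0)))"
proof -
  let ?D = "2^(n+a) :: nat"
  note Gc = unitary_carrier[OF G]
  define P :: "complex mat" where "P = mat ?D ?D (\<lambda>(i,j). (if i = 0 \<and> j = 0 then 1 else 0))"
  have Pc: "P \<in> carrier_mat ?D ?D" by (simp add: P_def)
  have \<rho>: "\<rho> = ptrace2 (2^n) (2^a) (G * P * cadj G)" using p by (simp add: purifies_def P_def Let_def)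
  have e: "(G * P * cadj G) $$ (x,y) = G $$ (x,0) * cnj (G $$ (y,0))" if xy: "x < ?D" "y < ?D" for x y
  proof -
    have GP: "(G * P) $$ (x,k) = (if k = 0 then G $$ (x,0) else 0)" if k: "k < ?D" for k
    proof -
      have "(G * P) $$ (x,k) = (\<Sum>l<?D. G $$ (x,l) * P $$ (l,k))" by (rule mat_mult_entry[OF Gc Pc xy(1) k])
      also have "\<dots> = (\<Sum>l<?D. if l = 0 then (if k = 0 then G $$ (x,0) else 0) else 0)"
        by (rule sum.cong) (use k in \<open>auto simp: P_def\<close>)
      finally show ?thesis by simp
    qed
    have "(G * P * cadj G) $$ (x,y) = (\<Sum>k<?D. (G * P) $$ (x,k) * cadj G $$ (k,y))"
      by (rule mat_mult_entry[of _ ?D ?D]) (use Gc Pc xy in auto)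
    also have "\<dots> = (\<Sum>k<?D. if k = 0 then G $$ (x,0) * cnj (G $$ (y,0)) else 0)"
      by (rule sum.cong) (use Gc xy in \<open>auto simp: GP simp del: index_mult_mat(1)\<close>)
    finally show ?thesis by simp
  qed
  have b: "x * 2^a + l < ?D" if "x < 2^n" "l < 2^a" for x l
    using mult_add_less[OF that] by (simp add: power_add)
  show ?thesis unfolding \<rho> ptrace2_def using ij by (simp add: e b del: index_mult_mat(1))
qed

lemma overlap_bounds:
  assumes "psd d \<rho>" "mtrace \<rho> = 1" "sqnorm d v \<noteq> 0"
  shows "0 \<le> overlap d \<rho> v" "overlap d \<rho> v \<le> 1" "Im (sesq d \<rho> v v) = 0"
proof -
  have s: "0 < sqnorm d v" using assms(3) by (simp add: sqnorm_def less_le sum_nonneg)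
  show "Im (sesq d \<rho> v v) = 0" using assms(1) by (simp add: psd_iff)
  have nn: "0 \<le> Re (sesq d \<rho> v v)" using assms(1) by (simp add: psd_iff)
  then show "0 \<le> overlap d \<rho> v" using s by (simp add: overlap_def)
  have d: "0 < d" using s by (cases d) (auto simp: sqnorm_def)
  \<comment> \<open>The vector v as column 0 of an otherwise zero matrix: its expectation becomes |R
    M|^2, bounded by |R|^2 |M|^2 = |v|^2.\<close>
  define M where "M = mat d d (\<lambda>(i,j). if j = 0 then v i else 0)"
  have M: "M \<in> carrier_mat d d" by (simp add: M_def)
  define R where "R = msqrt d \<rho>"
  note R = msqrt[OF assms(1), folded R_def]
  note c = psd_carrier[OF R(1)] psd_carrier[OF assms(1)]
  have fR: "frob R = 1" using frob_psd_eq_1[OF R(1)] R(2) assms(2) by simp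
  have M0: "M $$ (i,0) = v i" if "i < d" for i using that d by (simp add: M_def)
  have fM: "(frob M)\<^sup>2 = sqnorm d v"
  proof -
    have "(frob M)\<^sup>2 = (\<Sum>i<d. \<Sum>j<d. if j = 0 then (cmod (v i))\<^sup>2 else 0)"
      unfolding frob_sq[OF M] by (intro sum.cong) (auto simp: M_def)
    then show ?thesis using d by (simp add: sqnorm_def)
  qed
  have "mtrace (cadj M * (\<rho> * M)) = (\<Sum>i<d. \<Sum>j<d. cnj (M $$ (i,j)) * (\<rho> * M) $$ (i,j))"
    by (rule mtrace_cadj_mult) (use M c in auto)
  also have "\<dots> = (\<Sum>i<d. \<Sum>j<d. if j = 0 then cnj (v i) * (\<rho> * M) $$ (i,0) else 0)"
    by (intro sum.cong) (auto simp: M_def simp del: index_mult_mat(1))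
  also have "\<dots> = (\<Sum>i<d. cnj (v i) * (\<rho> * M) $$ (i,0))" using d by (simp del: index_mult_mat(1))
  also have "\<dots> = sesq d \<rho> v v"
    unfolding sesq_def
    by (intro sum.cong refl) (use d in \<open>simp add: mat_mult_entry[OF c(2) M] sum_distrib_left M0 mult.assoc del: index_mult_mat(1)\<close>)
  finally have "complex_of_real ((frob (R * M))\<^sup>2) = sesq d \<rho> v v"
    using sqrt_form[OF R(1) M] R(2) by simp
  then have "Re (sesq d \<rho> v v) = (frob (R * M))\<^sup>2" by (metis Re_complex_of_real)
  also have "\<dots> \<le> (frob R * frob M)\<^sup>2" by (intro power_mono frob_mult_le[OF c(1) M]) auto
  finally have "Re (sesq d \<rho> v v) \<le> sqnorm d v" by (simp add: fR fM)
  then show "overlap d \<rho> v \<le> 1" using s by (simp add: overlap_def)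
qed

text \<open>One Chebyshev round uses the oracle and its adjoint once each, hence 2 * j queries. The
  extra qubit in \<open>m\<close> is the one acted on by the tilts.\<close>

lemma reach_probe:
  fixes n :: nat and anc :: "oracle_sel \<Rightarrow> nat" and s :: oracle_sel
  assumes v: "sqnorm (2^n) v \<noteq> 0"
  defines "m \<equiv> n + anc s + 1"
  shows "\<exists>f. reach n anc m (2 * j) f \<and> (\<forall>W \<rho>. gates_ok n anc W \<longrightarrow> density n \<rho> \<longrightarrow> purifies n (anc s) (W s) \<rho> \<longrightarrow>
     f W $ 0 = complex_of_real (cos (j * arccos ((3 + overlap (2^n) \<rho> v) / 5))))"
proof -
  let ?d = "2^n :: nat" and ?e = "2^anc s :: nat" and ?D = "2^m :: nat"
  have De: "?d * ?e * 2 = ?D" by (simp add: m_def power_add)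
  define X where "X = probe ?d ?e v"
  have X: "unitary_mat ?D X" using unitary_probe[OF v, of ?e] by (simp add: X_def De)
  define E where "E W = embed m (W s)" for W :: "oracle_sel \<Rightarrow> complex mat"
  \<comment> \<open>A unitary conjugate of an involution, so again an involution; its entry (0,0) is
    the expectation of the probe in the prepared state.\<close>
  define R where "R W = cadj (E W) * (X * E W)" for W
  define f where "f j W = (cheb_step ?D (R W) ^^ j) (unit_vec ?D 0)" for j W
  have m: "n + anc s \<le> m" by (simp add: m_def)
  have Wu: "unitary_mat (2^(n + anc s)) (W s)" if "gates_ok n anc W" for W using that by (simp add: gates_ok_def)
  have E: "unitary_mat ?D (E W)" if "gates_ok n anc W" for W
    unfolding E_def by (rule unitary_embed[OF Wu[OF that] m])
  have Ek: "E W = kron (W s) (1\<^sub>m 2)" if "gates_ok n anc W" for W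
    unfolding E_def using embed_eq[OF Wu[OF that] m] by (simp add: m_def)
  have Ea: "embed m (cadj (W s)) = cadj (E W)" if "gates_ok n anc W" for W
    using embed_eq[OF unitary_cadj[OF Wu[OF that]] m] cadj_kron[OF unitary_carrier[OF Wu[OF that]] one_carrier_mat, of 2]
    by (simp add: Ek[OF that] m_def)
  have Rc: "R W \<in> carrier_mat ?D ?D" if "gates_ok n anc W" for W
    unfolding R_def using unitary_carrier[OF X] unitary_carrier[OF E[OF that]] by simp
  have RR: "R W * R W = 1\<^sub>m ?D" if W: "gates_ok n anc W" for W
  proof -
    note c = unitary_carrier[OF X] unitary_carrier[OF E[OF W]]
    have "R W * R W = cadj (E W) * (X * ((E W * cadj (E W)) * (X * E W)))"
      unfolding R_def using c by (simp add: assoc_mult_mat[of _ ?D ?D _ ?D _ ?D])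
    also have "\<dots> = cadj (E W) * (X * X * E W)" using c by (simp add: unitary_right[OF E[OF W]])
    also have "X * X = 1\<^sub>m ?D" using probe_involution[OF v, of ?e] by (simp add: X_def De)
    finally show ?thesis using c by (simp add: unitary_left[OF E[OF W]])
  qed
  have reach: "reach n anc m (2 * j) (f j)"
  proof (induction j)
    case 0
    show ?case unfolding f_def using reach.init[of n anc m] by simp
  next
    case (Suc j)
    have "reach n anc m (Suc (Suc (2 * j))) (\<lambda>W. refl0 ?D *\<^sub>v (embed m (query_gate QAdj (W s)) *\<^sub>v
        (X *\<^sub>v (embed m (query_gate QPlain (W s)) *\<^sub>v f j W))))"
      by (intro reach.unit[OF _ unitary_refl0] reach.query[where n = n and anc = anc and m = m and s = s, OF _ m] reach.unit[OF _ X] Suc) auto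
    then have "reach n anc m (Suc (Suc (2 * j))) (f (Suc j))"
    proof (rule reach.cong)
      fix W assume W: "gates_ok n anc W"
      note c = unitary_carrier[OF X] unitary_carrier[OF E[OF W]]
      have fj: "f j W \<in> carrier_vec ?D" using reach_norm[OF Suc W] by simp
      have "R W *\<^sub>v f j W = cadj (E W) *\<^sub>v (X *\<^sub>v (E W *\<^sub>v f j W))"
        unfolding R_def using c fj by (simp add: assoc_mult_mat_vec[of _ ?D ?D _ ?D])
      then show "f (Suc j) W = refl0 ?D *\<^sub>v (embed m (query_gate QAdj (W s)) *\<^sub>v
        (X *\<^sub>v (embed m (query_gate QPlain (W s)) *\<^sub>v f j W)))"
        by (simp add: f_def cheb_step_def Ea[OF W] E_def)
    qed
    then show ?case by simp
  qed
  show ?thesis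
  proof (intro exI conjI allI impI)
    show "reach n anc m (2 * j) (f j)" by (rule reach)
    fix W \<rho> assume W: "gates_ok n anc W" and \<rho>: "density n \<rho>" and p: "purifies n (anc s) (W s) \<rho>"
    note c = unitary_carrier[OF X] unitary_carrier[OF E[OF W]]
    define w where "w = (\<lambda>k. kron (W s) (1\<^sub>m 2) $$ (k,0))"
    have psd: "psd ?d \<rho>" "mtrace \<rho> = 1" using \<rho> by (auto simp: density_def)
    note ob = overlap_bounds[OF psd v]
    define a where "a = (3 + overlap ?d \<rho> v) / 5"
    have G: "unitary_mat (?d * ?e) (W s)" using Wu[OF W] by (simp add: power_add)
    have "R W $$ (0,0) = (\<Sum>k<?D. cadj (E W) $$ (0,k) * (X * E W) $$ (k,0))"
      unfolding R_def by (rule mat_mult_entry) (use c in auto)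
    also have "\<dots> = (\<Sum>k<?D. \<Sum>l<?D. cnj (w k) * X $$ (k,l) * w l)"
    proof (rule sum.cong[OF refl])
      fix k assume "k \<in> {..<?D}"
      then have k: "k < ?D" by simp
      have "cadj (E W) $$ (0,k) * (X * E W) $$ (k,0) = cnj (w k) * (\<Sum>l<?D. X $$ (k,l) * w l)"
        using mat_mult_entry[OF c k, of 0] c k by (simp add: w_def Ek[OF W] del: index_mult_mat(1))
      then show "cadj (E W) $$ (0,k) * (X * E W) $$ (k,0) = (\<Sum>l<?D. cnj (w k) * X $$ (k,l) * w l)"
        by (simp add: sum_distrib_left mult.assoc)
    qed
    also have "\<dots> = sesq (?d * ?e * 2) (probe ?d ?e v) w w" by (simp only: sesq_def De X_def)
    also have "\<dots> = 3/5 + 1/5 * (sesq ?d \<rho> v v / complex_of_real (sqnorm ?d v))"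
      unfolding w_def by (rule probe_expectation[OF G _ purifies_entry[OF Wu[OF W] p]]) simp
    also have "sesq ?d \<rho> v v = complex_of_real (Re (sesq ?d \<rho> v v))"
      using ob(3) by (simp add: complex_eq_iff)
    finally have "R W $$ (0,0) = complex_of_real a"
      by (simp add: a_def overlap_def add_divide_distrib)
    also have "a = cos (arccos a)" using ob by (intro cos_arccos[symmetric]) (auto simp: a_def)
    finally show "f j W $ 0 = complex_of_real (cos (j * arccos ((3 + overlap ?d \<rho> v) / 5)))"
      using cheb_iterate[OF Rc[OF W] RR[OF W], of "arccos a" j] by (simp add: f_def a_def)
  qed
qed

section \<open>Reconstructing the states\<close>

text \<open>Read off from \<open>sesq_pairfun\<close> at the identity matrix. For equal indices the
  vector is (1 + c) e_i, of squared length 4 for c = 1 and 2 for c = \<i>.\<close>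

lemma sqnorm_pairfun:
  assumes "i < d" "j < d" "c \<in> {1, \<i>}"
  shows "sqnorm d (pairfun i j c) = (if i = j then (if c = 1 then 4 else 2) else 2)"
proof -
  let ?v = "pairfun i j c"
  have "complex_of_real (sqnorm d ?v) = (\<Sum>k<d. cnj (?v k) * ?v k)"
    unfolding sqnorm_def of_real_sum by (rule sum.cong) (auto simp: complex_norm_square mult.commute simp del: of_real_power)
  also have "\<dots> = (\<Sum>k<d. \<Sum>l<d. if l = k then cnj (?v k) * ?v k else 0)" by simp
  also have "\<dots> = sesq d (1\<^sub>m d) ?v ?v" unfolding sesq_def by (intro sum.cong refl) auto
  also have "\<dots> = (if i = j then 1 + c + cnj c + cnj c * c else 1 + cnj c * c)"
    unfolding sesq_pairfun[OF assms(1,2)] using assms(1,2) by simp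
  also have "\<dots> = complex_of_real (if i = j then (if c = 1 then 4 else 2) else 2)"
    using assms(3) by (auto simp: complex_eq_iff)
  finally show ?thesis by (simp only: of_real_eq_iff)
qed

text \<open>Polarization: equal indices bound the diagonal by \<eta>, then c = 1 and c = \<i> bound
  the real and imaginary part of each entry by 2 \<eta>. A squared entry is at most 8 \<eta>^2,
  rounded up to 9 \<eta>^2 for a rational constant.\<close>

lemma frob_diff_le_of_overlaps:
  assumes r: "psd d \<rho>" "psd d \<rho>'"
    and h: "\<And>i j c. i < d \<Longrightarrow> j < d \<Longrightarrow> c \<in> {1, \<i>} \<Longrightarrow>
      \<bar>overlap d \<rho> (pairfun i j c) - overlap d \<rho>' (pairfun i j c)\<bar> \<le> \<eta>"
  shows "frob (\<rho> - \<rho>') \<le> 3 * real d * \<eta>"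
proof (cases "d = 0")
  case True
  then have "\<rho> - \<rho>' \<in> carrier_mat 0 0" using psd_carrier[OF r(2)] by (simp add: minus_carrier_mat)
  then have "(frob (\<rho> - \<rho>'))\<^sup>2 = 0" by (simp add: frob_sq)
  then show ?thesis using True by simp
next
  case False
  have \<eta>: "0 \<le> \<eta>" using h[of 0 0 1] False by fastforce
  note c = psd_carrier[OF r(1)] psd_carrier[OF r(2)]
  define \<Delta> where "\<Delta> i j = \<rho> $$ (i,j) - \<rho>' $$ (i,j)" for i j
  have herm: "\<Delta> j i = cnj (\<Delta> i j)" if ij: "i < d" "j < d" for i j
  proof -
    have "\<rho> $$ (j,i) = cadj \<rho> $$ (j,i)" "\<rho>' $$ (j,i) = cadj \<rho>' $$ (j,i)"
      using psd_cadj[OF r(1)] psd_cadj[OF r(2)] by auto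
    then show ?thesis using c ij by (simp add: \<Delta>_def)
  qed
  have ov: "\<bar>Re (\<Delta> i i + x * \<Delta> i j + cnj x * \<Delta> j i + cnj x * x * \<Delta> j j)\<bar> \<le> sqnorm d (pairfun i j x) * \<eta>"
    if ij: "i < d" "j < d" "x \<in> {1, \<i>}" for i j x
  proof -
    let ?v = "pairfun i j x"
    have s: "0 < sqnorm d ?v" using sqnorm_pairfun[OF ij] by auto
    have "overlap d \<rho> ?v - overlap d \<rho>' ?v = Re (sesq d \<rho> ?v ?v - sesq d \<rho>' ?v ?v) / sqnorm d ?v"
      by (simp add: overlap_def diff_divide_distrib)
    also have "sesq d \<rho> ?v ?v - sesq d \<rho>' ?v ?v = \<Delta> i i + x * \<Delta> i j + cnj x * \<Delta> j i + cnj x * x * \<Delta> j j"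
      unfolding sesq_pairfun[OF ij(1,2)] \<Delta>_def by (simp add: algebra_simps)
    finally show ?thesis using h[OF ij] s by (simp add: pos_divide_le_eq mult.commute)
  qed
  have diag: "\<bar>Re (\<Delta> i i)\<bar> \<le> \<eta>" if "i < d" for i
    using ov[OF that that, of 1] sqnorm_pairfun[OF that that, of 1] by simp
  have e: "(cmod (\<Delta> i j))\<^sup>2 \<le> 9 * \<eta>\<^sup>2" if ij: "i < d" "j < d" for i j
  proof -
    have "\<bar>Re (\<Delta> i j)\<bar> \<le> 2 * \<eta> \<and> \<bar>Im (\<Delta> i j)\<bar> \<le> 2 * \<eta>"
    proof (cases "i = j")
      case True
      then have "Im (\<Delta> i j) = 0" using herm[OF ij] by (auto simp: complex_eq_iff)
      then show ?thesis using diag[OF ij(1)] True \<eta> by simp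
    next
      case False
      then show ?thesis
        using ov[OF ij, of 1] ov[OF ij, of \<i>] diag[OF ij(1)] diag[OF ij(2)] herm[OF ij]
          sqnorm_pairfun[OF ij, of 1] sqnorm_pairfun[OF ij, of \<i>] by auto
    qed
    then have "\<bar>Re (\<Delta> i j)\<bar>\<^sup>2 \<le> (2 * \<eta>)\<^sup>2" "\<bar>Im (\<Delta> i j)\<bar>\<^sup>2 \<le> (2 * \<eta>)\<^sup>2"
      by (intro power_mono; simp)+
    then have "(Re (\<Delta> i j))\<^sup>2 \<le> 4 * \<eta>\<^sup>2" "(Im (\<Delta> i j))\<^sup>2 \<le> 4 * \<eta>\<^sup>2"
      by (simp_all add: power_mult_distrib)
    then show ?thesis unfolding cmod_power2 using zero_le_power2[of \<eta>] by linarith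
  qed
  have "(frob (\<rho> - \<rho>'))\<^sup>2 = (\<Sum>i<d. \<Sum>j<d. (cmod ((\<rho> - \<rho>') $$ (i,j)))\<^sup>2)"
    by (rule frob_sq) (use c in \<open>simp add: minus_carrier_mat\<close>)
  also have "\<dots> \<le> (\<Sum>i<d. \<Sum>j<d. 9 * \<eta>\<^sup>2)"
  proof (intro sum_mono)
    fix i j assume "i \<in> {..<d}" "j \<in> {..<d}"
    then show "(cmod ((\<rho> - \<rho>') $$ (i,j)))\<^sup>2 \<le> 9 * \<eta>\<^sup>2" using e[of i j] c by (simp add: \<Delta>_def)
  qed
  also have "\<dots> = (3 * real d * \<eta>)\<^sup>2" by (simp add: power2_eq_square)
  finally show ?thesis by (rule power2_le_imp_le) (use \<eta> in simp)
qed

section \<open>The algorithm\<close>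

type_synonym query_index = "(oracle_sel \<times> nat \<times> nat \<times> complex) \<times> nat \<times> nat"

definition indices :: "nat \<Rightarrow> nat \<Rightarrow> query_index set" where
  "indices d K = ({OrRho, OrSigma} \<times> {..<d} \<times> {..<d} \<times> {1, \<i>}) \<times> ({..K} \<times> {..1})"

text \<open>The exact vacuum probability of a probe with 2^k + b rounds.\<close>

definition ideal :: "nat \<Rightarrow> (oracle_sel \<Rightarrow> complex mat) \<Rightarrow> query_index \<Rightarrow> real" where
  "ideal d st = (\<lambda>((s,i,j,c),(k,b)). (cos (real (2^k + b) * arccos ((3 + overlap d (st s) (pairfun i j c)) / 5)))\<^sup>2)"

text \<open>Mentions no oracle, so the post-processing can search among candidates without knowing
  one.\<close>

definition candidate :: "nat \<Rightarrow> (oracle_sel \<Rightarrow> real) \<Rightarrow> (oracle_sel \<Rightarrow> complex mat) \<Rightarrow> bool" where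
  "candidate n \<kappa> st \<longleftrightarrow> (\<forall>s. density n (st s) \<and>
     loewner_le (2^n) ((1 / complex_of_real (\<kappa> s)) \<cdot>\<^sub>m 1\<^sub>m (2^n)) (st s))"

text \<open>Two candidates within 1/25 of the same data have ideal values within 2/25, the tolerance
  of \<open>angle_recovery\<close>. Scaling by 5 gives overlap error 2/2^K, hence Frobenius error 6
  * 2^n/2^K. The one-sided bound is used in both directions.\<close>

lemma candidates_close:
  assumes st: "candidate n \<kappa> st" and st': "candidate n \<kappa> st'" and k: "\<And>s. \<kappa> s > 0"
    and z: "\<And>x. x \<in> indices (2^n) K \<Longrightarrow> \<bar>z x - ideal (2^n) st x\<bar> \<le> 1/25"
    and z': "\<And>x. x \<in> indices (2^n) K \<Longrightarrow> \<bar>z x - ideal (2^n) st' x\<bar> \<le> 1/25"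
  shows "fidelity (2^n) (st OrRho) (st OrSigma) - fidelity (2^n) (st' OrRho) (st' OrSigma)
    \<le> 6 * 2^n * (\<kappa> OrRho + \<kappa> OrSigma) / 2^K"
proof -
  let ?d = "2^n :: nat"
  have p: "psd ?d (st s)" "mtrace (st s) = 1" "psd ?d (st' s)" "mtrace (st' s) = 1" for s
    using st st' by (auto simp: candidate_def density_def)
  have f: "frob (st s - st' s) \<le> 6 * 2^n / 2^K" for s
  proof -
    have "frob (st s - st' s) \<le> 3 * real ?d * (2 / 2^K)"
    proof (rule frob_diff_le_of_overlaps[OF p(1,3)])
      fix i j c assume ijc: "i < ?d" "j < ?d" "c \<in> {1, \<i>}"
      let ?v = "pairfun i j c"
      have sn: "sqnorm ?d ?v \<noteq> 0" using sqnorm_pairfun[OF ijc] by auto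
      note b = overlap_bounds(1,2)[OF p(1,2) sn, of s] and b' = overlap_bounds(1,2)[OF p(3,4) sn, of s]
      have "\<bar>(3 + overlap ?d (st s) ?v) / 5 - (3 + overlap ?d (st' s) ?v) / 5\<bar> \<le> (2/5) / 2^K"
      proof (rule angle_recovery)
        fix k b :: nat assume kb: "k \<le> K" "b \<le> 1"
        have x: "((s,i,j,c),(k,b)) \<in> indices ?d K" using ijc kb by (cases s) (auto simp: indices_def)
        show "\<bar>(cos (real (2^k + b) * arccos ((3 + overlap ?d (st s) ?v) / 5)))\<^sup>2 -
          (cos (real (2^k + b) * arccos ((3 + overlap ?d (st' s) ?v) / 5)))\<^sup>2\<bar> \<le> 2/25"
          using z[OF x] z'[OF x] unfolding ideal_def prod.case by linarith
      qed (use b b' in auto)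
      then show "\<bar>overlap ?d (st s) ?v - overlap ?d (st' s) ?v\<bar> \<le> 2 / 2^K"
        by (simp add: field_simps abs_le_iff)
    qed
    then show ?thesis by simp
  qed
  have "fidelity ?d (st OrRho) (st OrSigma) - fidelity ?d (st' OrRho) (st' OrSigma)
    \<le> \<kappa> OrRho * frob (st OrRho - st' OrRho) + \<kappa> OrSigma * frob (st OrSigma - st' OrSigma)"
    by (rule fidelity_Lipschitz) (use p k st st' in \<open>auto simp: candidate_def\<close>)
  also have "\<dots> \<le> \<kappa> OrRho * (6 * 2^n / 2^K) + \<kappa> OrSigma * (6 * 2^n / 2^K)"
    by (intro add_mono mult_left_mono f less_imp_le[OF k])
  finally show ?thesis by (simp add: algebra_simps add_divide_distrib)
qed

text \<open>The targets \<open>q\<close> depend on the oracles alone; they are identified with the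
  ideal values of a pair of states only when the oracles purify that pair. The number 2500 is 4 *
  25^2, from the exponent c^2 r/4 at c = 1/25.\<close>

lemma estimates_indices:
  fixes n :: nat and anc :: "oracle_sel \<Rightarrow> nat"
  assumes r: "0 < r"
  shows "\<exists>q. estimates n anc (1/25) M (\<Sum>x\<in>indices (2^n) K. r * (2 * (2^fst (snd x) + snd (snd x))))
      (card (indices (2^n) K) * (2 * exp (- (r / 2500)))) (indices (2^n) K) q \<and>
    (\<forall>x\<in>indices (2^n) K. \<forall>W st. gates_ok n anc W \<longrightarrow>
       (\<forall>s. density n (st s) \<and> purifies n (anc s) (W s) (st s)) \<longrightarrow> q x W = ideal (2^n) st x)"
proof -
  let ?d = "2^n :: nat" and ?I = "indices (2^n) K"
  have "\<exists>f. reach n anc (n + anc (fst (fst x)) + 1) (2 * (2^fst (snd x) + snd (snd x))) f \<and>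
     (\<forall>W st. gates_ok n anc W \<longrightarrow> (\<forall>s. density n (st s) \<and> purifies n (anc s) (W s) (st s)) \<longrightarrow>
       (cmod (f W $ 0))\<^sup>2 = ideal ?d st x)" if x: "x \<in> ?I" for x
  proof -
    obtain s i j c k b where e: "x = ((s,i,j,c),(k,b))" by (metis prod.exhaust)
    have ij: "i < ?d" "j < ?d" "c \<in> {1, \<i>}" using x by (auto simp: e indices_def)
    have sn: "sqnorm ?d (pairfun i j c) \<noteq> 0" using sqnorm_pairfun[OF ij] by auto
    obtain f where f: "reach n anc (n + anc s + 1) (2 * (2^k + b)) f"
      "\<And>W \<rho>. gates_ok n anc W \<Longrightarrow> density n \<rho> \<Longrightarrow> purifies n (anc s) (W s) \<rho> \<Longrightarrow>
       f W $ 0 = complex_of_real (cos (real (2^k + b) * arccos ((3 + overlap ?d \<rho> (pairfun i j c)) / 5)))"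
      using reach_probe[OF sn, of anc s "2^k + b"] by blast
    show ?thesis
    proof (intro exI conjI allI impI)
      show "reach n anc (n + anc (fst (fst x)) + 1) (2 * (2^fst (snd x) + snd (snd x))) f" using f(1) by (simp add: e)
      fix W st assume W: "gates_ok n anc W" and st: "\<forall>s. density n (st s) \<and> purifies n (anc s) (W s) (st s)"
      have "f W $ 0 = complex_of_real (cos (real (2^k + b) * arccos ((3 + overlap ?d (st s) (pairfun i j c)) / 5)))"
        by (rule f(2)[OF W]) (use st in auto)
      then show "(cmod (f W $ 0))\<^sup>2 = ideal ?d st x" by (simp only: ideal_def e prod.case norm_of_real power2_abs)
    qed
  qed
  then obtain F where F: "\<And>x. x \<in> ?I \<Longrightarrow> reach n anc (n + anc (fst (fst x)) + 1) (2 * (2^fst (snd x) + snd (snd x))) (F x)"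
    "\<And>x W st. x \<in> ?I \<Longrightarrow> gates_ok n anc W \<Longrightarrow> (\<forall>s. density n (st s) \<and> purifies n (anc s) (W s) (st s)) \<Longrightarrow>
       (cmod (F x W $ 0))\<^sup>2 = ideal ?d st x"
    by metis
  define q where "q x W = (cmod (F x W $ 0))\<^sup>2" for x W
  have "estimates n anc (1/25) M (\<Sum>x\<in>?I. r * (2 * (2^fst (snd x) + snd (snd x)))) (card ?I * (2 * exp (- (r / 2500)))) ?I q"
  proof (rule estimates_finite)
    show "finite ?I" by (simp add: indices_def)
    fix x assume x: "x \<in> ?I"
    have e: "(1/25)\<^sup>2 * real r / 4 = r / 2500" by (simp add: power2_eq_square)
    show "estimates n anc (1/25) 0 (r * (2 * (2^fst (snd x) + snd (snd x)))) (2 * exp (- (r / 2500))) {x} q"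
      using estimates_repeat[OF F(1)[OF x] _ _ r, of "1/25" q x] unfolding e by (simp add: q_def)
  qed
  moreover have "q x W = ideal ?d st x"
    if "x \<in> ?I" "gates_ok n anc W" "\<forall>s. density n (st s) \<and> purifies n (anc s) (W s) (st s)" for x W st
    unfolding q_def by (rule F(2)[OF that])
  ultimately show ?thesis by (intro exI[of _ q] conjI ballI allI impI)
qed

lemma card_indices: "card (indices d K) = 8 * d\<^sup>2 * (K + 1)"
  by (simp add: indices_def card_cartesian_product power2_eq_square complex_eq_iff algebra_simps)

text \<open>The costs of the levels grow geometrically, so the top level dominates: 4 d^2 probes, 6
  * 2^k for the two multiples, and a factor 2 for the geometric sum.\<close>

lemma sum_indices:
  "(\<Sum>x\<in>indices d K. r * (2 * (2^fst (snd x) + snd (snd x)))) \<le> 48 * d\<^sup>2 * r * 2^K"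
proof -
  let ?A = "{OrRho, OrSigma} \<times> {..<d} \<times> {..<d} \<times> {1, \<i>}" and ?B = "{..K} \<times> {..1::nat}"
  have A: "card ?A = 4 * d\<^sup>2" by (simp add: card_cartesian_product power2_eq_square complex_eq_iff algebra_simps)
  have "(\<Sum>x\<in>indices d K. r * (2 * (2^fst (snd x) + snd (snd x)))) = (\<Sum>x\<in>?A. \<Sum>y\<in>?B. r * (2 * (2^fst y + snd y)))"
    unfolding indices_def by (simp only: sum.cartesian_product case_prod_unfold)
  also have "\<dots> = card ?A * (\<Sum>y\<in>?B. r * (2 * (2^fst y + snd y)))" by simp
  also have "(\<Sum>y\<in>?B. r * (2 * (2^fst y + snd y))) = (\<Sum>k\<le>K. \<Sum>b\<le>1. r * (2 * (2^k + b)))"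
    by (simp only: sum.cartesian_product case_prod_unfold)
  also have "\<dots> \<le> (\<Sum>k\<le>K. r * (6 * 2^k))"
  proof (intro sum_mono)
    fix k
    have "2 * p + 2 * (p + 1) \<le> 6 * p" if "1 \<le> p" for p :: nat using that by simp
    from this[of "2^k"] have "2 * 2^k + 2 * (2^k + 1) \<le> 6 * (2::nat)^k" by simp
    then have "r * (2 * 2^k + 2 * (2^k + 1)) \<le> r * (6 * 2^k)" by (rule mult_le_mono2)
    then show "(\<Sum>b\<le>1. r * (2 * (2^k + b))) \<le> r * (6 * 2^k)" by (simp add: algebra_simps)
  qed
  also have "\<dots> = r * 6 * (\<Sum>k\<le>K. 2^k)" by (simp add: sum_distrib_left mult.assoc)
  also have "(\<Sum>k\<le>K. (2::nat)^k) \<le> 2 * 2^K" by (induction K) auto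
  finally have "(\<Sum>x\<in>indices d K. r * (2 * (2^fst (snd x) + snd (snd x)))) \<le> card ?A * (r * 6 * (2 * 2^K))"
    by (simp add: mult_le_mono2)
  then show ?thesis unfolding A by (simp add: algebra_simps)
qed

lemma power2_between:
  fixes x :: real
  assumes "1 \<le> x" shows "\<exists>K. x \<le> 2^K \<and> 2^K \<le> 2 * x"
proof -
  have ex: "\<exists>K. x \<le> 2^K" using real_arch_pow[of 2 x] by (auto intro: less_imp_le)
  define K where "K = (LEAST K. x \<le> 2^K)"
  have K: "x \<le> 2^K" unfolding K_def by (rule LeastI_ex[OF ex])
  have "2^K \<le> 2 * x"
  proof (cases K)
    case (Suc L)
    have "\<not> x \<le> 2^L" using not_less_Least[of L "\<lambda>K. x \<le> 2^K"] Suc by (simp add: K_def)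
    then show ?thesis by (simp add: Suc)
  qed (use assms in simp)
  with K show ?thesis by blast
qed

lemma fidelity_estimation:
  fixes n :: nat and anc :: "oracle_sel \<Rightarrow> nat" and \<kappa> :: "oracle_sel \<Rightarrow> real"
  assumes k: "\<And>s. 2^n \<le> \<kappa> s" and \<epsilon>: "0 < \<epsilon>" "\<epsilon> < 1"
  shows "\<exists>m N f out. M \<le> m \<and> reach n anc m N f \<and>
    real N \<le> 1152 * 27501 * min ((\<kappa> OrRho)\<^sup>2) ((\<kappa> OrSigma)\<^sup>2) * \<kappa> OrRho * \<kappa> OrSigma / \<epsilon> * ln (\<kappa> OrRho + \<kappa> OrSigma + 1/\<epsilon>) \<and>
    (\<forall>W st. gates_ok n anc W \<longrightarrow> candidate n \<kappa> st \<longrightarrow> (\<forall>s. purifies n (anc s) (W s) (st s)) \<longrightarrow>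
      (\<Sum>z<2^m. (cmod (f W $ z))\<^sup>2 * (if \<bar>out z - fidelity (2^n) (st OrRho) (st OrSigma)\<bar> \<le> \<epsilon> then 0 else 1)) \<le> 1/3)"
proof -
  let ?\<kappa>1 = "\<kappa> OrRho" and ?\<kappa>2 = "\<kappa> OrSigma"
  define d :: real where "d = 2^n"
  define y where "y = ?\<kappa>1 + ?\<kappa>2 + 1/\<epsilon>"
  define L where "L = ln y"
  have d1: "1 \<le> d" by (simp add: d_def)
  have kd: "d \<le> \<kappa> s" for s using k[of s] by (simp add: d_def)
  have k1: "1 \<le> \<kappa> s" for s using d1 kd[of s] by linarith
  have k0: "0 < \<kappa> s" for s using k1[of s] by linarith
  have ie: "1 < 1/\<epsilon>" using \<epsilon> by simp
  have y3: "3 \<le> y" using k1[of OrRho] k1[of OrSigma] ie by (simp add: y_def)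
  have "exp 1 \<le> y" using exp_le y3 by linarith
  then have L1: "1 \<le> L" unfolding L_def using y3 by (simp add: ln_ge_iff)
  have "1 \<le> 6 * d * (?\<kappa>1 + ?\<kappa>2) / \<epsilon>"
  proof -
    have "1 * 1 \<le> (6 * d) * (?\<kappa>1 + ?\<kappa>2)" by (intro mult_mono) (use d1 k1[of OrRho] k1[of OrSigma] in auto)
    then show ?thesis using \<epsilon> by (simp add: field_simps)
  qed
  \<comment> \<open>The lower bound pushes the error of \<open>candidates_close\<close> below
    \<epsilon>; the upper bound limits the cost of rounding to a power of two.\<close>
  then obtain K where K: "6 * d * (?\<kappa>1 + ?\<kappa>2) / \<epsilon> \<le> 2^K" "2^K \<le> 2 * (6 * d * (?\<kappa>1 + ?\<kappa>2) / \<epsilon>)"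
    using power2_between by blast
  \<comment> \<open>Six times the number of tests: with \<open>r\<close> repetitions each test fails
    with probability at most 2/B, so the union bound gives 1/3.\<close>
  define B :: real where "B = 48 * d\<^sup>2 * (K + 1)"
  have B1: "1 < B"
  proof -
    have "1 * 1 \<le> d\<^sup>2 * (K + 1)" by (intro mult_mono) (use d1 in auto)
    then show ?thesis by (simp add: B_def)
  qed
  define r where "r = nat \<lceil>2500 * ln B\<rceil>"
  have lnB: "0 < ln B" using B1 by simp
  then have r: "0 < r" "2500 * ln B \<le> r" "r \<le> 2500 * ln B + 1" by (auto simp: r_def)
  obtain q where q: "estimates n anc (1/25) M (\<Sum>x\<in>indices (2^n) K. r * (2 * (2^fst (snd x) + snd (snd x))))
      (card (indices (2^n) K) * (2 * exp (- (r / 2500)))) (indices (2^n) K) q"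
    "\<And>x W st. x \<in> indices (2^n) K \<Longrightarrow> gates_ok n anc W \<Longrightarrow>
       (\<forall>s. density n (st s) \<and> purifies n (anc s) (W s) (st s)) \<Longrightarrow> q x W = ideal (2^n) st x"
    using estimates_indices[OF r(1), of n anc M K] by blast
  define N where "N = (\<Sum>x\<in>indices (2^n) K. r * (2 * (2^fst (snd x) + snd (snd x))))"
  obtain m f z where m: "M \<le> m" "reach n anc m N f"
    "\<And>W. gates_ok n anc W \<Longrightarrow> (\<Sum>t<2^m. (cmod (f W $ t))\<^sup>2 * (if \<forall>x\<in>indices (2^n) K. \<bar>z t x - q x W\<bar> \<le> 1/25 then 0 else 1))
       \<le> card (indices (2^n) K) * (2 * exp (- (r / 2500)))"
    using q(1) unfolding estimates_def N_def by blast
  \<comment> \<open>If every test succeeds, the true pair is \<open>good\<close>, so the choice in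
    \<open>out\<close> returns a \<open>good\<close> pair, possibly a different one;
    \<open>candidates_close\<close> makes its fidelity just as acceptable.\<close>
  define good where "good t st \<longleftrightarrow> candidate n \<kappa> st \<and> (\<forall>x\<in>indices (2^n) K. \<bar>z t x - ideal (2^n) st x\<bar> \<le> 1/25)" for t st
  define out where "out t = (let st = (SOME st. good t st) in fidelity (2^n) (st OrRho) (st OrSigma))" for t
  have fail: "card (indices (2^n) K) * (2 * exp (- (r / 2500))) \<le> 1/3"
  proof -
    have "B = exp (ln B)" using B1 by simp
    also have "\<dots> \<le> exp (r / 2500)" using r(2) by simp
    finally have "B * exp (- (r / 2500)) \<le> exp (r / 2500) * exp (- (r / 2500))" by (intro mult_right_mono) auto
    also have "\<dots> = 1" by (simp add: mult_exp_exp)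
    finally have "B * exp (- (r / 2500)) \<le> 1" .
    moreover have card: "real (card (indices (2^n) K)) = B / 6" unfolding card_indices by (simp add: B_def d_def algebra_simps)
    ultimately show ?thesis unfolding card by simp
  qed
  have N: "real N \<le> 1152 * 27501 * min (?\<kappa>1\<^sup>2) (?\<kappa>2\<^sup>2) * ?\<kappa>1 * ?\<kappa>2 / \<epsilon> * L"
  proof -
    \<comment> \<open>For each of the two summands, d^2 is replaced by \<mu> and the remaining d by
      the other of the two bounds, so d^3 (\<kappa>1 + \<kappa>2) is at most 2 \<mu> \<kappa>1
      \<kappa>2.\<close>
    define \<mu> where "\<mu> = min (?\<kappa>1\<^sup>2) (?\<kappa>2\<^sup>2)"
    have "d\<^sup>2 \<le> \<mu>" unfolding \<mu>_def by (intro min.boundedI power_mono kd) (use d1 in auto)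
    have "d\<^sup>2 * (d * ?\<kappa>1) \<le> \<mu> * (?\<kappa>2 * ?\<kappa>1)"
      by (intro mult_mono \<open>d\<^sup>2 \<le> \<mu>\<close> mult_right_mono[OF kd]) (use d1 k0[of OrRho] in \<open>auto simp: \<mu>_def\<close>)
    moreover have "d\<^sup>2 * (d * ?\<kappa>2) \<le> \<mu> * (?\<kappa>1 * ?\<kappa>2)"
      by (intro mult_mono \<open>d\<^sup>2 \<le> \<mu>\<close> mult_right_mono[OF kd]) (use d1 k0[of OrSigma] in \<open>auto simp: \<mu>_def\<close>)
    ultimately have dk: "d\<^sup>2 * d * (?\<kappa>1 + ?\<kappa>2) \<le> 2 * (\<mu> * ?\<kappa>1 * ?\<kappa>2)" by (simp add: algebra_simps)
    have \<mu>0: "0 \<le> \<mu> * ?\<kappa>1 * ?\<kappa>2" using k0[of OrRho] k0[of OrSigma] by (simp add: \<mu>_def)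
    \<comment> \<open>Only a power of y is needed for B: 576 is at most 3^6, hence at most y^6, and
      the other factors give y^5. So ln B \<le> 11 L, and r \<le> 2500 * 11 L + 1 \<le> 27501
      L.\<close>
    have KK: "real K + 1 \<le> 2^K" by (induction K) auto
    have "B \<le> 48 * d\<^sup>2 * 2^K" unfolding B_def using KK by (intro mult_left_mono) auto
    also have "\<dots> \<le> 48 * d\<^sup>2 * (2 * (6 * d * (?\<kappa>1 + ?\<kappa>2) / \<epsilon>))" by (intro mult_left_mono K) auto
    also have "\<dots> = 576 * (d\<^sup>2 * d * (?\<kappa>1 + ?\<kappa>2) * (1/\<epsilon>))" by simp
    also have "d\<^sup>2 * d * (?\<kappa>1 + ?\<kappa>2) * (1/\<epsilon>) \<le> y\<^sup>2 * y * y * y"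
    proof -
      have "d \<le> y" using kd[of OrRho] k0[of OrSigma] ie by (simp add: y_def)
      moreover have "?\<kappa>1 + ?\<kappa>2 \<le> y" "1/\<epsilon> \<le> y" using \<epsilon> k0[of OrRho] k0[of OrSigma] by (auto simp: y_def)
      ultimately show ?thesis
        using d1 y3 ie \<epsilon> k0[of OrRho] k0[of OrSigma] by (intro mult_mono power_mono) auto
    qed
    also have "(576::real) \<le> 3^6" by simp
    also have "(3::real)^6 \<le> y^6" by (rule power_mono[OF y3]) simp
    finally have "B \<le> y^6 * (y\<^sup>2 * y * y * y)" using y3 by (simp add: mult_right_mono)
    also have "\<dots> = y^11" by (simp add: power_numeral_reduce)
    finally have "ln B \<le> ln (y^11)" using B1 y3 by simp
    also have "\<dots> = 11 * L" using y3 by (simp add: L_def ln_realpow)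
    finally have "r \<le> 27501 * L" using r(3) L1 by linarith
    have "real N \<le> real (48 * (2^n)\<^sup>2 * r * 2^K)" unfolding N_def by (intro of_nat_mono sum_indices)
    also have "\<dots> = 48 * d\<^sup>2 * r * 2^K" by (simp add: d_def)
    also have "\<dots> \<le> 48 * d\<^sup>2 * r * (2 * (6 * d * (?\<kappa>1 + ?\<kappa>2) / \<epsilon>))" by (intro mult_left_mono K) auto
    also have "\<dots> = 576 / \<epsilon> * r * (d\<^sup>2 * d * (?\<kappa>1 + ?\<kappa>2))" by simp
    also have "\<dots> \<le> 576 / \<epsilon> * r * (2 * (\<mu> * ?\<kappa>1 * ?\<kappa>2))" using \<epsilon> by (intro mult_left_mono dk) auto
    also have "\<dots> = 1152 * (\<mu> * ?\<kappa>1 * ?\<kappa>2) / \<epsilon> * r" by simp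
    also have "\<dots> \<le> 1152 * (\<mu> * ?\<kappa>1 * ?\<kappa>2) / \<epsilon> * (27501 * L)"
      using \<open>r \<le> 27501 * L\<close> \<epsilon> \<mu>0 by (intro mult_left_mono) auto
    finally show ?thesis by (simp add: \<mu>_def mult_ac)
  qed
  have bad: "(\<Sum>t<2^m. (cmod (f W $ t))\<^sup>2 * (if \<bar>out t - fidelity (2^n) (st OrRho) (st OrSigma)\<bar> \<le> \<epsilon> then 0 else 1)) \<le> 1/3"
    if W: "gates_ok n anc W" and st: "candidate n \<kappa> st" and p: "\<forall>s. purifies n (anc s) (W s) (st s)" for W st
  proof -
    have qi: "q x W = ideal (2^n) st x" if "x \<in> indices (2^n) K" for x
      by (rule q(2)[OF that W]) (use st p in \<open>auto simp: candidate_def\<close>)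
    have close: "6 * 2^n * (?\<kappa>1 + ?\<kappa>2) / 2^K \<le> \<epsilon>"
      using K(1) \<epsilon> by (simp add: d_def field_simps)
    have "\<bar>out t - fidelity (2^n) (st OrRho) (st OrSigma)\<bar> \<le> \<epsilon>" if "\<forall>x\<in>indices (2^n) K. \<bar>z t x - q x W\<bar> \<le> 1/25" for t
    proof -
      have g: "good t st" using st that qi by (simp add: good_def)
      define st' where "st' = (SOME st. good t st)"
      have g': "good t st'" unfolding st'_def using someI[of "good t" st] g by simp
      have "fidelity (2^n) (st' OrRho) (st' OrSigma) - fidelity (2^n) (st OrRho) (st OrSigma) \<le> 6 * 2^n * (?\<kappa>1 + ?\<kappa>2) / 2^K"
        "fidelity (2^n) (st OrRho) (st OrSigma) - fidelity (2^n) (st' OrRho) (st' OrSigma) \<le> 6 * 2^n * (?\<kappa>1 + ?\<kappa>2) / 2^K"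
        by (rule candidates_close[where z = "z t"]; use g g' k0 in \<open>auto simp: good_def\<close>)+
      then show ?thesis using close by (simp add: out_def Let_def st'_def[symmetric] abs_le_iff)
    qed
    then have "(\<Sum>t<2^m. (cmod (f W $ t))\<^sup>2 * (if \<bar>out t - fidelity (2^n) (st OrRho) (st OrSigma)\<bar> \<le> \<epsilon> then 0 else 1))
      \<le> (\<Sum>t<2^m. (cmod (f W $ t))\<^sup>2 * (if \<forall>x\<in>indices (2^n) K. \<bar>z t x - q x W\<bar> \<le> 1/25 then 0 else 1))"
      by (intro sum_mono mult_left_mono) auto
    then show ?thesis using m(3)[OF W] fail by linarith
  qed
  show ?thesis
    by (intro exI[of _ m] exI[of _ N] exI[of _ f] exI[of _ out] conjI allI impI m(1,2) bad)
      (use N in \<open>auto simp: L_def y_def\<close>)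
qed

text \<open>The Loewner bound tested on the identity matrix reads d/\<kappa> \<le> tr \<rho> =
  1.\<close>

lemma loewner_density_dim:
  assumes "density n \<rho>" "loewner_le (2^n) ((1 / complex_of_real \<kappa>) \<cdot>\<^sub>m 1\<^sub>m (2^n)) \<rho>" "0 < \<kappa>"
  shows "2^n \<le> \<kappa>"
proof -
  let ?d = "2^n :: nat"
  have c: "\<rho> \<in> carrier_mat ?d ?d" and t: "mtrace \<rho> = 1" using assms(1) by (auto simp: density_def psd_def)
  have "(frob (1\<^sub>m ?d))\<^sup>2 = (\<Sum>i<?d. \<Sum>j<?d. if j = i then 1 else 0)"
    unfolding frob_sq[OF one_carrier_mat] by (intro sum.cong refl) auto
  then have "(frob (1\<^sub>m ?d))\<^sup>2 = 2^n" by simp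
  then show ?thesis using loewner_form[OF assms(2) one_carrier_mat] c t assms(3) by (simp add: field_simps)
qed

theorem mainTheorem9:
  "\<exists>C::real. \<exists>k::nat. C > 0 \<and>
    (\<forall>(n::nat) (ar::nat) (as::nat) (\<kappa>r::real) (\<kappa>s::real) (\<epsilon>::real).
      \<kappa>r \<ge> 1 \<longrightarrow> \<kappa>s \<ge> 1 \<longrightarrow> 0 < \<epsilon> \<longrightarrow> \<epsilon> < 1 \<longrightarrow>
      (\<exists>m U0 steps (out :: nat \<Rightarrow> real).
         valid_alg n ar as m U0 steps \<and>
         real (length steps) \<le> C * min (\<kappa>r^2) (\<kappa>s^2) * \<kappa>r * \<kappa>s / \<epsilon>
                                    * (ln (\<kappa>r + \<kappa>s + 1/\<epsilon>))^k \<and>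
         (\<forall>\<rho> \<sigma> Or Os.
            density n \<rho> \<longrightarrow> density n \<sigma> \<longrightarrow>
            loewner_le (2^n) ((1/complex_of_real \<kappa>r) \<cdot>\<^sub>m 1\<^sub>m (2^n)) \<rho> \<longrightarrow>
            loewner_le (2^n) ((1/complex_of_real \<kappa>s) \<cdot>\<^sub>m 1\<^sub>m (2^n)) \<sigma> \<longrightarrow>
            unitary_mat (2^(n+ar)) Or \<longrightarrow> purifies n ar Or \<rho> \<longrightarrow>
            unitary_mat (2^(n+as)) Os \<longrightarrow> purifies n as Os \<sigma> \<longrightarrow>
            out_prob Or Os m U0 steps out
               {x. \<bar>x - fidelity (2^n) \<rho> \<sigma>\<bar> \<le> \<epsilon>} \<ge> 2/3)))"
\<comment> \<open>The logarithm has power 1, as it enters only through the number of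
  repetitions.\<close>
proof (rule exI[of _ "1152 * 27501"], rule exI[of _ 1], intro conjI allI impI)
  fix n a1 a2 :: nat and \<kappa>1 \<kappa>2 \<epsilon> :: real
  assume k: "1 \<le> \<kappa>1" "1 \<le> \<kappa>2" and \<epsilon>: "0 < \<epsilon>" "\<epsilon> < 1"
  let ?M = "n + a1 + a2 + 1"
  show "\<exists>m U0 steps (out :: nat \<Rightarrow> real).
         valid_alg n a1 a2 m U0 steps \<and>
         real (length steps) \<le> 1152 * 27501 * min (\<kappa>1^2) (\<kappa>2^2) * \<kappa>1 * \<kappa>2 / \<epsilon>
                                    * (ln (\<kappa>1 + \<kappa>2 + 1/\<epsilon>))^1 \<and>
         (\<forall>\<rho> \<sigma> Or Os.
            density n \<rho> \<longrightarrow> density n \<sigma> \<longrightarrow>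
            loewner_le (2^n) ((1/complex_of_real \<kappa>1) \<cdot>\<^sub>m 1\<^sub>m (2^n)) \<rho> \<longrightarrow>
            loewner_le (2^n) ((1/complex_of_real \<kappa>2) \<cdot>\<^sub>m 1\<^sub>m (2^n)) \<sigma> \<longrightarrow>
            unitary_mat (2^(n+a1)) Or \<longrightarrow> purifies n a1 Or \<rho> \<longrightarrow>
            unitary_mat (2^(n+a2)) Os \<longrightarrow> purifies n a2 Os \<sigma> \<longrightarrow>
            out_prob Or Os m U0 steps out
               {x. \<bar>x - fidelity (2^n) \<rho> \<sigma>\<bar> \<le> \<epsilon>} \<ge> 2/3)"
  proof (cases "2^n \<le> \<kappa>1 \<and> 2^n \<le> \<kappa>2")
    \<comment> \<open>The dimension exceeds one of the bounds, so no pair of states is admissible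
      and a circuit without queries meets the claim vacuously.\<close>
    case False
    have "0 \<le> ln (\<kappa>1 + \<kappa>2 + 1/\<epsilon>)" using k \<epsilon> by (intro ln_ge_zero) (simp add: add_increasing2)
    then have "0 \<le> 1152 * 27501 * min (\<kappa>1^2) (\<kappa>2^2) * \<kappa>1 * \<kappa>2 / \<epsilon> * (ln (\<kappa>1 + \<kappa>2 + 1/\<epsilon>))^1"
      using k \<epsilon> by simp
    moreover have False if "density n \<rho>" "density n \<sigma>"
      "loewner_le (2^n) ((1/complex_of_real \<kappa>1) \<cdot>\<^sub>m 1\<^sub>m (2^n)) \<rho>"
      "loewner_le (2^n) ((1/complex_of_real \<kappa>2) \<cdot>\<^sub>m 1\<^sub>m (2^n)) \<sigma>" for \<rho> \<sigma>
      using False loewner_density_dim[OF that(1,3)] loewner_density_dim[OF that(2,4)] k by simp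
    ultimately show ?thesis
      by (intro exI[of _ ?M] exI[of _ "1\<^sub>m (2^?M)"] exI[of _ "[]"] exI[of _ "\<lambda>_. 0"])
        (auto simp: valid_alg_def unitary_one)
  next
    case True
    define anc where "anc s = (case s of OrRho \<Rightarrow> a1 | OrSigma \<Rightarrow> a2)" for s
    define \<kappa> where "\<kappa> s = (case s of OrRho \<Rightarrow> \<kappa>1 | OrSigma \<Rightarrow> \<kappa>2)" for s
    have ak: "anc OrRho = a1" "anc OrSigma = a2" "\<kappa> OrRho = \<kappa>1" "\<kappa> OrSigma = \<kappa>2" by (auto simp: anc_def \<kappa>_def)
    have kd: "2^n \<le> \<kappa> s" for s using True by (cases s) (auto simp: \<kappa>_def)
    obtain m N f out where m: "?M \<le> m" "reach n anc m N f"
      "real N \<le> 1152 * 27501 * min (\<kappa>1\<^sup>2) (\<kappa>2\<^sup>2) * \<kappa>1 * \<kappa>2 / \<epsilon> * ln (\<kappa>1 + \<kappa>2 + 1/\<epsilon>)"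
      and bad: "\<And>W st. gates_ok n anc W \<Longrightarrow> candidate n \<kappa> st \<Longrightarrow> (\<forall>s. purifies n (anc s) (W s) (st s)) \<Longrightarrow>
      (\<Sum>z<2^m. (cmod (f W $ z))\<^sup>2 * (if \<bar>out z - fidelity (2^n) (st OrRho) (st OrSigma)\<bar> \<le> \<epsilon> then 0 else 1)) \<le> 1/3"
      using fidelity_estimation[where n = n and anc = anc and \<kappa> = \<kappa> and M = ?M, OF kd \<epsilon>] unfolding ak by blast
    obtain U0 steps where c: "unitary_mat (2^m) U0" "length steps = N"
      "\<forall>(s,k,U)\<in>set steps. n + anc s \<le> m \<and> k \<in> {QPlain, QAdj} \<and> unitary_mat (2^m) U"
      "\<And>W. gates_ok n anc W \<Longrightarrow> final_state (W OrRho) (W OrSigma) m U0 steps = f W"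
      using reach_run[OF m(2)] by blast
    have "valid_alg n a1 a2 m U0 steps" using m(1) c(1,3) by (auto simp: valid_alg_def)
    moreover have "2/3 \<le> out_prob Or Os m U0 steps out {x. \<bar>x - fidelity (2^n) \<rho> \<sigma>\<bar> \<le> \<epsilon>}"
      if h: "density n \<rho>" "density n \<sigma>"
      "loewner_le (2^n) ((1/complex_of_real \<kappa>1) \<cdot>\<^sub>m 1\<^sub>m (2^n)) \<rho>"
      "loewner_le (2^n) ((1/complex_of_real \<kappa>2) \<cdot>\<^sub>m 1\<^sub>m (2^n)) \<sigma>"
      "unitary_mat (2^(n+a1)) Or" "purifies n a1 Or \<rho>" "unitary_mat (2^(n+a2)) Os" "purifies n a2 Os \<sigma>" for \<rho> \<sigma> Or Os
    proof -
      define W where "W s = sel_oracle s Or Os" for s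
      define st where "st s = sel_oracle s \<rho> \<sigma>" for s
      have ws: "W OrRho = Or" "W OrSigma = Os" "st OrRho = \<rho>" "st OrSigma = \<sigma>" by (auto simp: W_def st_def sel_oracle_def)
      have all: "(\<forall>s. P s) \<longleftrightarrow> P OrRho \<and> P OrSigma" for P by (metis oracle_sel.exhaust)
      have W: "gates_ok n anc W" using h by (simp add: gates_ok_def all ws ak)
      have cd: "candidate n \<kappa> st" using h by (simp add: candidate_def all ws ak)
      have pf: "\<forall>s. purifies n (anc s) (W s) (st s)" using h by (simp add: all ws ak)
      have b: "(\<Sum>z<2^m. (cmod (f W $ z))\<^sup>2 * (if \<bar>out z - fidelity (2^n) \<rho> \<sigma>\<bar> \<le> \<epsilon> then 0 else 1)) \<le> 1/3"
        using bad[OF W cd pf] unfolding ws .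
      have fs: "final_state Or Os m U0 steps = f W" using c(4)[OF W] by (simp add: ws)
      have "out_prob Or Os m U0 steps out {x. \<bar>x - fidelity (2^n) \<rho> \<sigma>\<bar> \<le> \<epsilon>}
        = (\<Sum>z\<in>{..<2^m} \<inter> {z. \<bar>out z - fidelity (2^n) \<rho> \<sigma>\<bar> \<le> \<epsilon>}. (cmod (f W $ z))\<^sup>2)"
        unfolding out_prob_def fs by (rule sum.cong) auto
      also have "\<dots> = (\<Sum>z<2^m. if z \<in> {z. \<bar>out z - fidelity (2^n) \<rho> \<sigma>\<bar> \<le> \<epsilon>} then (cmod (f W $ z))\<^sup>2 else 0)"
        by (rule sum.inter_restrict) simp
      also have "\<dots> = (\<Sum>z<2^m. (cmod (f W $ z))\<^sup>2 - (cmod (f W $ z))\<^sup>2 * (if \<bar>out z - fidelity (2^n) \<rho> \<sigma>\<bar> \<le> \<epsilon> then 0 else 1))"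
        by (rule sum.cong) auto
      also have "\<dots> = 1 - (\<Sum>z<2^m. (cmod (f W $ z))\<^sup>2 * (if \<bar>out z - fidelity (2^n) \<rho> \<sigma>\<bar> \<le> \<epsilon> then 0 else 1))"
        unfolding sum_subtractf using reach_norm[OF m(2) W] by simp
      finally show ?thesis using b by linarith
    qed
    ultimately show ?thesis using m(3) c(2)
      by (intro exI[of _ m] exI[of _ U0] exI[of _ steps] exI[of _ out]) simp
  qed
qed simp

end
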